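(* Let $K$ be a field of characteristic zero, let $\sigma$ be a $K$-linear automorphism of the ring $K[x]$ and let $d$ be a $K$-linear $\sigma$-derivation of $K[x]$. Let $q,b\in K$ be such that $\sigma(x)=qx+b$. The following statements are equivalent: (a) $S=K[x][\theta;\sigma,d]$ satisfies property $(\diamond)$; (b) $S\simeq K_q[x,y]$ or $S\simeq A_1^q(K)$ for $q$ a root of unity (including $q=1$); (c) $q\neq 1$ is a root of unity, or $q=1$ and $d(x)$ is a constant polynomial; (d) $\sigma\neq \mathrm{id}$ has finite order, or $\sigma=\mathrm{id}$ and $d$ is locally nilpotent.
   Context: A $\sigma$-derivation of $K[x]$ is an additive map $d$ with $d(ab)=\sigma(a)d(b)+d(a)b$ for all $a,b\in K[x]$. The Ore extension $K[x][\theta;\sigma,d]$ is the overring of $K[x]$ that is free as a left $K[x]$-module with basis $\{\theta^n\mid n\geq 0\}$, subject to $\theta a=\sigma(a)\theta+d(a)$ for all $a\in K[x]$. $K_q[x,y]=K\langle x,y\mid yx=qxy\rangle$ is the quantum plane, and $A_1^q(K)=K\langle x,y\mid yx=qxy+1\rangle$ is the quantum Weyl algebra (for $q=1$ these are the polynomial ring $K[x,y]$ and the first Weyl algebra). The map $d$ is locally nilpotent if for every $a\in K[x]$ there is $n>0$ with $d^n(a)=0$. A module is locally Artinian if each of its finitely generated submodules is Artinian. A ring $A$ satisfies property $(\diamond)$ if injective hulls of simple left $A$-modules are locally Artinian (equivalently, all finitely generated essential extensions of simple left $A$-modules are Artinian).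
   Formalization: In (c), the case q=1 also requires b=0 (σ=id): as printed, σ(x)=x+1, d=0 satisfies (c) but not (d). Injective hulls in (⋄) are taken, up to isomorphism, among modules whose elements are functions from S to the rationals. *)

theory Defs
  imports
    "HOL-Computational_Algebra.Polynomial"
    "HOL-Algebra.QuotRing"
    "HOL-Algebra.Module"
begin

section \<open>Ore extensions of the polynomial ring \<open>K[x]\<close>\<close>

definition ring_automorphism :: "('a::ring_1 \<Rightarrow> 'a) \<Rightarrow> bool" where
  "ring_automorphism \<sigma> \<longleftrightarrow> bij \<sigma> \<and> \<sigma> 1 = 1 \<and>
     (\<forall>a b. \<sigma> (a + b) = \<sigma> a + \<sigma> b) \<and> (\<forall>a b. \<sigma> (a * b) = \<sigma> a * \<sigma> b)"

definition sigma_derivation :: "('a::ring_1 \<Rightarrow> 'a) \<Rightarrow> ('a \<Rightarrow> 'a) \<Rightarrow> bool" where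
  "sigma_derivation \<sigma> d \<longleftrightarrow>
     (\<forall>a b. d (a + b) = d a + d b) \<and> (\<forall>a b. d (a * b) = \<sigma> a * d b + d a * b)"

abbreviation K_linear :: "('k::field poly \<Rightarrow> 'k poly) \<Rightarrow> bool" where
  "K_linear \<equiv> Vector_Spaces.linear Polynomial.smult Polynomial.smult"

text \<open>
  The Ore extension \<open>K[x][\<theta>;\<sigma>,d]\<close> is realised on the type \<open>'k poly poly\<close>: the outer variable is
  \<open>\<theta>\<close>, and \<open>p\<close> stands for \<open>\<Sum>n. coeff p n \<theta>\<^sup>n\<close> with coefficients on the left.  Left multiplication by
  \<open>\<theta>\<close> is forced by \<open>\<theta> a = \<sigma>(a) \<theta> + d(a)\<close>, and this determines the whole product.
\<close>

definition theta_mult ::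
    "('k::field poly \<Rightarrow> 'k poly) \<Rightarrow> ('k poly \<Rightarrow> 'k poly) \<Rightarrow> 'k poly poly \<Rightarrow> 'k poly poly" where
  "theta_mult \<sigma> d p = pCons 0 (map_poly \<sigma> p) + map_poly d p"

definition ore_mult ::
    "('k::field poly \<Rightarrow> 'k poly) \<Rightarrow> ('k poly \<Rightarrow> 'k poly) \<Rightarrow>
      'k poly poly \<Rightarrow> 'k poly poly \<Rightarrow> 'k poly poly" where
  "ore_mult \<sigma> d p q =
     (\<Sum>n\<le>degree p. Polynomial.smult (coeff p n) ((theta_mult \<sigma> d ^^ n) q))"

definition ore_extension ::
    "('k::field poly \<Rightarrow> 'k poly) \<Rightarrow> ('k poly \<Rightarrow> 'k poly) \<Rightarrow> 'k poly poly ring" where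
  "ore_extension \<sigma> d =
     \<lparr>carrier = UNIV, mult = ore_mult \<sigma> d, one = 1, zero = 0, add = (+)\<rparr>"

abbreviation ore_theta :: "'k::field poly poly" where
  "ore_theta \<equiv> [:0, 1:]"

definition ore_const :: "'k::field \<Rightarrow> 'k poly poly" where
  "ore_const c = [:[:c:]:]"

context
  fixes \<sigma> d :: "'k::field poly \<Rightarrow> 'k poly"
  assumes \<sigma>: "ring_automorphism \<sigma>" and d: "sigma_derivation \<sigma> d"
begin

private abbreviation "T \<equiv> theta_mult \<sigma> d"
private abbreviation "M \<equiv> ore_mult \<sigma> d"

private lemma s_add: "\<sigma> (a + b) = \<sigma> a + \<sigma> b" and s_mult: "\<sigma> (a * b) = \<sigma> a * \<sigma> b"
  and s_one: "\<sigma> 1 = 1"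
  using \<sigma> by (auto simp: ring_automorphism_def)

private lemma d_add: "d (a + b) = d a + d b" and d_mult: "d (a * b) = \<sigma> a * d b + d a * b"
  using d by (auto simp: sigma_derivation_def)

private lemma s_zero: "\<sigma> 0 = 0" using s_add[of 0 0] by (metis add_0 add_cancel_right_right)
private lemma d_zero: "d 0 = 0" using d_add[of 0 0] by (metis add_0 add_cancel_right_right)
private lemma d_one: "d 1 = 0" using d_mult[of 1 1] by (metis s_one mult_1 mult_1_right add_cancel_right_right)

private lemma coeff_T: "coeff (T p) n = (case n of 0 \<Rightarrow> 0 | Suc m \<Rightarrow> \<sigma> (coeff p m)) + d (coeff p n)"
  by (cases n) (simp_all add: theta_mult_def coeff_map_poly s_zero d_zero)

private lemma T_add: "T (p + q) = T p + T q"
  by (rule poly_eqI) (simp add: coeff_T s_add d_add algebra_simps split: nat.split)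

private lemma T_smult:
  "T (Polynomial.smult a p) = Polynomial.smult (\<sigma> a) (T p) + Polynomial.smult (d a) p"
  by (rule poly_eqI) (simp add: coeff_T s_mult d_mult algebra_simps split: nat.split)

private lemma T_zero: "T 0 = 0" using T_add[of 0 0] by (metis add_0 add_cancel_right_right)

private lemma Tn_add: "(T ^^ n) (p + q) = (T ^^ n) p + (T ^^ n) q"
  by (induction n) (simp_all add: T_add)

private lemma Tn_zero: "(T ^^ n) 0 = 0"
  by (induction n) (simp_all add: T_zero)

private lemma M_bound:
  assumes "degree p \<le> N"
  shows "M p q = (\<Sum>n\<le>N. Polynomial.smult (coeff p n) ((T ^^ n) q))"
  unfolding ore_mult_def using assms
  by (intro sum.mono_neutral_left) (auto simp: coeff_eq_0)

private lemma M_add_left: "M (p + p') q = M p q + M p' q"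
proof -
  let ?N = "max (degree p) (degree p')"
  have "degree (p + p') \<le> ?N" by (rule degree_add_le_max)
  then show ?thesis
    by (simp add: M_bound[of _ ?N] smult_add_left sum.distrib)
qed

private lemma M_add_right: "M p (q + q') = M p q + M p q'"
  by (simp add: ore_mult_def Tn_add smult_add_right sum.distrib)

private lemma M_zero_left: "M 0 q = 0" by (simp add: ore_mult_def)
private lemma M_zero_right: "M p 0 = 0" by (simp add: ore_mult_def Tn_zero)

private lemma smult_sum_right:
  "Polynomial.smult a (\<Sum>i\<in>A. f i) = (\<Sum>i\<in>A. Polynomial.smult a (f i))" for a :: "'k poly"
  by (induction A rule: infinite_finite_induct) (simp_all add: smult_add_right)

private lemma M_smult: "M (Polynomial.smult a p) q = Polynomial.smult a (M p q)"
proof -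
  have "degree (Polynomial.smult a p) \<le> degree p" by (rule degree_smult_le)
  then show ?thesis
    by (simp add: M_bound[of _ "degree p"] smult_sum_right)
qed

private lemma M_monom: "M (monom a n) q = Polynomial.smult a ((T ^^ n) q)"
proof -
  have "M (monom a n) q = (\<Sum>m\<le>n. Polynomial.smult (coeff (monom a n) m) ((T ^^ m) q))"
    by (rule M_bound) (rule degree_monom_le)
  also have "\<dots> = (\<Sum>m\<le>n. if m = n then Polynomial.smult a ((T ^^ m) q) else 0)"
    by (rule sum.cong) auto
  finally show ?thesis by simp
qed

private lemma T_M: "M (T q) r = T (M q r)"
proof -
  have mon: "M (T (monom a n)) r = T (M (monom a n) r)" for a n
  proof -
    have "T (monom a n) = monom (\<sigma> a) (Suc n) + monom (d a) n"
      by (rule poly_eqI) (auto simp: coeff_T s_zero d_zero split: nat.split)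
    then show ?thesis by (simp add: M_add_left M_monom T_smult)
  qed
  have "M (T (\<Sum>i\<le>k. monom (f i) i)) r = T (M (\<Sum>i\<le>k. monom (f i) i) r)" for k f
    by (induction k) (simp_all add: mon T_add M_add_left)
  from this[of "coeff q" "degree q"] show ?thesis
    by (simp add: poly_as_sum_of_monoms)
qed

private lemma Tn_M: "M ((T ^^ n) q) r = (T ^^ n) (M q r)"
  by (induction n) (simp_all add: T_M)

private lemma M_sum_left: "M (\<Sum>i\<in>A. f i) q = (\<Sum>i\<in>A. M (f i) q)"
  by (induction A rule: infinite_finite_induct) (simp_all add: M_zero_left M_add_left)

private lemma M_assoc: "M (M p q) r = M p (M q r)"
  unfolding ore_mult_def[of \<sigma> d p] by (simp add: M_sum_left M_smult Tn_M)

private lemma M_one_left: "M 1 q = q"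
  using M_monom[of 1 0 q] by (simp add: monom_0 one_pCons[symmetric])

private lemma Tn_one: "(T ^^ n) 1 = monom 1 n"
proof (induction n)
  case (Suc n)
  have "T (monom 1 n) = monom 1 (Suc n)"
    by (rule poly_eqI) (auto simp: coeff_T s_zero d_zero s_one d_one split: nat.split)
  then show ?case using Suc by simp
qed (simp add: monom_0 one_pCons)

private lemma M_one_right: "M p 1 = p"
  by (simp add: ore_mult_def Tn_one smult_monom poly_as_sum_of_monoms)

lemma ring_ore_extension: "ring (ore_extension \<sigma> d)"
proof (rule ringI)
  show "abelian_group (ore_extension \<sigma> d)"
    by (rule abelian_groupI)
      (auto simp: ore_extension_def algebra_simps intro: exI[of _ "- _"] add.left_inverse)
  show "monoid (ore_extension \<sigma> d)"
    by (rule monoidI) (auto simp: ore_extension_def M_assoc M_one_left M_one_right)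
qed (auto simp: ore_extension_def M_add_left M_add_right)

text \<open>
  \<open>K[x]\<close> (embedded as the constant polynomials) is a subring whose left action is the obvious one,
  the elements \<open>\<theta>\<^sup>n\<close> form a basis, and the defining commutation relation holds.
\<close>

lemma ore_extension_const_mult:
  "[:a:] \<otimes>\<^bsub>ore_extension \<sigma> d\<^esub> p = Polynomial.smult a p"
  using M_monom[of a 0 p] by (simp add: ore_extension_def monom_0)

lemma ore_extension_theta_mult_const:
  "ore_theta \<otimes>\<^bsub>ore_extension \<sigma> d\<^esub> [:a:] =
     [:\<sigma> a:] \<otimes>\<^bsub>ore_extension \<sigma> d\<^esub> ore_theta \<oplus>\<^bsub>ore_extension \<sigma> d\<^esub> [:d a:]"
proof -
  have "M [:0, 1:] [:a:] = T [:a:]"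
    using M_monom[of 1 1 "[:a:]"] by (simp add: monom_altdef)
  moreover have "T [:a:] = [:d a, \<sigma> a:]"
    by (rule poly_eqI) (auto simp: coeff_T coeff_pCons s_zero d_zero split: nat.split)
  moreover have "M [:\<sigma> a:] [:0, 1:] = [:0, \<sigma> a:]"
    using M_monom[of "\<sigma> a" 0 "[:0, 1:]"] by (simp add: monom_0)
  ultimately show ?thesis by (simp add: ore_extension_def)
qed

lemma ore_extension_theta_pow:
  "ore_theta [^]\<^bsub>ore_extension \<sigma> d\<^esub> (n::nat) = monom 1 n"
proof -
  interpret ring "ore_extension \<sigma> d" by (rule ring_ore_extension)
  show ?thesis
  proof (induction n)
    case 0
    show ?case by (simp add: ore_extension_def monom_0 one_pCons)
  next
    case (Suc n)
    have "M (monom 1 n) [:0, 1:] = (T ^^ n) ((T ^^ 1) 1)"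
      by (simp only: M_monom Tn_one) (simp add: monom_altdef)
    also have "\<dots> = monom 1 (Suc n)"
      using Tn_one[of "Suc n"] by (simp add: funpow_swap1)
    finally show ?case using Suc by (simp add: ore_extension_def)
  qed
qed

end


section \<open>Algebras with two generators \<open>x\<close>, \<open>y\<close> and relations\<close>

datatype generator = GX | GY

text \<open>
  The free algebra \<open>K\<langle>x,y\<rangle>\<close>: finitely supported \<open>K\<close>-valued functions on the words in the generators.
\<close>

definition free_algebra :: "('v list \<Rightarrow> 'k::field) ring" where
  "free_algebra =
     \<lparr>carrier = {f. finite {w. f w \<noteq> 0}},
      mult = (\<lambda>f g w. \<Sum>(u, v) | u @ v = w. f u * g v),
      one = (\<lambda>w. if w = [] then 1 else 0),
      zero = (\<lambda>w. 0),
      add = (\<lambda>f g w. f w + g w)\<rparr>"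

definition word :: "'v list \<Rightarrow> 'v list \<Rightarrow> 'k::field" where
  "word u = (\<lambda>w. if w = u then 1 else 0)"

definition free_const :: "'k \<Rightarrow> 'v list \<Rightarrow> 'k::field" where
  "free_const c = (\<lambda>w. c * word [] w)"

definition presented_algebra :: "(generator list \<Rightarrow> 'k::field) set \<Rightarrow> (generator list \<Rightarrow> 'k) set ring" where
  "presented_algebra rels = free_algebra Quot (Idl\<^bsub>free_algebra\<^esub> rels)"

definition presented_const ::
    "(generator list \<Rightarrow> 'k::field) set \<Rightarrow> 'k \<Rightarrow> (generator list \<Rightarrow> 'k) set" where
  "presented_const rels c = (Idl\<^bsub>free_algebra\<^esub> rels) +>\<^bsub>free_algebra\<^esub> free_const c"

definition quantum_plane_rels :: "'k::field \<Rightarrow> (generator list \<Rightarrow> 'k) set" where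
  "quantum_plane_rels q = {\<lambda>w. word [GY, GX] w - q * word [GX, GY] w}"

definition quantum_weyl_rels :: "'k::field \<Rightarrow> (generator list \<Rightarrow> 'k) set" where
  "quantum_weyl_rels q = {\<lambda>w. word [GY, GX] w - q * word [GX, GY] w - word [] w}"

text \<open>
  Isomorphism of \<open>K\<close>-algebras; the algebra structures are given by the maps \<open>i\<close>, \<open>j\<close> from \<open>K\<close>.
\<close>

definition K_algebra_isomorphic ::
    "('a, 'm) ring_scheme \<Rightarrow> ('k \<Rightarrow> 'a) \<Rightarrow> ('b, 'n) ring_scheme \<Rightarrow> ('k \<Rightarrow> 'b) \<Rightarrow> bool" where
  "K_algebra_isomorphic A i B j \<longleftrightarrow> (\<exists>h \<in> ring_iso A B. \<forall>c. h (i c) = j c)"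

lemma finite_splits: "finite {(u, v). u @ v = w}"
proof -
  have "{(u, v). u @ v = w} \<subseteq> (\<lambda>i. (take i w, drop i w)) ` {..length w}"
  proof clarify
    fix u v :: "'a list"
    show "(u, v) \<in> (\<lambda>i. (take i (u @ v), drop i (u @ v))) ` {..length (u @ v)}"
      by (rule image_eqI[of _ _ "length u"]) auto
  qed
  then show ?thesis by (rule finite_subset) simp
qed

lemma ring_free_algebra: "ring (free_algebra :: ('v list \<Rightarrow> 'k::field) ring)"
proof (rule ringI)
  let ?F = "free_algebra :: ('v list \<Rightarrow> 'k::field) ring"
  have fin_add: "finite {w. f w + g w \<noteq> 0}"
    if "finite {w. f w \<noteq> 0}" "finite {w. g w \<noteq> 0}" for f g :: "'v list \<Rightarrow> 'k"
    by (rule finite_subset[OF _ finite_UnI[OF that]]) auto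
  show "abelian_group ?F"
  proof (rule abelian_groupI)
    fix f assume "f \<in> carrier ?F"
    then show "\<exists>g\<in>carrier ?F. g \<oplus>\<^bsub>?F\<^esub> f = \<zero>\<^bsub>?F\<^esub>"
      by (intro bexI[of _ "\<lambda>w. - f w"]) (auto simp: free_algebra_def)
  qed (auto simp: free_algebra_def fin_add algebra_simps)
  show "monoid ?F"
  proof (rule monoidI)
    fix f g assume "f \<in> carrier ?F" "g \<in> carrier ?F"
    then have fin: "finite {w. f w \<noteq> 0}" "finite {w. g w \<noteq> 0}" by (auto simp: free_algebra_def)
    have "{w. (\<Sum>(u, v) | u @ v = w. f u * g v) \<noteq> 0} \<subseteq>
        (\<lambda>(u, v). u @ v) ` ({w. f w \<noteq> 0} \<times> {w. g w \<noteq> 0})"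
    proof
      fix w assume "w \<in> {w. (\<Sum>(u, v) | u @ v = w. f u * g v) \<noteq> 0}"
      then obtain z where "z \<in> {(u, v). u @ v = w}" "(case z of (u, v) \<Rightarrow> f u * g v) \<noteq> 0"
        by (auto elim: sum.not_neutral_contains_not_neutral)
      then show "w \<in> (\<lambda>(u, v). u @ v) ` ({w. f w \<noteq> 0} \<times> {w. g w \<noteq> 0})"
        by (auto simp: image_iff)
    qed
    then have "finite {w. (\<Sum>(u, v) | u @ v = w. f u * g v) \<noteq> 0}"
      by (rule finite_subset) (use fin in auto)
    then show "f \<otimes>\<^bsub>?F\<^esub> g \<in> carrier ?F" by (simp add: free_algebra_def)
  next
    fix f g h :: "'v list \<Rightarrow> 'k"
    have "(\<Sum>(a, v) | a @ v = w. (\<Sum>(s, t) | s @ t = a. f s * g t) * h v) =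
        (\<Sum>(s, b) | s @ b = w. f s * (\<Sum>(t, v) | t @ v = b. g t * h v))" for w
    proof -
      have "(\<Sum>(a, v) | a @ v = w. (\<Sum>(s, t) | s @ t = a. f s * g t) * h v) =
          (\<Sum>x\<in>{(a, v). a @ v = w}. \<Sum>y\<in>{(s, t). s @ t = fst x}. f (fst y) * g (snd y) * h (snd x))"
        by (simp add: sum_distrib_right case_prod_unfold)
      also have "\<dots> = (\<Sum>(x, y)\<in>(SIGMA x:{(a, v). a @ v = w}. {(s, t). s @ t = fst x}).
          f (fst y) * g (snd y) * h (snd x))"
        by (rule sum.Sigma) (auto simp: finite_splits)
      also have "\<dots> = (\<Sum>(x, y)\<in>(SIGMA x:{(s, b). s @ b = w}. {(t, v). t @ v = snd x}).
          f (fst x) * (g (fst y) * h (snd y)))"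
        by (rule sum.reindex_bij_witness[
              where i = "\<lambda>((s, b), (t, v)). ((s @ t, v), (s, t))"
                and j = "\<lambda>((a, v), (s, t)). ((s, t @ v), (t, v))"])
          (auto simp: mult.assoc)
      also have "\<dots> = (\<Sum>x\<in>{(s, b). s @ b = w}. \<Sum>y\<in>{(t, v). t @ v = snd x}.
          f (fst x) * (g (fst y) * h (snd y)))"
        by (rule sum.Sigma[symmetric]) (auto simp: finite_splits)
      also have "\<dots> = (\<Sum>(s, b) | s @ b = w. f s * (\<Sum>(t, v) | t @ v = b. g t * h v))"
        by (simp add: sum_distrib_left case_prod_unfold)
      finally show ?thesis .
    qed
    then show "f \<otimes>\<^bsub>?F\<^esub> g \<otimes>\<^bsub>?F\<^esub> h = f \<otimes>\<^bsub>?F\<^esub> (g \<otimes>\<^bsub>?F\<^esub> h)"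
      by (simp add: free_algebra_def)
  next
    fix f :: "'v list \<Rightarrow> 'k"
    have "(\<Sum>(u, v) | u @ v = w. (if u = [] then 1 else 0) * f v) = f w" for w
    proof -
      have "(\<Sum>(u, v) | u @ v = w. (if u = [] then 1 else 0) * f v) = (\<Sum>(u, v)\<in>{([] :: 'v list, w)}. f v)"
        using finite_splits[of w] by (intro sum.mono_neutral_cong_right) (auto split: if_splits)
      then show ?thesis by simp
    qed
    then show "\<one>\<^bsub>?F\<^esub> \<otimes>\<^bsub>?F\<^esub> f = f" by (simp add: free_algebra_def)
    have "(\<Sum>(u, v) | u @ v = w. f u * (if v = [] then 1 else 0)) = f w" for w
    proof -
      have "(\<Sum>(u, v) | u @ v = w. f u * (if v = [] then 1 else 0)) = (\<Sum>(u, v)\<in>{(w, [] :: 'v list)}. f u)"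
        using finite_splits[of w] by (intro sum.mono_neutral_cong_right) (auto split: if_splits)
      then show ?thesis by simp
    qed
    then show "f \<otimes>\<^bsub>?F\<^esub> \<one>\<^bsub>?F\<^esub> = f" by (simp add: free_algebra_def)
  qed (auto simp: free_algebra_def)
qed (auto simp: free_algebra_def case_prod_unfold algebra_simps sum.distrib)


section \<open>Left modules and property \<open>(\<diamond>)\<close>\<close>

text \<open>
  The library's locale \<^locale>\<open>module\<close> is restricted to commutative rings; its module record and its
  locale \<^locale>\<open>submodule\<close> make sense over any ring and are reused.
\<close>

locale left_module = R?: ring R + M?: abelian_group M for R (structure) and M (structure) +
  assumes smult_closed [simp, intro]:
      "\<lbrakk>a \<in> carrier R; m \<in> carrier M\<rbrakk> \<Longrightarrow> a \<odot>\<^bsub>M\<^esub> m \<in> carrier M"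
    and smult_l_distr:
      "\<lbrakk>a \<in> carrier R; b \<in> carrier R; m \<in> carrier M\<rbrakk> \<Longrightarrow>
        (a \<oplus> b) \<odot>\<^bsub>M\<^esub> m = a \<odot>\<^bsub>M\<^esub> m \<oplus>\<^bsub>M\<^esub> b \<odot>\<^bsub>M\<^esub> m"
    and smult_r_distr:
      "\<lbrakk>a \<in> carrier R; m \<in> carrier M; n \<in> carrier M\<rbrakk> \<Longrightarrow>
        a \<odot>\<^bsub>M\<^esub> (m \<oplus>\<^bsub>M\<^esub> n) = a \<odot>\<^bsub>M\<^esub> m \<oplus>\<^bsub>M\<^esub> a \<odot>\<^bsub>M\<^esub> n"
    and smult_assoc1:
      "\<lbrakk>a \<in> carrier R; b \<in> carrier R; m \<in> carrier M\<rbrakk> \<Longrightarrow>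
        (a \<otimes> b) \<odot>\<^bsub>M\<^esub> m = a \<odot>\<^bsub>M\<^esub> (b \<odot>\<^bsub>M\<^esub> m)"
    and smult_one [simp]:
      "m \<in> carrier M \<Longrightarrow> \<one> \<odot>\<^bsub>M\<^esub> m = m"

abbreviation restrict_module :: "('a, 'b, 'm) module_scheme \<Rightarrow> 'b set \<Rightarrow> ('a, 'b, 'm) module_scheme" where
  "restrict_module M N \<equiv> M\<lparr>carrier := N\<rparr>"

definition left_module_hom ::
    "('a, 'r) ring_scheme \<Rightarrow> ('a, 'b, 'm) module_scheme \<Rightarrow> ('a, 'c, 'n) module_scheme \<Rightarrow> ('b \<Rightarrow> 'c) set" where
  "left_module_hom R M N =
     {f. f \<in> carrier M \<rightarrow> carrier N \<and>
        (\<forall>m\<in>carrier M. \<forall>n\<in>carrier M. f (m \<oplus>\<^bsub>M\<^esub> n) = f m \<oplus>\<^bsub>N\<^esub> f n) \<and>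
        (\<forall>a\<in>carrier R. \<forall>m\<in>carrier M. f (a \<odot>\<^bsub>M\<^esub> m) = a \<odot>\<^bsub>N\<^esub> f m)}"

definition simple_module :: "('a, 'r) ring_scheme \<Rightarrow> ('a, 'b, 'm) module_scheme \<Rightarrow> bool" where
  "simple_module R M \<longleftrightarrow> left_module R M \<and> carrier M \<noteq> {\<zero>\<^bsub>M\<^esub>} \<and>
     (\<forall>N. submodule N R M \<longrightarrow> N = {\<zero>\<^bsub>M\<^esub>} \<or> N = carrier M)"

definition artinian_module :: "('a, 'r) ring_scheme \<Rightarrow> ('a, 'b, 'm) module_scheme \<Rightarrow> bool" where
  "artinian_module R M \<longleftrightarrow> left_module R M \<and>
     (\<forall>N :: nat \<Rightarrow> 'b set. (\<forall>i. submodule (N i) R M) \<and> (\<forall>i. N (Suc i) \<subseteq> N i) \<longrightarrow>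
        (\<exists>n. \<forall>i\<ge>n. N i = N n))"

definition submodule_generated ::
    "('a, 'r) ring_scheme \<Rightarrow> ('a, 'b, 'm) module_scheme \<Rightarrow> 'b set \<Rightarrow> 'b set" where
  "submodule_generated R M A = \<Inter>{N. submodule N R M \<and> A \<subseteq> N}"

definition fg_submodule :: "'b set \<Rightarrow> ('a, 'r) ring_scheme \<Rightarrow> ('a, 'b, 'm) module_scheme \<Rightarrow> bool" where
  "fg_submodule N R M \<longleftrightarrow> (\<exists>A. finite A \<and> A \<subseteq> carrier M \<and> N = submodule_generated R M A)"

definition locally_artinian :: "('a, 'r) ring_scheme \<Rightarrow> ('a, 'b, 'm) module_scheme \<Rightarrow> bool" where
  "locally_artinian R M \<longleftrightarrow> left_module R M \<and>
     (\<forall>N. fg_submodule N R M \<longrightarrow> artinian_module R (restrict_module M N))"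

definition essential_submodule :: "'b set \<Rightarrow> ('a, 'r) ring_scheme \<Rightarrow> ('a, 'b, 'm) module_scheme \<Rightarrow> bool" where
  "essential_submodule N R M \<longleftrightarrow> submodule N R M \<and>
     (\<forall>L. submodule L R M \<and> L \<noteq> {\<zero>\<^bsub>M\<^esub>} \<longrightarrow> L \<inter> N \<noteq> {\<zero>\<^bsub>M\<^esub>})"

text \<open>
  A definition cannot quantify over types, so the test modules \<open>Y\<close> for injectivity are carried by the
  type \<open>'a\<close> of the ring elements.  Nothing is lost: the left regular module with its left ideals is
  among the tests, so by Baer's criterion the lifting property follows for test modules on any type.
\<close>

definition injective_module :: "('a, 'r) ring_scheme \<Rightarrow> ('a, 'b, 'm) module_scheme \<Rightarrow> bool" where
  "injective_module R E \<longleftrightarrow> left_module R E \<and>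
     (\<forall>(Y :: ('a, 'a) module) X f.
        left_module R Y \<and> submodule X R Y \<and> f \<in> left_module_hom R (restrict_module Y X) E \<longrightarrow>
        (\<exists>g \<in> left_module_hom R Y E. \<forall>m\<in>X. g m = f m))"

definition injective_hull :: "('a, 'r) ring_scheme \<Rightarrow> 'b set \<Rightarrow> ('a, 'b, 'm) module_scheme \<Rightarrow> bool" where
  "injective_hull R N E \<longleftrightarrow> essential_submodule N R E \<and> injective_module R E"

text \<open>
  Property \<open>(\<diamond>)\<close>: every injective hull of a simple left module is locally Artinian.  The hulls range
  over modules carried by \<open>'a \<Rightarrow> rat\<close>.  This type contains, up to isomorphism, an injective hull of
  every simple left \<open>R\<close>-module \<open>S\<close> (on any type): for a nonzero additive \<open>\<chi> : S \<rightarrow> \<rat>/\<int>\<close> the map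
  \<open>s \<mapsto> (r \<mapsto> \<chi> (r s))\<close> embeds \<open>S\<close> into the injective module \<open>Hom\<^sub>\<int>(R, \<rat>/\<int>)\<close>, whose elements are
  represented by functions from \<open>R\<close> to \<open>\<rat> \<inter> [0,1)\<close>.  As injective hulls are unique up to
  isomorphism, no larger type would change the property.
\<close>

definition diamond_property :: "('a, 'r) ring_scheme \<Rightarrow> bool" where
  "diamond_property R \<longleftrightarrow>
     (\<forall>(E :: ('a, 'a \<Rightarrow> rat) module) N.
        simple_module R (restrict_module E N) \<and> injective_hull R N E \<longrightarrow> locally_artinian R E)"

end

theory Submission
  imports Defs
begin

text \<open>
  Cyclic essential extensions of simple modules are the quotients \<open>S / I\<close> for which a single element lies
  in all left ideals strictly above \<open>I\<close>; call such \<open>I\<close> monolithic.  As \<open>S\<close> contains \<open>\<rat>\<close>, the additive maps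
  \<open>S \<rightarrow> \<rat>\<close> form an injective module into which every \<open>S / I\<close> with \<open>I\<close> monolithic embeds, so \<open>(\<diamond>)\<close>
  means that \<open>S / I\<close> is Artinian for all monolithic \<open>I\<close>.

  If \<open>q \<noteq> 1\<close> is a root of unity, or \<open>\<sigma> = id\<close> and \<open>d = 0\<close>, then \<open>S\<close> is finite over its centre.  Simple modules
  are then finite-dimensional, and central elements that annihilate the socle of \<open>S / I\<close> act
  nilpotently, so \<open>S / I\<close> is finite-dimensional too.  If \<open>\<sigma> = id\<close> and \<open>d(x)\<close> is a nonzero constant, \<open>S\<close> is
  the Weyl algebra; the leading exponents of a left ideal form an up-closed subset of \<open>\<nat> \<times> \<nat>\<close>, and
  along a descending chain above \<open>I \<noteq> 0\<close> these sets eventually differ by finite sets only, which forces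
  equality since the Weyl algebra has no nonzero finite-dimensional modules.

  In all other cases a monolithic product \<open>S g f\<close> with \<open>S g\<close> maximal is exhibited for which \<open>S / S f\<close>, hence
  \<open>S / S g f\<close>, is not Artinian.
\<close>

section \<open>Modules over a ring\<close>

text \<open>Quotient modules are never formed; S / I is replaced by the left ideals above I. The
  obstacle in the negative cases is essentiality. S / S g f contains the simple module S f / S g f,
  a copy of S / S g, with quotient S / S f. The latter has visible descending chains: p^k K[x] if
  \<sigma> = id and p = d(x), and S z^k + S f for a normal element z otherwise. A nonzero submodule
  missing the simple one would make an equation solvable that is not. For \<sigma> = id it would
  give a polynomial vanishing at a whose order at a does not drop under differentiation. Otherwise
  it would make a nonzero constant of S / S g divisible by x - a_n. The choice of a, f, g and z
  serves to exclude just this.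

  In the passage from (b) to (c) only q = 1 is delicate. The presented algebras are not analysed by
  themselves: each is compared with a concrete Ore extension over \<sigma> = id. Two ring invariants
  then decide, namely commutativity for the plane and whether 1 is a commutator for the Weyl
  algebra.\<close>

definition left_ideal :: "'a set \<Rightarrow> ('a, 'r) ring_scheme \<Rightarrow> bool" where
  "left_ideal J R \<longleftrightarrow> J \<subseteq> carrier R \<and> \<zero>\<^bsub>R\<^esub> \<in> J \<and> (\<forall>a\<in>J. \<forall>b\<in>J. a \<oplus>\<^bsub>R\<^esub> b \<in> J) \<and>
     (\<forall>s\<in>carrier R. \<forall>a\<in>J. s \<otimes>\<^bsub>R\<^esub> a \<in> J)"

definition monolithic :: "('a, 'r) ring_scheme \<Rightarrow> 'a set \<Rightarrow> bool" where
  "monolithic R I \<longleftrightarrow> left_ideal I R \<and>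
     (\<exists>f\<in>carrier R. f \<notin> I \<and> (\<forall>J. left_ideal J R \<and> I \<subset> J \<longrightarrow> f \<in> J))"

text \<open>Artinianness of R / I, expressed by the correspondence between its submodules and the
  left ideals above I.\<close>

definition dcc_above :: "('a, 'r) ring_scheme \<Rightarrow> 'a set \<Rightarrow> bool" where
  "dcc_above R I \<longleftrightarrow> (\<forall>J :: nat \<Rightarrow> 'a set.
     (\<forall>i. left_ideal (J i) R \<and> I \<subseteq> J i \<and> J (Suc i) \<subseteq> J i) \<longrightarrow> (\<exists>n. \<forall>i\<ge>n. J i = J n))"

context left_module
begin

lemma smult_zero_left [simp]: "m \<in> carrier M \<Longrightarrow> \<zero>\<^bsub>R\<^esub> \<odot>\<^bsub>M\<^esub> m = \<zero>\<^bsub>M\<^esub>"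
  by (metis M.add.r_cancel_one' R.add.one_closed R.add.r_one smult_closed smult_l_distr)

lemma smult_zero_right [simp]: "a \<in> carrier R \<Longrightarrow> a \<odot>\<^bsub>M\<^esub> \<zero>\<^bsub>M\<^esub> = \<zero>\<^bsub>M\<^esub>"
  by (metis M.add.one_closed M.add.r_cancel_one' M.l_zero smult_closed smult_r_distr)

lemma smult_minus_left:
  assumes "a \<in> carrier R" "m \<in> carrier M"
  shows "(\<ominus>\<^bsub>R\<^esub> a) \<odot>\<^bsub>M\<^esub> m = \<ominus>\<^bsub>M\<^esub> (a \<odot>\<^bsub>M\<^esub> m)"
  using assms smult_l_distr[of "\<ominus>\<^bsub>R\<^esub> a" a m]
  by (simp add: M.minus_equality R.l_neg)

text \<open>Negatives come from the action of -1, so the subgroup condition inside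
  \<open>submodule\<close> reduces to closure under addition, in parallel with
  \<open>left_ideal\<close>.\<close>

lemma submodule_iff:
  "submodule N R M \<longleftrightarrow> N \<subseteq> carrier M \<and> \<zero>\<^bsub>M\<^esub> \<in> N \<and> (\<forall>a\<in>N. \<forall>b\<in>N. a \<oplus>\<^bsub>M\<^esub> b \<in> N) \<and>
     (\<forall>s\<in>carrier R. \<forall>a\<in>N. s \<odot>\<^bsub>M\<^esub> a \<in> N)" (is "_ \<longleftrightarrow> ?rhs")
proof
  assume "submodule N R M"
  then interpret submodule N R M .
  show ?rhs using subset one_closed m_closed smult_closed by auto
next
  assume N: ?rhs
  have "\<ominus>\<^bsub>M\<^esub> a \<in> N" if "a \<in> N" for a
  proof -
    have "a \<in> carrier M" using N that by auto
    then have "(\<ominus>\<^bsub>R\<^esub> \<one>\<^bsub>R\<^esub>) \<odot>\<^bsub>M\<^esub> a = \<ominus>\<^bsub>M\<^esub> a" by (simp add: smult_minus_left)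
    then show ?thesis using N that by (metis R.add.inv_closed R.one_closed)
  qed
  with N show "submodule N R M"
    by (intro submodule.intro subgroup.intro submodule_axioms.intro)
       (auto simp: a_inv_def)
qed

lemma submodule_minus_closed:
  assumes "submodule N R M" "a \<in> N" "b \<in> N" shows "a \<ominus>\<^bsub>M\<^esub> b \<in> N"
proof -
  interpret submodule N R M by fact
  show ?thesis using assms m_inv_closed[of b] m_closed[of a "\<ominus>\<^bsub>M\<^esub> b"] by (simp add: a_minus_def a_inv_def)
qed

lemma left_module_restrict:
  assumes "submodule N R M"
  shows "left_module R (restrict_module M N)"
proof -
  have N: "N \<subseteq> carrier M" "\<zero>\<^bsub>M\<^esub> \<in> N" "\<And>a b. a \<in> N \<Longrightarrow> b \<in> N \<Longrightarrow> a \<oplus>\<^bsub>M\<^esub> b \<in> N"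
      "\<And>s a. s \<in> carrier R \<Longrightarrow> a \<in> N \<Longrightarrow> s \<odot>\<^bsub>M\<^esub> a \<in> N"
    using assms by (auto simp: submodule_iff)
  have neg: "\<ominus>\<^bsub>M\<^esub> a \<in> N" if "a \<in> N" for a
    using submodule_minus_closed[OF assms N(2) that] N(1) that by (auto simp: M.minus_eq subsetD)
  have "abelian_group (restrict_module M N)"
  proof (rule abelian_groupI)
    fix a assume "a \<in> carrier (restrict_module M N)"
    then show "\<exists>b\<in>carrier (restrict_module M N). b \<oplus>\<^bsub>restrict_module M N\<^esub> a = \<zero>\<^bsub>restrict_module M N\<^esub>"
      using neg N(1) by (intro bexI[of _ "\<ominus>\<^bsub>M\<^esub> a"]) (auto simp: M.l_neg subsetD)
  qed (use N in \<open>auto simp: M.a_ac subsetD\<close>)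
  then interpret A: abelian_group "restrict_module M N" .
  show ?thesis
    by unfold_locales (use N in \<open>auto simp: subsetD smult_l_distr smult_r_distr smult_assoc1\<close>)
qed

lemma submodule_restrict:
  assumes "submodule N R M"
  shows "submodule L R (restrict_module M N) \<longleftrightarrow> submodule L R M \<and> L \<subseteq> N"
proof -
  interpret N: left_module R "restrict_module M N" by (rule left_module_restrict[OF assms])
  show ?thesis using assms by (auto simp: N.submodule_iff submodule_iff)
qed

lemma submodule_carrier: "submodule (carrier M) R M" by (simp add: submodule_iff)

definition cyclic :: "'c \<Rightarrow> 'c set" where "cyclic m = {s \<odot>\<^bsub>M\<^esub> m | s. s \<in> carrier R}"

lemma ideal_smult_submodule:
  assumes "left_ideal J R" "m \<in> carrier M"
  shows "submodule {s \<odot>\<^bsub>M\<^esub> m | s. s \<in> J} R M"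
proof -
  have J: "J \<subseteq> carrier R" "\<zero>\<^bsub>R\<^esub> \<in> J" "\<And>a b. a \<in> J \<Longrightarrow> b \<in> J \<Longrightarrow> a \<oplus>\<^bsub>R\<^esub> b \<in> J"
      "\<And>s a. s \<in> carrier R \<Longrightarrow> a \<in> J \<Longrightarrow> s \<otimes>\<^bsub>R\<^esub> a \<in> J"
    using assms(1) by (auto simp: left_ideal_def)
  show ?thesis unfolding submodule_iff
  proof (intro conjI ballI)
    show "\<zero>\<^bsub>M\<^esub> \<in> {s \<odot>\<^bsub>M\<^esub> m | s. s \<in> J}" using J(2) assms(2) smult_zero_left by (auto intro!: exI[of _ "\<zero>\<^bsub>R\<^esub>"])
    fix a b assume "a \<in> {s \<odot>\<^bsub>M\<^esub> m | s. s \<in> J}" "b \<in> {s \<odot>\<^bsub>M\<^esub> m | s. s \<in> J}"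
    then show "a \<oplus>\<^bsub>M\<^esub> b \<in> {s \<odot>\<^bsub>M\<^esub> m | s. s \<in> J}"
      using J assms(2) smult_l_distr by (smt (verit) mem_Collect_eq subsetD)
  next
    fix s a assume "s \<in> carrier R" "a \<in> {s \<odot>\<^bsub>M\<^esub> m | s. s \<in> J}"
    then show "s \<odot>\<^bsub>M\<^esub> a \<in> {s \<odot>\<^bsub>M\<^esub> m | s. s \<in> J}"
      using J assms(2) smult_assoc1 by (smt (verit) mem_Collect_eq subsetD)
  qed (use J(1) assms(2) in auto)
qed

lemma left_ideal_carrier: "left_ideal (carrier R) R" by (auto simp: left_ideal_def)

lemma submodule_cyclic: "m \<in> carrier M \<Longrightarrow> submodule (cyclic m) R M"
  unfolding cyclic_def by (rule ideal_smult_submodule[OF left_ideal_carrier])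

lemma mem_cyclic: "m \<in> carrier M \<Longrightarrow> m \<in> cyclic m"
  by (auto simp: cyclic_def intro!: exI[of _ "\<one>\<^bsub>R\<^esub>"])

lemma cyclic_minimal: "submodule N R M \<Longrightarrow> m \<in> N \<Longrightarrow> cyclic m \<subseteq> N"
  by (auto simp: cyclic_def submodule_iff)

lemma left_ideal_colon:
  assumes "submodule N R M" "m \<in> carrier M"
  shows "left_ideal {s \<in> carrier R. s \<odot>\<^bsub>M\<^esub> m \<in> N} R"
  using assms by (auto simp: left_ideal_def submodule_iff smult_l_distr smult_assoc1)

lemma submodule_zero: "submodule {\<zero>\<^bsub>M\<^esub>} R M"
  by (auto simp: submodule_iff)

lemma submodule_generated_submodule:
  assumes "A \<subseteq> carrier M" shows "submodule (submodule_generated R M A) R M"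
proof -
  have "carrier M \<in> {N. submodule N R M \<and> A \<subseteq> N}" using assms submodule_carrier by auto
  then show ?thesis unfolding submodule_generated_def by (auto simp: submodule_iff)
qed

lemma submodule_generated_singleton:
  assumes "m \<in> carrier M" shows "submodule_generated R M {m} = cyclic m"
proof
  show "submodule_generated R M {m} \<subseteq> cyclic m"
    using submodule_cyclic[OF assms] mem_cyclic[OF assms] by (auto simp: submodule_generated_def)
  show "cyclic m \<subseteq> submodule_generated R M {m}"
    using cyclic_minimal by (auto simp: submodule_generated_def)
qed

definition annihilator :: "'c \<Rightarrow> 'a set" where
  "annihilator m = {s \<in> carrier R. s \<odot>\<^bsub>M\<^esub> m = \<zero>\<^bsub>M\<^esub>}"

definition dcc_below :: "'c set \<Rightarrow> bool" where
  "dcc_below N \<longleftrightarrow> (\<forall>L :: nat \<Rightarrow> 'c set.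
     (\<forall>i. submodule (L i) R M \<and> L i \<subseteq> N \<and> L (Suc i) \<subseteq> L i) \<longrightarrow> (\<exists>n. \<forall>i\<ge>n. L i = L n))"

lemma submodule_Int: "submodule A R M \<Longrightarrow> submodule B R M \<Longrightarrow> submodule (A \<inter> B) R M"
  by (auto simp: submodule_iff)

definition plus_cyclic :: "'c set \<Rightarrow> 'c \<Rightarrow> 'c set" where
  "plus_cyclic N m = {n \<oplus>\<^bsub>M\<^esub> s \<odot>\<^bsub>M\<^esub> m | n s. n \<in> N \<and> s \<in> carrier R}"

lemma submodule_plus_cyclic:
  assumes N: "submodule N R M" and m: "m \<in> carrier M"
  shows "submodule (plus_cyclic N m) R M" "N \<subseteq> plus_cyclic N m" "m \<in> plus_cyclic N m"
proof -
  have N': "N \<subseteq> carrier M" "\<zero>\<^bsub>M\<^esub> \<in> N" "\<And>a b. a \<in> N \<Longrightarrow> b \<in> N \<Longrightarrow> a \<oplus>\<^bsub>M\<^esub> b \<in> N"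
      "\<And>s a. s \<in> carrier R \<Longrightarrow> a \<in> N \<Longrightarrow> s \<odot>\<^bsub>M\<^esub> a \<in> N"
    using N by (auto simp: submodule_iff)
  show sub: "N \<subseteq> plus_cyclic N m"
  proof
    fix n assume n: "n \<in> N"
    then have "n = n \<oplus>\<^bsub>M\<^esub> \<zero>\<^bsub>R\<^esub> \<odot>\<^bsub>M\<^esub> m" using N'(1) m by (auto simp: subsetD)
    then show "n \<in> plus_cyclic N m" using n unfolding plus_cyclic_def by blast
  qed
  have "m = \<zero>\<^bsub>M\<^esub> \<oplus>\<^bsub>M\<^esub> \<one>\<^bsub>R\<^esub> \<odot>\<^bsub>M\<^esub> m" using m by simp
  then show "m \<in> plus_cyclic N m" using N'(2) unfolding plus_cyclic_def by blast
  show "submodule (plus_cyclic N m) R M"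
    unfolding submodule_iff
  proof (intro conjI ballI)
    show "plus_cyclic N m \<subseteq> carrier M" using N'(1) m by (auto simp: plus_cyclic_def)
    show "\<zero>\<^bsub>M\<^esub> \<in> plus_cyclic N m" using sub N'(2) by auto
    fix a b assume "a \<in> plus_cyclic N m" "b \<in> plus_cyclic N m"
    then obtain n s n' s' where h: "a = n \<oplus>\<^bsub>M\<^esub> s \<odot>\<^bsub>M\<^esub> m" "b = n' \<oplus>\<^bsub>M\<^esub> s' \<odot>\<^bsub>M\<^esub> m" "n \<in> N" "n' \<in> N"
        "s \<in> carrier R" "s' \<in> carrier R" by (auto simp: plus_cyclic_def)
    have "a \<oplus>\<^bsub>M\<^esub> b = (n \<oplus>\<^bsub>M\<^esub> n') \<oplus>\<^bsub>M\<^esub> (s \<oplus>\<^bsub>R\<^esub> s') \<odot>\<^bsub>M\<^esub> m"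
      using h m N'(1) by (simp add: subsetD smult_l_distr M.a_ac)
    then show "a \<oplus>\<^bsub>M\<^esub> b \<in> plus_cyclic N m"
      using h N'(3) unfolding plus_cyclic_def by blast
  next
    fix t a assume t: "t \<in> carrier R" and "a \<in> plus_cyclic N m"
    then obtain n s where h: "a = n \<oplus>\<^bsub>M\<^esub> s \<odot>\<^bsub>M\<^esub> m" "n \<in> N" "s \<in> carrier R" by (auto simp: plus_cyclic_def)
    have "t \<odot>\<^bsub>M\<^esub> a = t \<odot>\<^bsub>M\<^esub> n \<oplus>\<^bsub>M\<^esub> (t \<otimes>\<^bsub>R\<^esub> s) \<odot>\<^bsub>M\<^esub> m"
      using h m N'(1) t by (simp add: subsetD smult_r_distr smult_assoc1)
    then show "t \<odot>\<^bsub>M\<^esub> a \<in> plus_cyclic N m"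
      using h t N'(4) unfolding plus_cyclic_def by blast
  qed
qed

text \<open>Extensions of Artinian modules are Artinian: a chain in N + R m is controlled by its
  intersections with N and by its images in the quotient by N.\<close>

lemma dcc_below_plus_cyclic:
  assumes N: "submodule N R M" "dcc_below N" and m: "m \<in> carrier M" and dcc: "dcc_above R (annihilator m)"
  shows "dcc_below (plus_cyclic N m)"
  unfolding dcc_below_def
proof (intro allI impI)
  fix L :: "nat \<Rightarrow> 'c set"
  assume L: "\<forall>i. submodule (L i) R M \<and> L i \<subseteq> plus_cyclic N m \<and> L (Suc i) \<subseteq> L i"
  then have Ls: "submodule (L i) R M" for i by blast
  have NC: "N \<subseteq> carrier M" "\<zero>\<^bsub>M\<^esub> \<in> N" and NA: "a \<in> N \<Longrightarrow> b \<in> N \<Longrightarrow> a \<oplus>\<^bsub>M\<^esub> b \<in> N" for a b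
    using N(1) by (auto simp: submodule_iff)
  have LC: "L i \<subseteq> carrier M" "\<zero>\<^bsub>M\<^esub> \<in> L i" for i using Ls[of i] by (auto simp: submodule_iff)
  have "\<exists>n. \<forall>i\<ge>n. L i \<inter> N = L n \<inter> N"
    using N(2)[unfolded dcc_below_def, rule_format, of "\<lambda>i. L i \<inter> N"] L submodule_Int[OF Ls N(1)] by blast
  then obtain n1 where n1: "\<And>i. i \<ge> n1 \<Longrightarrow> L i \<inter> N = L n1 \<inter> N" by blast
  \<comment> \<open>The image of \<open>L i\<close> in (N + R m) / N, pulled back to R along s |-> s
    m. It contains \<open>annihilator m\<close>, so the chain condition above that left ideal
    applies.\<close>
  define J where "J i = {s \<in> carrier R. \<exists>n\<in>N. n \<oplus>\<^bsub>M\<^esub> s \<odot>\<^bsub>M\<^esub> m \<in> L i}" for i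
  have Jid: "left_ideal (J i) R" for i
    unfolding left_ideal_def
  proof (intro conjI ballI)
    show "\<zero>\<^bsub>R\<^esub> \<in> J i" using NC(2) m LC(2)[of i] by (auto simp: J_def intro!: bexI[of _ "\<zero>\<^bsub>M\<^esub>"])
    fix a b assume "a \<in> J i" "b \<in> J i"
    then obtain n n' where h: "a \<in> carrier R" "b \<in> carrier R" "n \<in> N" "n' \<in> N"
      "n \<oplus>\<^bsub>M\<^esub> a \<odot>\<^bsub>M\<^esub> m \<in> L i" "n' \<oplus>\<^bsub>M\<^esub> b \<odot>\<^bsub>M\<^esub> m \<in> L i" by (auto simp: J_def)
    have "(n \<oplus>\<^bsub>M\<^esub> n') \<oplus>\<^bsub>M\<^esub> (a \<oplus>\<^bsub>R\<^esub> b) \<odot>\<^bsub>M\<^esub> m = (n \<oplus>\<^bsub>M\<^esub> a \<odot>\<^bsub>M\<^esub> m) \<oplus>\<^bsub>M\<^esub> (n' \<oplus>\<^bsub>M\<^esub> b \<odot>\<^bsub>M\<^esub> m)"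
      using h m NC(1) by (simp add: subsetD smult_l_distr M.a_ac)
    also have "\<dots> \<in> L i" using h(5,6) Ls[of i] by (auto simp: submodule_iff)
    finally show "a \<oplus>\<^bsub>R\<^esub> b \<in> J i" using h NA by (auto simp: J_def)
  next
    fix t a assume t: "t \<in> carrier R" and "a \<in> J i"
    then obtain n where h: "a \<in> carrier R" "n \<in> N" "n \<oplus>\<^bsub>M\<^esub> a \<odot>\<^bsub>M\<^esub> m \<in> L i" by (auto simp: J_def)
    have "t \<odot>\<^bsub>M\<^esub> n \<oplus>\<^bsub>M\<^esub> (t \<otimes>\<^bsub>R\<^esub> a) \<odot>\<^bsub>M\<^esub> m = t \<odot>\<^bsub>M\<^esub> (n \<oplus>\<^bsub>M\<^esub> a \<odot>\<^bsub>M\<^esub> m)"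
      using h m NC(1) t by (simp add: subsetD smult_r_distr smult_assoc1)
    also have "\<dots> \<in> L i" using h t Ls[of i] by (auto simp: submodule_iff)
    finally show "t \<otimes>\<^bsub>R\<^esub> a \<in> J i" using h t N(1) by (auto simp: J_def submodule_iff)
  qed (auto simp: J_def)
  have "annihilator m \<subseteq> J i" for i
  proof
    fix a assume "a \<in> annihilator m"
    then show "a \<in> J i" using NC(2) LC(2)[of i] by (auto simp: J_def annihilator_def intro!: bexI[of _ "\<zero>\<^bsub>M\<^esub>"])
  qed
  moreover have "J (Suc i) \<subseteq> J i" for i using L by (auto simp: J_def)
  ultimately have "\<exists>n. \<forall>i\<ge>n. J i = J n"
    using dcc[unfolded dcc_above_def, rule_format, of J] Jid by blast
  then obtain n2 where n2: "\<And>i. i \<ge> n2 \<Longrightarrow> J i = J n2" by blast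
  have anti: "i \<le> j \<Longrightarrow> L j \<subseteq> L i" for i j using L lift_Suc_antimono_le[of L] by blast
  show "\<exists>n. \<forall>i\<ge>n. L i = L n"
  proof (intro exI[of _ "max n1 n2"] allI impI)
    fix i assume i: "i \<ge> max n1 n2"
    let ?k = "max n1 n2"
    have "L ?k \<subseteq> L i"
    proof
      fix l assume l: "l \<in> L ?k"
      then obtain n s where h: "l = n \<oplus>\<^bsub>M\<^esub> s \<odot>\<^bsub>M\<^esub> m" "n \<in> N" "s \<in> carrier R"
        using L by (fastforce simp: plus_cyclic_def)
      then have "s \<in> J ?k" using l by (auto simp: J_def)
      then have "s \<in> J i" using n2[of ?k] n2[of i] i by auto
      then obtain n' where n': "n' \<in> N" "n' \<oplus>\<^bsub>M\<^esub> s \<odot>\<^bsub>M\<^esub> m \<in> L i" by (auto simp: J_def)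
      have "n' \<oplus>\<^bsub>M\<^esub> s \<odot>\<^bsub>M\<^esub> m \<in> L ?k" using n'(2) anti[OF i] by auto
      \<comment> \<open>The two elements of \<open>L ?k\<close> have the same component along m.
        Their difference lies in N, where the chain has already stabilised.\<close>
      then have "l \<ominus>\<^bsub>M\<^esub> (n' \<oplus>\<^bsub>M\<^esub> s \<odot>\<^bsub>M\<^esub> m) \<in> L ?k" using l submodule_minus_closed[OF Ls] by blast
      moreover have eq: "l \<ominus>\<^bsub>M\<^esub> (n' \<oplus>\<^bsub>M\<^esub> s \<odot>\<^bsub>M\<^esub> m) = n \<ominus>\<^bsub>M\<^esub> n'"
      proof -
        have c: "n \<in> carrier M" "n' \<in> carrier M" "s \<odot>\<^bsub>M\<^esub> m \<in> carrier M" using h n' NC m by auto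
        have "n \<oplus>\<^bsub>M\<^esub> s \<odot>\<^bsub>M\<^esub> m = (n \<ominus>\<^bsub>M\<^esub> n') \<oplus>\<^bsub>M\<^esub> (n' \<oplus>\<^bsub>M\<^esub> s \<odot>\<^bsub>M\<^esub> m)"
          using c by (simp add: a_minus_def M.a_assoc M.r_neg1 M.r_neg2)
        moreover have "(x \<oplus>\<^bsub>M\<^esub> y) \<ominus>\<^bsub>M\<^esub> y = x" if "x \<in> carrier M" "y \<in> carrier M" for x y
          using that by (simp add: a_minus_def M.a_assoc M.r_neg)
        ultimately show ?thesis using c h(1) by (metis M.minus_closed M.a_closed)
      qed
      ultimately have "n \<ominus>\<^bsub>M\<^esub> n' \<in> L ?k \<inter> N" using submodule_minus_closed[OF N(1) h(2) n'(1)] by simp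
      then have "n \<ominus>\<^bsub>M\<^esub> n' \<in> L i" using n1[of ?k] n1[of i] i by auto
      then have "(n \<ominus>\<^bsub>M\<^esub> n') \<oplus>\<^bsub>M\<^esub> (n' \<oplus>\<^bsub>M\<^esub> s \<odot>\<^bsub>M\<^esub> m) \<in> L i" using n'(2) Ls[of i] by (auto simp: submodule_iff)
      moreover have "(n \<ominus>\<^bsub>M\<^esub> n') \<oplus>\<^bsub>M\<^esub> (n' \<oplus>\<^bsub>M\<^esub> s \<odot>\<^bsub>M\<^esub> m) = l"
      proof -
        have c: "n \<in> carrier M" "n' \<in> carrier M" "s \<odot>\<^bsub>M\<^esub> m \<in> carrier M" using h n' NC m by auto
        show ?thesis using c h(1)
          by (simp add: a_minus_def M.a_assoc M.r_neg1 M.r_neg2)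
      qed
      ultimately show "l \<in> L i" by simp
    qed
    then show "L i = L ?k" using anti[OF i] by auto
  qed
qed

text \<open>Induction on a finite generating set, adding one cyclic module at a time.\<close>

lemma locally_artinianI:
  assumes "\<And>m. m \<in> carrier M \<Longrightarrow> dcc_above R (annihilator m)"
  shows "locally_artinian R M"
  unfolding locally_artinian_def
proof (intro conjI allI impI)
  show "left_module R M" by unfold_locales
  fix N assume "fg_submodule N R M"
  then obtain A where A: "finite A" "A \<subseteq> carrier M" "N = submodule_generated R M A"
    by (auto simp: fg_submodule_def)
  have "\<exists>P. submodule P R M \<and> A \<subseteq> P \<and> dcc_below P" using A(1,2)
  proof (induction rule: finite_induct)
    case empty
    have "dcc_below {\<zero>\<^bsub>M\<^esub>}" unfolding dcc_below_def
    proof (intro allI impI exI[of _ 0])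
      fix L :: "nat \<Rightarrow> 'c set" and i :: nat
      assume "\<forall>i. submodule (L i) R M \<and> L i \<subseteq> {\<zero>\<^bsub>M\<^esub>} \<and> L (Suc i) \<subseteq> L i"
      then have "L i = {\<zero>\<^bsub>M\<^esub>}" for i by (auto simp: submodule_iff)
      then show "L i = L 0" by simp
    qed
    then show ?case using submodule_zero by blast
  next
    case (insert m A)
    then obtain P where "submodule P R M" "A \<subseteq> P" "dcc_below P" by auto
    then show ?case
      using submodule_plus_cyclic[of P m] dcc_below_plus_cyclic[of P m] assms[of m] insert.prems by blast
  qed
  then obtain P where P: "submodule P R M" "A \<subseteq> P" "dcc_below P" by blast
  have N: "submodule N R M" using A submodule_generated_submodule by simp
  have "N \<subseteq> P" using P A by (auto simp: submodule_generated_def)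
  then show "artinian_module R (restrict_module M N)"
    unfolding artinian_module_def using left_module_restrict[OF N] P(3)[unfolded dcc_below_def]
    by (simp add: submodule_restrict[OF N]) (meson subset_trans)
qed

end

lemma restrict_restrict [simp]: "restrict_module (restrict_module M A) B = restrict_module M B"
  by simp

text \<open>In a hull E of a simple N every nonzero submodule contains N. If f m is a nonzero
  element of N, then f lies in every left ideal strictly above the annihilator of m, which is
  therefore monolithic.\<close>

lemma diamond_propertyI:
  assumes "\<And>I. monolithic R I \<Longrightarrow> dcc_above R I"
  shows "diamond_property (R :: ('a, 'r) ring_scheme)"
  unfolding diamond_property_def
proof (intro allI impI, elim conjE)
  fix E :: "('a, 'a \<Rightarrow> rat) module" and N
  assume simple: "simple_module R (restrict_module E N)" and hull: "injective_hull R N E"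
  have mod: "left_module R E" and ess: "essential_submodule N R E"
    using hull by (auto simp: injective_hull_def injective_module_def)
  interpret left_module R E by (rule mod)
  have N: "submodule N R E" using ess by (simp add: essential_submodule_def)
  show "locally_artinian R E"
  proof (rule locally_artinianI)
    fix m assume m: "m \<in> carrier E"
    show "dcc_above R (annihilator m)"
    proof (cases "m = \<zero>\<^bsub>E\<^esub>")
      case True
      then have "annihilator m = carrier R" by (auto simp: annihilator_def)
      then show ?thesis unfolding dcc_above_def left_ideal_def by (metis subset_antisym)
    next
      case False
      have ann: "left_ideal (annihilator m) R"
        using left_ideal_colon[OF submodule_zero m] by (simp add: annihilator_def)
      have meets: "N \<subseteq> L" if L: "submodule L R E" "L \<noteq> {\<zero>\<^bsub>E\<^esub>}" for L
      proof -
        have "L \<inter> N \<noteq> {\<zero>\<^bsub>E\<^esub>}" using ess L by (auto simp: essential_submodule_def)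
        moreover have "submodule (L \<inter> N) R (restrict_module E N)"
          using submodule_restrict[OF N] submodule_Int[OF L(1) N] by auto
        ultimately have "L \<inter> N = N" using simple by (auto simp: simple_module_def)
        then show ?thesis by auto
      qed
      have "N \<noteq> {\<zero>\<^bsub>E\<^esub>}" using simple by (auto simp: simple_module_def)
      then obtain n where n: "n \<in> N" "n \<noteq> \<zero>\<^bsub>E\<^esub>" using N by (auto simp: submodule_iff)
      have "N \<subseteq> cyclic m" using meets[OF submodule_cyclic[OF m]] mem_cyclic[OF m] False by auto
      then obtain f where f: "f \<in> carrier R" "n = f \<odot>\<^bsub>E\<^esub> m" using n by (auto simp: cyclic_def)
      have "monolithic R (annihilator m)"
        unfolding monolithic_def
      proof (intro conjI ann bexI[of _ f] allI impI f(1))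
        show "f \<notin> annihilator m" using n f by (auto simp: annihilator_def)
        fix J assume "left_ideal J R \<and> annihilator m \<subset> J"
        then have J: "left_ideal J R" "annihilator m \<subset> J" by auto
        let ?L = "{s \<odot>\<^bsub>E\<^esub> m | s. s \<in> J}"
        have JC: "J \<subseteq> carrier R" using J by (auto simp: left_ideal_def)
        obtain j where "j \<in> J" "j \<notin> annihilator m" using J by auto
        then have "?L \<noteq> {\<zero>\<^bsub>E\<^esub>}" using JC by (auto simp: annihilator_def)
        then have "N \<subseteq> ?L" using meets ideal_smult_submodule[OF J(1) m] by blast
        then obtain j where j: "j \<in> J" "f \<odot>\<^bsub>E\<^esub> m = j \<odot>\<^bsub>E\<^esub> m" using n f by auto
        then have jc: "j \<in> carrier R" using JC by auto
        have "f \<oplus>\<^bsub>R\<^esub> \<ominus>\<^bsub>R\<^esub> j \<in> annihilator m"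
          using j jc f m by (auto simp: annihilator_def smult_l_distr smult_minus_left M.r_neg)
        then have "(f \<oplus>\<^bsub>R\<^esub> \<ominus>\<^bsub>R\<^esub> j) \<oplus>\<^bsub>R\<^esub> j \<in> J" using J j by (auto simp: left_ideal_def)
        then show "f \<in> J" using f jc by (simp add: R.a_assoc R.l_neg)
      qed
      then show ?thesis by (rule assms)
    qed
  qed
qed

section \<open>The injective module of additive characters\<close>

text \<open>This is Hom_Z(R, Q) with (s \<chi>)(a) = \<chi>(a s), injective because Q is divisible.
  The value 0 outside the carrier makes equal characters equal as functions. The type is the one
  over which \<open>diamond_property\<close> ranges.\<close>

definition char_module :: "('a, 'r) ring_scheme \<Rightarrow> ('a, 'a \<Rightarrow> rat) module" where
  "char_module R =
     \<lparr>carrier = {\<chi>. (\<forall>a\<in>carrier R. \<forall>b\<in>carrier R. \<chi> (a \<oplus>\<^bsub>R\<^esub> b) = \<chi> a + \<chi> b) \<and> (\<forall>a. a \<notin> carrier R \<longrightarrow> \<chi> a = 0)},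
      mult = undefined, one = undefined, zero = (\<lambda>a. 0), add = (\<lambda>\<chi> \<psi> a. \<chi> a + \<psi> a),
      smult = (\<lambda>s \<chi> a. if a \<in> carrier R then \<chi> (a \<otimes>\<^bsub>R\<^esub> s) else 0)\<rparr>"

text \<open>A copy of Q in R turns R-modules into rational vector spaces, so that additive maps into
  Q separate points. In general, elements of finite order would force Q/Z as the target.\<close>

locale rational_ring = ring R for R (structure) +
  fixes \<rho> :: "rat \<Rightarrow> 'a"
  assumes rho_closed [simp]: "\<rho> r \<in> carrier R"
    and rho_add: "\<rho> (r + s) = \<rho> r \<oplus> \<rho> s"
    and rho_mult: "\<rho> (r * s) = \<rho> r \<otimes> \<rho> s"
    and rho_one [simp]: "\<rho> 1 = \<one>"
begin

lemma rho0: "\<rho> 0 = \<zero>" using rho_add[of 0 0] by (metis add_0 add.r_cancel_one' rho_closed)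

lemma rhom: "\<rho> (- r) = \<ominus> \<rho> r"
  using rho_add[of "- r" r] rho0 by (simp add: minus_equality)

abbreviation "H \<equiv> char_module R"

lemma left_module_char: "left_module R H"
proof -
  have "abelian_group H"
  proof (rule abelian_groupI)
    fix \<chi> assume "\<chi> \<in> carrier H"
    then show "\<exists>\<psi>\<in>carrier H. \<psi> \<oplus>\<^bsub>H\<^esub> \<chi> = \<zero>\<^bsub>H\<^esub>"
      by (intro bexI[of _ "\<lambda>a. - \<chi> a"]) (auto simp: char_module_def)
  qed (auto simp: char_module_def algebra_simps)
  then interpret H: abelian_group H .
  show ?thesis
    by unfold_locales (auto simp: char_module_def fun_eq_iff l_distr r_distr m_assoc)
qed

lemma char_smult_eq_zero_iff: "s \<odot>\<^bsub>H\<^esub> \<chi> = \<zero>\<^bsub>H\<^esub> \<longleftrightarrow> (\<forall>a\<in>carrier R. \<chi> (a \<otimes> s) = 0)"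
  by (auto simp: char_module_def fun_eq_iff)

text \<open>Partial additive maps into \<open>\<rat>\<close>, defined on rational subspaces, are handled as graphs, so that Zorn's
  lemma for inclusion applies to them.\<close>

definition graphs :: "('a, 'y, 'm) module_scheme \<Rightarrow> ('y \<times> rat) set set" where
  "graphs M = {G. G \<subseteq> carrier M \<times> UNIV \<and> G \<noteq> {} \<and>
     (\<forall>y v z w. (y, v) \<in> G \<longrightarrow> (z, w) \<in> G \<longrightarrow> (y \<ominus>\<^bsub>M\<^esub> z, v - w) \<in> G) \<and>
     (\<forall>y v r. (y, v) \<in> G \<longrightarrow> (\<exists>w. (\<rho> r \<odot>\<^bsub>M\<^esub> y, w) \<in> G)) \<and>
     (\<forall>v. (\<zero>\<^bsub>M\<^esub>, v) \<in> G \<longrightarrow> v = 0)}"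

lemma graphsI:
  assumes "G \<subseteq> carrier M \<times> UNIV" "G \<noteq> {}"
    "\<And>y v z w. (y, v) \<in> G \<Longrightarrow> (z, w) \<in> G \<Longrightarrow> (y \<ominus>\<^bsub>M\<^esub> z, v - w) \<in> G"
    "\<And>y v r. (y, v) \<in> G \<Longrightarrow> \<exists>w. (\<rho> r \<odot>\<^bsub>M\<^esub> y, w) \<in> G"
    "\<And>v. (\<zero>\<^bsub>M\<^esub>, v) \<in> G \<Longrightarrow> v = 0"
  shows "G \<in> graphs M"
  using assms unfolding graphs_def mem_Collect_eq by metis

lemma graphsD:
  assumes "G \<in> graphs M"
  shows "G \<subseteq> carrier M \<times> UNIV" "G \<noteq> {}"
    "\<And>y v z w. (y, v) \<in> G \<Longrightarrow> (z, w) \<in> G \<Longrightarrow> (y \<ominus>\<^bsub>M\<^esub> z, v - w) \<in> G"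
    "\<And>y v r. (y, v) \<in> G \<Longrightarrow> \<exists>w. (\<rho> r \<odot>\<^bsub>M\<^esub> y, w) \<in> G"
    "\<And>v. (\<zero>\<^bsub>M\<^esub>, v) \<in> G \<Longrightarrow> v = 0"
  using assms unfolding graphs_def mem_Collect_eq by metis+

text \<open>A graph that is maximal under inclusion has full domain, because otherwise one more
  vector could be given the value 0.\<close>

lemma graph_extension:
  fixes M :: "('a, 'y, 'm) module_scheme"
  assumes "left_module R M" and G0: "G0 \<in> graphs M"
  shows "\<exists>\<psi>. (\<forall>y\<in>carrier M. \<forall>z\<in>carrier M. \<psi> (y \<oplus>\<^bsub>M\<^esub> z) = \<psi> y + \<psi> z) \<and> (\<forall>y v. (y, v) \<in> G0 \<longrightarrow> \<psi> y = v)"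
proof -
  interpret left_module R M by fact
  have "\<exists>G\<in>{G \<in> graphs M. G0 \<subseteq> G}. \<forall>X\<in>{G \<in> graphs M. G0 \<subseteq> G}. G \<subseteq> X \<longrightarrow> X = G"
  proof (rule subset_Zorn_nonempty)
    fix C assume C: "C \<noteq> {}" "subset.chain {G \<in> graphs M. G0 \<subseteq> G} C"
    have mem: "G \<in> graphs M" "G0 \<subseteq> G" if "G \<in> C" for G using C that by (auto simp: subset.chain_def)
    have two: "\<exists>G\<in>C. p \<in> G \<and> p' \<in> G" if "p \<in> \<Union>C" "p' \<in> \<Union>C" for p p'
    proof -
      obtain A B where "A \<in> C" "p \<in> A" "B \<in> C" "p' \<in> B" using \<open>p \<in> \<Union>C\<close> \<open>p' \<in> \<Union>C\<close> by auto
      moreover from this have "A \<subseteq> B \<or> B \<subseteq> A" using C(2) unfolding subset.chain_def by blast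
      ultimately show ?thesis by blast
    qed
    have "\<Union>C \<in> graphs M"
    proof (rule graphsI)
      show "\<Union>C \<subseteq> carrier M \<times> UNIV" using graphsD(1)[OF mem(1)] by blast
      show "\<Union>C \<noteq> {}" using C(1) graphsD(2)[OF mem(1)] by blast
      fix y v z w assume "(y, v) \<in> \<Union>C" "(z, w) \<in> \<Union>C"
      then obtain G where "G \<in> C" "(y, v) \<in> G" "(z, w) \<in> G" using two by blast
      then show "(y \<ominus>\<^bsub>M\<^esub> z, v - w) \<in> \<Union>C" using graphsD(3)[OF mem(1)] by blast
    next
      fix y v r assume "(y, v) \<in> \<Union>C"
      then show "\<exists>w. (\<rho> r \<odot>\<^bsub>M\<^esub> y, w) \<in> \<Union>C" using graphsD(4)[OF mem(1)] by blast
    next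
      fix v assume "(\<zero>\<^bsub>M\<^esub>, v) \<in> \<Union>C"
      then show "v = 0" using graphsD(5)[OF mem(1)] by blast
    qed
    then show "\<Union>C \<in> {G \<in> graphs M. G0 \<subseteq> G}" using C(1) mem(2) by auto
  qed (use G0 in auto)
  then obtain G where G: "G \<in> graphs M" "G0 \<subseteq> G" and
    max: "\<And>X. X \<in> graphs M \<Longrightarrow> G \<subseteq> X \<Longrightarrow> X = G" by fastforce
  have GC: "y \<in> carrier M" if "(y, v) \<in> G" for y v using graphsD(1)[OF G(1)] that by blast
  have Gm: "(y \<ominus>\<^bsub>M\<^esub> z, v - w) \<in> G" if "(y, v) \<in> G" "(z, w) \<in> G" for y v z w
    using graphsD(3)[OF G(1)] that by blast
  have Gq: "\<exists>w. (\<rho> r \<odot>\<^bsub>M\<^esub> y, w) \<in> G" if "(y, v) \<in> G" for y v r using graphsD(4)[OF G(1)] that by blast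
  have G0': "v = 0" if "(\<zero>\<^bsub>M\<^esub>, v) \<in> G" for v using graphsD(5)[OF G(1)] that by blast
  have Gz: "(\<zero>\<^bsub>M\<^esub>, 0) \<in> G"
  proof -
    obtain y v where yv: "(y, v) \<in> G" using graphsD(2)[OF G(1)] by (metis equals0I surj_pair)
    show ?thesis using Gm[OF yv yv] GC[OF yv] by (simp add: a_minus_def M.r_neg)
  qed
  have Ga: "(y \<oplus>\<^bsub>M\<^esub> z, v + w) \<in> G" if h: "(y, v) \<in> G" "(z, w) \<in> G" for y v z w
    using Gm[OF h(1) Gm[OF Gz h(2)]] GC[OF h(1)] GC[OF h(2)] by (simp add: a_minus_def)
  have uniq: "v = w" if h: "(y, v) \<in> G" "(y, w) \<in> G" for y v w
    using Gm[OF h] GC[OF h(1)] G0'[of "v - w"] by (simp add: a_minus_def M.r_neg)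
  have total: "\<exists>v. (y, v) \<in> G" if y: "y \<in> carrier M" for y
  proof (rule ccontr)
    assume ny: "\<not> ?thesis"
    \<comment> \<open>The new vector y is sent to 0. The domain of G is closed under rational
      multiples and misses y, so it meets the line Q y only in 0 and the value is well
      defined.\<close>
    let ?X = "{(d \<oplus>\<^bsub>M\<^esub> \<rho> r \<odot>\<^bsub>M\<^esub> y, v) | d r v. (d, v) \<in> G}"
    have "(y, 0) \<in> ?X"
    proof -
      have "y = \<zero>\<^bsub>M\<^esub> \<oplus>\<^bsub>M\<^esub> \<rho> 1 \<odot>\<^bsub>M\<^esub> y" using y by simp
      then show ?thesis using Gz by blast
    qed
    moreover have "G \<subseteq> ?X"
    proof clarify
      fix z v assume zv: "(z, v) \<in> G"
      then have "z = z \<oplus>\<^bsub>M\<^esub> \<rho> 0 \<odot>\<^bsub>M\<^esub> y" using y GC[OF zv] rho0 by simp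
      then show "\<exists>d r v'. (z, v) = (d \<oplus>\<^bsub>M\<^esub> \<rho> r \<odot>\<^bsub>M\<^esub> y, v') \<and> (d, v') \<in> G" using zv by blast
    qed
    moreover have "?X \<in> graphs M"
    proof (rule graphsI)
      show "?X \<subseteq> carrier M \<times> UNIV" using GC y by auto
      show "?X \<noteq> {}" using Gz by blast
      fix a v b w assume "(a, v) \<in> ?X" "(b, w) \<in> ?X"
      then obtain d r e s where h: "a = d \<oplus>\<^bsub>M\<^esub> \<rho> r \<odot>\<^bsub>M\<^esub> y" "b = e \<oplus>\<^bsub>M\<^esub> \<rho> s \<odot>\<^bsub>M\<^esub> y" "(d, v) \<in> G" "(e, w) \<in> G"
        by blast
      have "a \<ominus>\<^bsub>M\<^esub> b = (d \<ominus>\<^bsub>M\<^esub> e) \<oplus>\<^bsub>M\<^esub> \<rho> (r - s) \<odot>\<^bsub>M\<^esub> y"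
        using h GC[OF h(3)] GC[OF h(4)] y rho_add[of r "- s"] rhom[of s]
        by (simp add: a_minus_def smult_l_distr smult_minus_left M.minus_add M.a_ac)
      then show "(a \<ominus>\<^bsub>M\<^esub> b, v - w) \<in> ?X" using Gm[OF h(3,4)] by blast
    next
      fix a v r assume "(a, v) \<in> ?X"
      then obtain d s where h: "a = d \<oplus>\<^bsub>M\<^esub> \<rho> s \<odot>\<^bsub>M\<^esub> y" "(d, v) \<in> G" by blast
      obtain w where w: "(\<rho> r \<odot>\<^bsub>M\<^esub> d, w) \<in> G" using Gq[OF h(2)] by blast
      have "\<rho> r \<odot>\<^bsub>M\<^esub> a = \<rho> r \<odot>\<^bsub>M\<^esub> d \<oplus>\<^bsub>M\<^esub> \<rho> (r * s) \<odot>\<^bsub>M\<^esub> y"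
        using h GC[OF h(2)] y by (simp add: smult_r_distr rho_mult smult_assoc1)
      then show "\<exists>w. (\<rho> r \<odot>\<^bsub>M\<^esub> a, w) \<in> ?X" using w by blast
    next
      fix v assume "(\<zero>\<^bsub>M\<^esub>, v) \<in> ?X"
      then obtain d s where h: "\<zero>\<^bsub>M\<^esub> = d \<oplus>\<^bsub>M\<^esub> \<rho> s \<odot>\<^bsub>M\<^esub> y" "(d, v) \<in> G" by blast
      have d: "d \<in> carrier M" using GC h by blast
      show "v = 0"
      proof (cases "s = 0")
        case True
        then show ?thesis using h d y rho0 G0' by simp
      next
        case False
        have "\<rho> s \<odot>\<^bsub>M\<^esub> y = \<ominus>\<^bsub>M\<^esub> d" using h(1) d y by (metis M.minus_equality M.minus_minus M.a_comm rho_closed smult_closed)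
        then have "(\<rho> s \<odot>\<^bsub>M\<^esub> y, - v) \<in> G" using Gm[OF Gz h(2)] d by (simp add: a_minus_def)
        then obtain w where "(\<rho> (inverse s) \<odot>\<^bsub>M\<^esub> (\<rho> s \<odot>\<^bsub>M\<^esub> y), w) \<in> G" using Gq by blast
        moreover have "\<rho> (inverse s) \<odot>\<^bsub>M\<^esub> (\<rho> s \<odot>\<^bsub>M\<^esub> y) = y"
          using False y smult_assoc1[of "\<rho> (inverse s)" "\<rho> s" y] rho_mult[of "inverse s" s, symmetric] by simp
        ultimately show ?thesis using ny by auto
      qed
    qed
    ultimately show False using max[of ?X] ny by blast
  qed
  define \<psi> where "\<psi> y = (THE v. (y, v) \<in> G)" for y
  have psi: "\<psi> y = v" if "(y, v) \<in> G" for y v unfolding \<psi>_def using that uniq by blast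
  show ?thesis
  proof (intro exI[of _ \<psi>] conjI ballI allI impI)
    fix y z assume "y \<in> carrier M" "z \<in> carrier M"
    then obtain v w where "(y, v) \<in> G" "(z, w) \<in> G" using total by blast
    then show "\<psi> (y \<oplus>\<^bsub>M\<^esub> z) = \<psi> y + \<psi> z" using Ga psi by metis
  qed (use psi G(2) in auto)
qed

text \<open>A homomorphism g into \<open>H\<close> is determined by the additive map y |-> g y 1,
  since g y a = g (a y) 1. Lifting homomorphisms thus amounts to extending additive maps into
  Q.\<close>

lemma char_module_injective:
  fixes M :: "('a, 'y, 'm) module_scheme"
  assumes "left_module R M" and X: "submodule X R M" and f: "f \<in> left_module_hom R (restrict_module M X) H"
  shows "\<exists>g\<in>left_module_hom R M H. \<forall>m\<in>X. g m = f m"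
proof -
  interpret left_module R M by fact
  have X': "X \<subseteq> carrier M" "\<zero>\<^bsub>M\<^esub> \<in> X" "\<And>a b. a \<in> X \<Longrightarrow> b \<in> X \<Longrightarrow> a \<oplus>\<^bsub>M\<^esub> b \<in> X"
      "\<And>s a. s \<in> carrier R \<Longrightarrow> a \<in> X \<Longrightarrow> s \<odot>\<^bsub>M\<^esub> a \<in> X"
    using X by (auto simp: submodule_iff)
  have fC: "f x \<in> carrier H" if "x \<in> X" for x using f that by (auto simp: left_module_hom_def)
  have fa: "f (x \<oplus>\<^bsub>M\<^esub> y) a = f x a + f y a" if "x \<in> X" "y \<in> X" for x y a
    using f that by (auto simp: left_module_hom_def char_module_def)
  have fs: "f (s \<odot>\<^bsub>M\<^esub> x) a = f x (a \<otimes> s)" if "x \<in> X" "s \<in> carrier R" "a \<in> carrier R" for x s a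
    using f that by (auto simp: left_module_hom_def char_module_def)
  let ?G = "{(x, f x \<one>) | x. x \<in> X}"
  have f0: "f \<zero>\<^bsub>M\<^esub> a = 0" for a using fa[OF X'(2) X'(2), of a] by simp
  have fm: "f (x \<ominus>\<^bsub>M\<^esub> y) a = f x a - f y a" if "x \<in> X" "y \<in> X" for x y a
  proof -
    have "f ((x \<ominus>\<^bsub>M\<^esub> y) \<oplus>\<^bsub>M\<^esub> y) a = f (x \<ominus>\<^bsub>M\<^esub> y) a + f y a"
      using submodule_minus_closed[OF X that] that by (simp add: fa)
    moreover have "(x \<ominus>\<^bsub>M\<^esub> y) \<oplus>\<^bsub>M\<^esub> y = x"
      using that X'(1) by (simp add: a_minus_def M.a_assoc M.l_neg subsetD)
    ultimately show ?thesis by simp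
  qed
  have "?G \<in> graphs M"
  proof (rule graphsI)
    fix y v z w assume "(y, v) \<in> ?G" "(z, w) \<in> ?G"
    then show "(y \<ominus>\<^bsub>M\<^esub> z, v - w) \<in> ?G" using submodule_minus_closed[OF X] fm by auto
  next
    fix y v r assume "(y, v) \<in> ?G"
    then show "\<exists>w. (\<rho> r \<odot>\<^bsub>M\<^esub> y, w) \<in> ?G" using X'(4) by auto
  qed (use X' f0 in auto)
  then have "\<exists>\<psi>. (\<forall>y\<in>carrier M. \<forall>z\<in>carrier M. \<psi> (y \<oplus>\<^bsub>M\<^esub> z) = \<psi> y + \<psi> z) \<and> (\<forall>y v. (y, v) \<in> ?G \<longrightarrow> \<psi> y = v)"
    by (rule graph_extension[OF assms(1)])
  then obtain \<psi> where "\<forall>y\<in>carrier M. \<forall>z\<in>carrier M. \<psi> (y \<oplus>\<^bsub>M\<^esub> z) = \<psi> y + \<psi> z"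
    and "\<forall>y v. (y, v) \<in> ?G \<longrightarrow> \<psi> y = v" by (elim exE conjE)
  then have add: "\<And>y z. y \<in> carrier M \<Longrightarrow> z \<in> carrier M \<Longrightarrow> \<psi> (y \<oplus>\<^bsub>M\<^esub> z) = \<psi> y + \<psi> z"
    and ext: "\<And>x. x \<in> X \<Longrightarrow> \<psi> x = f x \<one>" by blast+
  define g where "g y = (\<lambda>a. if a \<in> carrier R then \<psi> (a \<odot>\<^bsub>M\<^esub> y) else 0)" for y
  show ?thesis
  proof (intro bexI[of _ g] ballI)
    show "g \<in> left_module_hom R M H"
      unfolding left_module_hom_def
    proof (intro CollectI conjI ballI funcsetI)
      fix x assume x: "x \<in> carrier M"
      then show "g x \<in> carrier H" by (simp add: char_module_def g_def smult_l_distr add)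
      fix y assume "y \<in> carrier M"
      then show "g (x \<oplus>\<^bsub>M\<^esub> y) = g x \<oplus>\<^bsub>H\<^esub> g y"
        using x by (simp add: char_module_def g_def fun_eq_iff smult_r_distr add)
    next
      fix s x assume "s \<in> carrier R" "x \<in> carrier M"
      then show "g (s \<odot>\<^bsub>M\<^esub> x) = s \<odot>\<^bsub>H\<^esub> g x"
        by (simp add: char_module_def g_def fun_eq_iff smult_assoc1)
    qed
    fix x assume x: "x \<in> X"
    show "g x = f x"
    proof
      fix a show "g x a = f x a"
        using fs[OF x, of a \<one>] ext[of "a \<odot>\<^bsub>M\<^esub> x"] X'(4)[of a x] x fC[OF x] by (auto simp: g_def char_module_def)
    qed
  qed
qed

text \<open>R / I is realised as a cyclic submodule R \<chi> of \<open>H\<close>, and a hull of its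
  simple submodule is cut out of \<open>H\<close> as a maximal essential extension E. Inside an
  injective module such an E is a retract, hence injective, and \<open>diamond_property\<close>
  applies to it.\<close>

lemma dcc_aboveI_diamond:
  assumes diamond: "diamond_property R" and mono: "monolithic R I"
  shows "dcc_above R I"
proof -
  interpret H: left_module R H by (rule left_module_char)
  obtain f where I: "left_ideal I R" and f: "f \<in> carrier R" "f \<notin> I"
    and fJ: "\<And>J. left_ideal J R \<Longrightarrow> I \<subset> J \<Longrightarrow> f \<in> J"
    using mono unfolding monolithic_def by blast
  have I': "I \<subseteq> carrier R" "\<zero> \<in> I" "\<And>a b. a \<in> I \<Longrightarrow> b \<in> I \<Longrightarrow> a \<oplus> b \<in> I"
      "\<And>s a. s \<in> carrier R \<Longrightarrow> a \<in> I \<Longrightarrow> s \<otimes> a \<in> I"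
    using I by (auto simp: left_ideal_def)
  define Reg :: "('a, 'a) module" where "Reg = \<lparr>carrier = carrier R, mult = mult R, one = one R, zero = zero R, add = add R, smult = mult R\<rparr>"
  have "abelian_group Reg"
    by (rule abelian_groupI) (auto simp: Reg_def a_assoc intro: a_comm)
  then have Reg: "left_module R Reg"
    by (intro left_module.intro left_module_axioms.intro ring_axioms) (auto simp: Reg_def l_distr r_distr m_assoc)
  interpret Reg: left_module R Reg by (rule Reg)
  have Iinv: "\<ominus> a \<in> I" if "a \<in> I" for a
    using I'(4)[of "\<ominus> \<one>" a] I'(1) that by (auto simp: l_minus subsetD)
  have reg_minus: "a \<ominus>\<^bsub>Reg\<^esub> b = a \<ominus> b" if "b \<in> carrier R" for a b
    using Reg.M.minus_equality[of "\<ominus> b" b] that by (simp add: Reg_def a_minus_def l_neg)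
  \<comment> \<open>The additive map on I + Q f that kills I and sends f to 1; it is well defined
    because f is not in I.\<close>
  define G where "G = {(i \<oplus> \<rho> r \<otimes> f, r) | i r. i \<in> I}"
  have "G \<in> graphs Reg"
  proof (rule graphsI)
    show "G \<subseteq> carrier Reg \<times> UNIV" using I' f by (auto simp: G_def Reg_def)
    show "G \<noteq> {}" using I'(2) by (auto simp: G_def)
    fix y v z w assume "(y, v) \<in> G" "(z, w) \<in> G"
    then obtain i j where h: "y = i \<oplus> \<rho> v \<otimes> f" "z = j \<oplus> \<rho> w \<otimes> f" "i \<in> I" "j \<in> I" by (auto simp: G_def)
    have "y \<ominus> z = (i \<oplus> \<ominus> j) \<oplus> \<rho> (v - w) \<otimes> f"
      using h I'(1) f rho_add[of v "- w"] by (simp add: a_minus_def rhom l_distr l_minus minus_add a_ac subsetD)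
    moreover have "z \<in> carrier R" using h I'(1) f by auto
    moreover have "i \<oplus> \<ominus> j \<in> I" using h I'(3) Iinv by blast
    ultimately show "(y \<ominus>\<^bsub>Reg\<^esub> z, v - w) \<in> G" unfolding G_def by (auto simp: reg_minus)
  next
    fix y v r assume "(y, v) \<in> G"
    then obtain i where h: "y = i \<oplus> \<rho> v \<otimes> f" "i \<in> I" by (auto simp: G_def)
    have "\<rho> r \<otimes> y = \<rho> r \<otimes> i \<oplus> \<rho> (r * v) \<otimes> f"
      using h I'(1) f by (simp add: r_distr rho_mult m_assoc subsetD)
    then show "\<exists>w. (\<rho> r \<odot>\<^bsub>Reg\<^esub> y, w) \<in> G" using I'(4)[OF rho_closed h(2)] unfolding G_def Reg_def by auto
  next
    fix v assume "(\<zero>\<^bsub>Reg\<^esub>, v) \<in> G"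
    then obtain i where h: "\<zero> = i \<oplus> \<rho> v \<otimes> f" "i \<in> I" by (auto simp: G_def Reg_def)
    have i: "i \<in> carrier R" using h I' by auto
    show "v = 0"
    proof (rule ccontr)
      assume "v \<noteq> 0"
      have "\<rho> v \<otimes> f = \<ominus> i" using h(1) i f by (metis minus_equality minus_minus a_comm m_closed rho_closed)
      then have "\<rho> v \<otimes> f \<in> I" using Iinv h(2) by simp
      then have "\<rho> (inverse v) \<otimes> (\<rho> v \<otimes> f) \<in> I" using I'(4) by simp
      moreover have "\<rho> (inverse v) \<otimes> (\<rho> v \<otimes> f) = f"
        using \<open>v \<noteq> 0\<close> f m_assoc[of "\<rho> (inverse v)" "\<rho> v" f] rho_mult[of "inverse v" v, symmetric] by simp
      ultimately show False using f by simp
    qed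
  qed
  then obtain \<psi> where add: "\<And>y z. y \<in> carrier R \<Longrightarrow> z \<in> carrier R \<Longrightarrow> \<psi> (y \<oplus> z) = \<psi> y + \<psi> z"
    and ext: "\<And>y v. (y, v) \<in> G \<Longrightarrow> \<psi> y = v" using graph_extension[OF Reg, of G] by (auto simp: Reg_def)
  define \<chi> where "\<chi> = (\<lambda>a. if a \<in> carrier R then \<psi> a else 0)"
  have chiC: "\<chi> \<in> carrier H" by (auto simp: \<chi>_def char_module_def add)
  have chiI: "\<chi> a = 0" if "a \<in> I" for a
  proof -
    have "a = a \<oplus> \<rho> 0 \<otimes> f" using that I' f rho0 by (auto simp: subsetD)
    then have "(a, 0) \<in> G" using that unfolding G_def by blast
    then show ?thesis using ext by (auto simp: \<chi>_def)
  qed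
  have chif: "\<chi> f = 1"
  proof -
    have "f = \<zero> \<oplus> \<rho> 1 \<otimes> f" using f by simp
    then have "(f, 1) \<in> G" using I' unfolding G_def by blast
    then show ?thesis using ext f by (auto simp: \<chi>_def)
  qed
  \<comment> \<open>The annihilator contains I but not f, whereas f lies in every left ideal
    strictly above I.\<close>
  have annI: "H.annihilator \<chi> = I"
  proof (rule ccontr)
    assume ne: "H.annihilator \<chi> \<noteq> I"
    have "left_ideal (H.annihilator \<chi>) R"
      using H.left_ideal_colon[OF H.submodule_zero chiC] by (simp add: H.annihilator_def)
    moreover have "I \<subseteq> H.annihilator \<chi>" using I' chiI by (auto simp: H.annihilator_def char_smult_eq_zero_iff)
    ultimately have "f \<in> H.annihilator \<chi>" using fJ ne by blast
    then have "\<chi> (\<one> \<otimes> f) = 0"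
      unfolding H.annihilator_def char_smult_eq_zero_iff by blast
    then show False using chif f by simp
  qed
  let ?f = "f \<odot>\<^bsub>H\<^esub> \<chi>"
  have fC: "?f \<in> carrier H" using f chiC by simp
  \<comment> \<open>The simple submodule: every nonzero submodule of R \<chi> contains f
    \<chi>.\<close>
  define N where "N = H.cyclic ?f"
  have N: "submodule N R H" using H.submodule_cyclic[OF fC] by (simp add: N_def)
  have f_ne: "?f \<noteq> \<zero>\<^bsub>H\<^esub>" using annI f by (auto simp: H.annihilator_def)
  have fN: "?f \<in> N" using H.mem_cyclic[OF fC] by (simp add: N_def)
  have f_mem: "?f \<in> L" if L: "submodule L R H" "L \<subseteq> H.cyclic \<chi>" "L \<noteq> {\<zero>\<^bsub>H\<^esub>}" for L
  proof -
    let ?J = "{s \<in> carrier R. s \<odot>\<^bsub>H\<^esub> \<chi> \<in> L}"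
    have z: "\<zero>\<^bsub>H\<^esub> \<in> L" using L(1) by (simp add: H.submodule_iff)
    obtain l where "l \<in> L" "l \<noteq> \<zero>\<^bsub>H\<^esub>" using L(3) z by auto
    then obtain s where "s \<in> carrier R" "s \<odot>\<^bsub>H\<^esub> \<chi> \<in> L" "s \<odot>\<^bsub>H\<^esub> \<chi> \<noteq> \<zero>\<^bsub>H\<^esub>" using L(2) by (auto simp: H.cyclic_def)
    then have "s \<in> ?J" "s \<notin> I" using annI by (auto simp: H.annihilator_def)
    moreover have "I \<subseteq> ?J" using annI z by (auto simp: H.annihilator_def)
    ultimately show ?thesis using fJ[OF H.left_ideal_colon[OF L(1) chiC]] by blast
  qed
  have Ncyc: "N \<subseteq> H.cyclic \<chi>" unfolding N_def
    by (rule H.cyclic_minimal[OF H.submodule_cyclic[OF chiC]]) (use f in \<open>auto simp: H.cyclic_def\<close>)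
  have simple: "simple_module R (restrict_module H N)"
    unfolding simple_module_def
  proof (intro conjI allI impI)
    show "left_module R (restrict_module H N)" by (rule H.left_module_restrict[OF N])
    show "carrier (restrict_module H N) \<noteq> {\<zero>\<^bsub>restrict_module H N\<^esub>}" using f_ne fN by auto
    fix L assume "submodule L R (restrict_module H N)"
    then have L: "submodule L R H" "L \<subseteq> N" using H.submodule_restrict[OF N] by auto
    show "L = {\<zero>\<^bsub>restrict_module H N\<^esub>} \<or> L = carrier (restrict_module H N)"
    proof (cases "L = {\<zero>\<^bsub>H\<^esub>}")
      case False
      then have "?f \<in> L" using f_mem L Ncyc by blast
      then have "N \<subseteq> L" unfolding N_def by (rule H.cyclic_minimal[OF L(1)])
      then show ?thesis using L by auto
    qed auto
  qed
  \<comment> \<open>Essentiality of N is stated elementwise because this form passes to unions of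
    chains.\<close>
  define ess where "ess E \<longleftrightarrow> submodule E R H \<and> H.cyclic \<chi> \<subseteq> E \<and>
     (\<forall>l\<in>E. l \<noteq> \<zero>\<^bsub>H\<^esub> \<longrightarrow> (\<exists>s\<in>carrier R. s \<odot>\<^bsub>H\<^esub> l \<in> N \<and> s \<odot>\<^bsub>H\<^esub> l \<noteq> \<zero>\<^bsub>H\<^esub>))" for E
  have ess0: "ess (H.cyclic \<chi>)"
    unfolding ess_def
  proof (intro conjI ballI impI order_refl)
    show "submodule (H.cyclic \<chi>) R H" by (rule H.submodule_cyclic[OF chiC])
    fix l assume l: "l \<in> H.cyclic \<chi>" "l \<noteq> \<zero>\<^bsub>H\<^esub>"
    have lC: "l \<in> carrier H" using l(1) H.submodule_cyclic[OF chiC] by (auto simp: H.submodule_iff)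
    have "?f \<in> H.cyclic l"
      by (rule f_mem[OF H.submodule_cyclic[OF lC]])
         (use H.cyclic_minimal[OF H.submodule_cyclic[OF chiC] l(1)] H.mem_cyclic[OF lC] l(2) in auto)
    then show "\<exists>s\<in>carrier R. s \<odot>\<^bsub>H\<^esub> l \<in> N \<and> s \<odot>\<^bsub>H\<^esub> l \<noteq> \<zero>\<^bsub>H\<^esub>"
      using fN f_ne by (auto simp: H.cyclic_def)
  qed
  have chain_sub: "submodule (\<Union>C) R H"
    if c1: "C \<noteq> {}" and c2: "\<And>A. A \<in> C \<Longrightarrow> submodule A R H" and c3: "\<And>A B. A \<in> C \<Longrightarrow> B \<in> C \<Longrightarrow> A \<subseteq> B \<or> B \<subseteq> A" for C
    unfolding H.submodule_iff
  proof (intro conjI ballI)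
    show "\<Union>C \<subseteq> carrier H" "\<zero>\<^bsub>H\<^esub> \<in> \<Union>C" using c1 c2 unfolding H.submodule_iff by blast+
    fix a b assume "a \<in> \<Union>C" "b \<in> \<Union>C"
    then obtain A where "A \<in> C" "a \<in> A" "b \<in> A" using c3 by blast
    then show "a \<oplus>\<^bsub>H\<^esub> b \<in> \<Union>C" using c2[of A] by (auto simp: H.submodule_iff)
  next
    fix s a assume "s \<in> carrier R" "a \<in> \<Union>C"
    then show "s \<odot>\<^bsub>H\<^esub> a \<in> \<Union>C" using c2 unfolding H.submodule_iff by blast
  qed
  have "\<exists>E\<in>Collect ess. \<forall>X\<in>Collect ess. E \<subseteq> X \<longrightarrow> X = E"
  proof (rule subset_Zorn_nonempty)
    fix C assume C: "C \<noteq> {}" "subset.chain (Collect ess) C"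
    have mem: "ess A" if "A \<in> C" for A using C that by (auto simp: subset.chain_def)
    have "submodule (\<Union>C) R H"
    proof (rule chain_sub[OF C(1)])
      show "submodule A R H" if "A \<in> C" for A using mem[OF that] by (simp add: ess_def)
      show "A \<subseteq> B \<or> B \<subseteq> A" if "A \<in> C" "B \<in> C" for A B using C(2) that unfolding subset.chain_def by blast
    qed
    then have "ess (\<Union>C)" using C(1) mem unfolding ess_def by blast
    then show "\<Union>C \<in> Collect ess" by simp
  qed (use ess0 in auto)
  then obtain E where E: "ess E" and maxE: "\<And>X. ess X \<Longrightarrow> E \<subseteq> X \<Longrightarrow> X = E" by auto
  have Es: "submodule E R H" and cE: "H.cyclic \<chi> \<subseteq> E" using E by (auto simp: ess_def)
  have E': "E \<subseteq> carrier H" "\<zero>\<^bsub>H\<^esub> \<in> E" "\<And>a b. a \<in> E \<Longrightarrow> b \<in> E \<Longrightarrow> a \<oplus>\<^bsub>H\<^esub> b \<in> E"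
      "\<And>s a. s \<in> carrier R \<Longrightarrow> a \<in> E \<Longrightarrow> s \<odot>\<^bsub>H\<^esub> a \<in> E"
    using Es by (auto simp: H.submodule_iff)
  \<comment> \<open>C is a complement of E, maximal with intersection 0. The projection of E + C
    onto E will be extended to an endomorphism g of \<open>H\<close>.\<close>
  have "\<exists>C\<in>{C. submodule C R H \<and> C \<inter> E = {\<zero>\<^bsub>H\<^esub>}}. \<forall>X\<in>{C. submodule C R H \<and> C \<inter> E = {\<zero>\<^bsub>H\<^esub>}}. C \<subseteq> X \<longrightarrow> X = C"
  proof (rule subset_Zorn_nonempty)
    show "{C. submodule C R H \<and> C \<inter> E = {\<zero>\<^bsub>H\<^esub>}} \<noteq> {}" using H.submodule_zero E'(2) by blast
    fix C assume C: "C \<noteq> {}" "subset.chain {C. submodule C R H \<and> C \<inter> E = {\<zero>\<^bsub>H\<^esub>}} C"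
    have "submodule (\<Union>C) R H" by (rule chain_sub[OF C(1)]) (use C(2) in \<open>unfold subset.chain_def, blast+\<close>)
    moreover have "\<Union>C \<inter> E = {\<zero>\<^bsub>H\<^esub>}" using C unfolding subset.chain_def by blast
    ultimately show "\<Union>C \<in> {C. submodule C R H \<and> C \<inter> E = {\<zero>\<^bsub>H\<^esub>}}" by simp
  qed
  then obtain C where C: "submodule C R H" "C \<inter> E = {\<zero>\<^bsub>H\<^esub>}"
    and maxC: "\<And>X. submodule X R H \<Longrightarrow> X \<inter> E = {\<zero>\<^bsub>H\<^esub>} \<Longrightarrow> C \<subseteq> X \<Longrightarrow> X = C" by auto
  have C': "C \<subseteq> carrier H" "\<zero>\<^bsub>H\<^esub> \<in> C" "\<And>a b. a \<in> C \<Longrightarrow> b \<in> C \<Longrightarrow> a \<oplus>\<^bsub>H\<^esub> b \<in> C"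
      "\<And>s a. s \<in> carrier R \<Longrightarrow> a \<in> C \<Longrightarrow> s \<odot>\<^bsub>H\<^esub> a \<in> C"
    using C(1) by (auto simp: H.submodule_iff)
  define P where "P = {e \<oplus>\<^bsub>H\<^esub> c | e c. e \<in> E \<and> c \<in> C}"
  have P: "submodule P R H" unfolding H.submodule_iff
  proof (intro conjI ballI)
    show "P \<subseteq> carrier H" using E' C' by (auto simp: P_def)
    have "\<zero>\<^bsub>H\<^esub> = \<zero>\<^bsub>H\<^esub> \<oplus>\<^bsub>H\<^esub> \<zero>\<^bsub>H\<^esub>" by simp
    then show "\<zero>\<^bsub>H\<^esub> \<in> P" using E' C' unfolding P_def by blast
    fix a b assume "a \<in> P" "b \<in> P"
    then obtain e c e' c' where h: "a = e \<oplus>\<^bsub>H\<^esub> c" "b = e' \<oplus>\<^bsub>H\<^esub> c'" "e \<in> E" "e' \<in> E" "c \<in> C" "c' \<in> C"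
      by (auto simp: P_def)
    have "a \<oplus>\<^bsub>H\<^esub> b = (e \<oplus>\<^bsub>H\<^esub> e') \<oplus>\<^bsub>H\<^esub> (c \<oplus>\<^bsub>H\<^esub> c')"
      using h E'(1) C'(1) by (simp add: subsetD H.M.a_ac)
    then show "a \<oplus>\<^bsub>H\<^esub> b \<in> P" using h E'(3) C'(3) unfolding P_def by blast
  next
    fix s a assume s: "s \<in> carrier R" and "a \<in> P"
    then obtain e c where h: "a = e \<oplus>\<^bsub>H\<^esub> c" "e \<in> E" "c \<in> C" by (auto simp: P_def)
    then have "s \<odot>\<^bsub>H\<^esub> a = s \<odot>\<^bsub>H\<^esub> e \<oplus>\<^bsub>H\<^esub> s \<odot>\<^bsub>H\<^esub> c" using s E'(1) C'(1) by (simp add: subsetD H.smult_r_distr)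
    then show "s \<odot>\<^bsub>H\<^esub> a \<in> P" using h s E'(4) C'(4) unfolding P_def by blast
  qed
  define \<phi> where "\<phi> p = (THE e. e \<in> E \<and> (\<exists>c\<in>C. p = e \<oplus>\<^bsub>H\<^esub> c))" for p
  have phi: "\<phi> (e \<oplus>\<^bsub>H\<^esub> c) = e" if ec: "e \<in> E" "c \<in> C" for e c
    unfolding \<phi>_def
  proof (rule the_equality)
    show "e \<in> E \<and> (\<exists>c'\<in>C. e \<oplus>\<^bsub>H\<^esub> c = e \<oplus>\<^bsub>H\<^esub> c')" using ec by auto
    fix e' assume "e' \<in> E \<and> (\<exists>c'\<in>C. e \<oplus>\<^bsub>H\<^esub> c = e' \<oplus>\<^bsub>H\<^esub> c')"
    then obtain c' where c': "e' \<in> E" "c' \<in> C" "e \<oplus>\<^bsub>H\<^esub> c = e' \<oplus>\<^bsub>H\<^esub> c'" by auto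
    have car: "e \<in> carrier H" "e' \<in> carrier H" "c \<in> carrier H" "c' \<in> carrier H" using ec c' E' C' by auto
    have "e' = (e' \<oplus>\<^bsub>H\<^esub> c') \<oplus>\<^bsub>H\<^esub> \<ominus>\<^bsub>H\<^esub> c'" using car by (simp add: H.M.a_assoc H.M.r_neg)
    also have "\<dots> = (c \<ominus>\<^bsub>H\<^esub> c') \<oplus>\<^bsub>H\<^esub> e" unfolding c'(3)[symmetric] using car by (simp add: a_minus_def H.M.a_ac)
    finally have "e' \<ominus>\<^bsub>H\<^esub> e = ((c \<ominus>\<^bsub>H\<^esub> c') \<oplus>\<^bsub>H\<^esub> e) \<ominus>\<^bsub>H\<^esub> e" by simp
    also have "\<dots> = c \<ominus>\<^bsub>H\<^esub> c'" using car by (simp add: a_minus_def H.M.a_assoc H.M.r_neg)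
    finally have "e' \<ominus>\<^bsub>H\<^esub> e \<in> C \<inter> E"
      using H.submodule_minus_closed[OF Es c'(1) ec(1)] H.submodule_minus_closed[OF C(1) ec(2) c'(2)] by auto
    then have "e' \<ominus>\<^bsub>H\<^esub> e = \<zero>\<^bsub>H\<^esub>" using C(2) by auto
    then show "e' = e" using car by (metis H.M.minus_equality H.M.minus_minus H.M.a_inv_closed a_minus_def)
  qed
  have phom: "\<phi> \<in> left_module_hom R (restrict_module H P) H"
    unfolding left_module_hom_def
  proof (intro CollectI conjI ballI)
    show "\<phi> \<in> carrier (restrict_module H P) \<rightarrow> carrier H" using phi E'(1) by (auto simp: P_def subsetD)
    fix a b assume "a \<in> carrier (restrict_module H P)" "b \<in> carrier (restrict_module H P)"
    then obtain e c e' c' where h: "a = e \<oplus>\<^bsub>H\<^esub> c" "b = e' \<oplus>\<^bsub>H\<^esub> c'" "e \<in> E" "e' \<in> E" "c \<in> C" "c' \<in> C"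
      by (auto simp: P_def)
    have "a \<oplus>\<^bsub>H\<^esub> b = (e \<oplus>\<^bsub>H\<^esub> e') \<oplus>\<^bsub>H\<^esub> (c \<oplus>\<^bsub>H\<^esub> c')"
      using h E'(1) C'(1) by (simp add: subsetD H.M.a_ac)
    then show "\<phi> (a \<oplus>\<^bsub>restrict_module H P\<^esub> b) = \<phi> a \<oplus>\<^bsub>H\<^esub> \<phi> b"
      using phi h E'(3) C'(3) by simp
  next
    fix s a assume s: "s \<in> carrier R" and "a \<in> carrier (restrict_module H P)"
    then obtain e c where h: "a = e \<oplus>\<^bsub>H\<^esub> c" "e \<in> E" "c \<in> C" by (auto simp: P_def)
    then have "s \<odot>\<^bsub>H\<^esub> a = s \<odot>\<^bsub>H\<^esub> e \<oplus>\<^bsub>H\<^esub> s \<odot>\<^bsub>H\<^esub> c" using s E'(1) C'(1) by (simp add: subsetD H.smult_r_distr)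
    then show "\<phi> (s \<odot>\<^bsub>restrict_module H P\<^esub> a) = s \<odot>\<^bsub>H\<^esub> \<phi> a"
      using phi h s E'(4) C'(4) by simp
  qed
  obtain g where g: "g \<in> left_module_hom R H H" and gP: "\<And>p. p \<in> P \<Longrightarrow> g p = \<phi> p"
    using char_module_injective[OF left_module_char P phom] by blast
  have gC: "g h \<in> carrier H" if "h \<in> carrier H" for h using g that by (auto simp: left_module_hom_def)
  have ga: "g (h \<oplus>\<^bsub>H\<^esub> h') = g h \<oplus>\<^bsub>H\<^esub> g h'" if "h \<in> carrier H" "h' \<in> carrier H" for h h'
    using g that by (auto simp: left_module_hom_def)
  have gs: "g (s \<odot>\<^bsub>H\<^esub> h) = s \<odot>\<^bsub>H\<^esub> g h" if "h \<in> carrier H" "s \<in> carrier R" for h s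
    using g that by (auto simp: left_module_hom_def)
  have gE: "g e = e" if "e \<in> E" for e
  proof -
    have eq: "e = e \<oplus>\<^bsub>H\<^esub> \<zero>\<^bsub>H\<^esub>" using that E' by (auto simp: subsetD)
    then have "e \<in> P" using that C'(2) unfolding P_def by blast
    then show ?thesis using phi[OF that C'(2)] gP[of e] eq by simp
  qed
  have gCz: "g c = \<zero>\<^bsub>H\<^esub>" if "c \<in> C" for c
  proof -
    have eq: "c = \<zero>\<^bsub>H\<^esub> \<oplus>\<^bsub>H\<^esub> c" using that C' by (auto simp: subsetD)
    then have "c \<in> P" using that E'(2) unfolding P_def by blast
    then show ?thesis using phi[OF E'(2) that] gP[of c] eq by simp
  qed
  \<comment> \<open>The image of g is again an essential extension. If g h is nonzero, then h is not
    in C, so C + R h meets E by maximality of C; applying g to e = c + s h gives e = s (g h).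
    Maximality of E yields equality.\<close>
  have gH: "g ` carrier H = E"
  proof (rule maxE)
    show sub: "E \<subseteq> g ` carrier H" using gE E'(1) by force
    show "ess (g ` carrier H)" unfolding ess_def
    proof (intro conjI ballI impI)
      show "submodule (g ` carrier H) R H" unfolding H.submodule_iff
      proof (intro conjI ballI)
        show "g ` carrier H \<subseteq> carrier H" using gC by auto
        show "\<zero>\<^bsub>H\<^esub> \<in> g ` carrier H" using sub E'(2) by auto
        fix a b assume "a \<in> g ` carrier H" "b \<in> g ` carrier H"
        then obtain h h' where "a = g h" "b = g h'" "h \<in> carrier H" "h' \<in> carrier H" by auto
        then show "a \<oplus>\<^bsub>H\<^esub> b \<in> g ` carrier H" using ga[of h h'] by (auto intro!: image_eqI[of _ _ "h \<oplus>\<^bsub>H\<^esub> h'"])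
      next
        fix s a assume "s \<in> carrier R" "a \<in> g ` carrier H"
        then obtain h where "s \<in> carrier R" "a = g h" "h \<in> carrier H" by auto
        then show "s \<odot>\<^bsub>H\<^esub> a \<in> g ` carrier H" using gs[of h s] by (auto intro!: image_eqI[of _ _ "s \<odot>\<^bsub>H\<^esub> h"])
      qed
      show "H.cyclic \<chi> \<subseteq> g ` carrier H" using sub cE by auto
      fix l assume "l \<in> g ` carrier H" and ne: "l \<noteq> \<zero>\<^bsub>H\<^esub>"
      then obtain h where h: "h \<in> carrier H" "l = g h" by auto
      have "H.plus_cyclic C h \<inter> E \<noteq> {\<zero>\<^bsub>H\<^esub>}"
        using maxC[of "H.plus_cyclic C h"] H.submodule_plus_cyclic[OF C(1) h(1)] gCz[of h] h ne by blast
      moreover have "\<zero>\<^bsub>H\<^esub> \<in> H.plus_cyclic C h \<inter> E"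
        using H.submodule_plus_cyclic(1)[OF C(1) h(1)] E'(2) by (auto simp: H.submodule_iff)
      ultimately obtain e where e: "e \<in> E" "e \<in> H.plus_cyclic C h" "e \<noteq> \<zero>\<^bsub>H\<^esub>" by blast
      then obtain c s where cs: "e = c \<oplus>\<^bsub>H\<^esub> s \<odot>\<^bsub>H\<^esub> h" "c \<in> C" "s \<in> carrier R" by (auto simp: H.plus_cyclic_def)
      have "e = g e" using gE e by simp
      also have "\<dots> = s \<odot>\<^bsub>H\<^esub> l" using cs h C'(1) ga gs gCz gC by (simp add: subsetD)
      finally have se: "s \<odot>\<^bsub>H\<^esub> l = e" by simp
      obtain t where t: "t \<in> carrier R" "t \<odot>\<^bsub>H\<^esub> e \<in> N" "t \<odot>\<^bsub>H\<^esub> e \<noteq> \<zero>\<^bsub>H\<^esub>"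
        using E e unfolding ess_def by blast
      have "(t \<otimes> s) \<odot>\<^bsub>H\<^esub> l = t \<odot>\<^bsub>H\<^esub> e" using t(1) cs(3) h gC se by (simp add: H.smult_assoc1)
      then show "\<exists>s\<in>carrier R. s \<odot>\<^bsub>H\<^esub> l \<in> N \<and> s \<odot>\<^bsub>H\<^esub> l \<noteq> \<zero>\<^bsub>H\<^esub>" using t cs(3) by (metis m_closed)
    qed
  qed
  let ?E = "restrict_module H E"
  interpret E: left_module R ?E by (rule H.left_module_restrict[OF Es])
  have "injective_module R ?E"
    unfolding injective_module_def
  proof (intro conjI allI impI)
    show "left_module R ?E" by (rule H.left_module_restrict[OF Es])
    fix Y :: "('a, 'a) module" and X u
    assume "left_module R Y \<and> submodule X R Y \<and> u \<in> left_module_hom R (restrict_module Y X) ?E"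
    then have Y: "left_module R Y" "submodule X R Y" and u: "u \<in> left_module_hom R (restrict_module Y X) ?E" by auto
    have "u \<in> left_module_hom R (restrict_module Y X) H" using u E'(1) by (auto simp: left_module_hom_def)
    then obtain w where w: "w \<in> left_module_hom R Y H" "\<And>m. m \<in> X \<Longrightarrow> w m = u m"
      using char_module_injective[OF Y] by blast
    show "\<exists>v\<in>left_module_hom R Y ?E. \<forall>m\<in>X. v m = u m"
    proof (intro bexI[of _ "g \<circ> w"] ballI)
      show "g \<circ> w \<in> left_module_hom R Y ?E"
        using w(1) gH ga gs by (auto simp: left_module_hom_def Pi_iff)
      fix m assume "m \<in> X"
      then have "u m \<in> E" using u by (auto simp: left_module_hom_def)
      then show "(g \<circ> w) m = u m" using w(2)[OF \<open>m \<in> X\<close>] gE by simp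
    qed
  qed
  moreover have "essential_submodule N R ?E"
    unfolding essential_submodule_def
  proof (intro conjI allI impI)
    show "submodule N R ?E" using N Ncyc cE H.submodule_restrict[OF Es] by auto
    fix L assume "submodule L R ?E \<and> L \<noteq> {\<zero>\<^bsub>?E\<^esub>}"
    then have L: "submodule L R H" "L \<subseteq> E" "L \<noteq> {\<zero>\<^bsub>H\<^esub>}" using H.submodule_restrict[OF Es] by auto
    then obtain l where "l \<in> L" "l \<noteq> \<zero>\<^bsub>H\<^esub>" unfolding H.submodule_iff by blast
    then have "\<exists>s\<in>carrier R. s \<odot>\<^bsub>H\<^esub> l \<in> N \<and> s \<odot>\<^bsub>H\<^esub> l \<noteq> \<zero>\<^bsub>H\<^esub>"
      using E L(2) by (auto simp: ess_def)
    moreover have "s \<odot>\<^bsub>H\<^esub> l \<in> L" if "s \<in> carrier R" for s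
      using L(1) \<open>l \<in> L\<close> that by (auto simp: H.submodule_iff)
    ultimately obtain s where "s \<odot>\<^bsub>H\<^esub> l \<in> L \<inter> N" "s \<odot>\<^bsub>H\<^esub> l \<noteq> \<zero>\<^bsub>H\<^esub>" by blast
    then show "L \<inter> N \<noteq> {\<zero>\<^bsub>?E\<^esub>}" by auto
  qed
  ultimately have "locally_artinian R ?E"
    using diamond simple unfolding diamond_property_def injective_hull_def by (metis restrict_restrict)
  moreover have chiE: "\<chi> \<in> E" using cE H.mem_cyclic[OF chiC] by auto
  then have "fg_submodule (E.cyclic \<chi>) R ?E"
    unfolding fg_submodule_def by (intro exI[of _ "{\<chi>}"]) (simp add: E.submodule_generated_singleton)
  ultimately have art: "artinian_module R (restrict_module H (H.cyclic \<chi>))"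
    unfolding locally_artinian_def by (auto simp: E.cyclic_def H.cyclic_def)
  show ?thesis
    unfolding dcc_above_def
  proof (intro allI impI)
    fix J :: "nat \<Rightarrow> 'a set"
    assume J: "\<forall>i. left_ideal (J i) R \<and> I \<subseteq> J i \<and> J (Suc i) \<subseteq> J i"
    \<comment> \<open>As the annihilator of \<chi> is I, the left ideals above I correspond to the
      submodules of R \<chi>.\<close>
    define L where "L i = {s \<odot>\<^bsub>H\<^esub> \<chi> | s. s \<in> J i}" for i
    have JC: "J i \<subseteq> carrier R" for i using J by (auto simp: left_ideal_def)
    have "submodule (L i) R (restrict_module H (H.cyclic \<chi>))" for i
      unfolding H.submodule_restrict[OF H.submodule_cyclic[OF chiC]]
      using H.ideal_smult_submodule[OF _ chiC, of "J i"] J JC[of i] by (auto simp: L_def H.cyclic_def)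
    moreover have "L (Suc i) \<subseteq> L i" for i using J by (auto simp: L_def)
    ultimately obtain n where n: "\<And>i. i \<ge> n \<Longrightarrow> L i = L n" using art unfolding artinian_module_def by blast
    have J_L: "J i = {s \<in> carrier R. s \<odot>\<^bsub>H\<^esub> \<chi> \<in> L i}" for i
    proof
      show "{s \<in> carrier R. s \<odot>\<^bsub>H\<^esub> \<chi> \<in> L i} \<subseteq> J i"
      proof clarify
        fix s assume s: "s \<in> carrier R" "s \<odot>\<^bsub>H\<^esub> \<chi> \<in> L i"
        then obtain j where j: "j \<in> J i" "s \<odot>\<^bsub>H\<^esub> \<chi> = j \<odot>\<^bsub>H\<^esub> \<chi>" by (auto simp: L_def)
        have jC: "j \<in> carrier R" using j JC by auto
        have "s \<oplus> \<ominus> j \<in> H.annihilator \<chi>"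
          using j(2) s jC chiC by (simp add: H.annihilator_def H.smult_l_distr H.smult_minus_left H.M.r_neg)
        then have "s \<oplus> \<ominus> j \<in> J i" using annI J by auto
        then have "(s \<oplus> \<ominus> j) \<oplus> j \<in> J i" using j J by (auto simp: left_ideal_def)
        then show "s \<in> J i" using s jC by (simp add: a_assoc l_neg)
      qed
    qed (use JC in \<open>auto simp: L_def\<close>)
    show "\<exists>n. \<forall>i\<ge>n. J i = J n" by (intro exI[of _ n] allI impI) (metis J_L n)
  qed
qed

end

hide_const (open) Module.smult

section \<open>Degrees and left ideals in Ore extensions\<close>

locale ore =
  fixes \<sigma> d :: "'k::field_char_0 poly \<Rightarrow> 'k poly" and q b :: 'k
  assumes aut: "ring_automorphism \<sigma>" and slin: "K_linear \<sigma>"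
    and der: "sigma_derivation \<sigma> d" and dlin: "K_linear d"
    and sx: "\<sigma> [:0, 1:] = [:b, q:]"
begin

abbreviation "S \<equiv> ore_extension \<sigma> d"
abbreviation "T \<equiv> theta_mult \<sigma> d"
abbreviation mul (infixl "\<star>" 70) where "mul \<equiv> ore_mult \<sigma> d"

lemma s_add: "\<sigma> (a + c) = \<sigma> a + \<sigma> c" and s_mult: "\<sigma> (a * c) = \<sigma> a * \<sigma> c"
  and s_one [simp]: "\<sigma> 1 = 1" and s_inj: "\<sigma> a = \<sigma> c \<longleftrightarrow> a = c"
  using aut by (auto simp: ring_automorphism_def bij_def inj_def)

lemma d_add: "d (a + c) = d a + d c" and d_mult: "d (a * c) = \<sigma> a * d c + d a * c"
  using der by (auto simp: sigma_derivation_def)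

lemma s_smult: "\<sigma> (smult k a) = smult k (\<sigma> a)"
  using module_hom.scale[OF slin[unfolded linear_iff_module_hom]] .

lemma d_smult: "d (smult k a) = smult k (d a)"
  using module_hom.scale[OF dlin[unfolded linear_iff_module_hom]] .

lemma s_zero [simp]: "\<sigma> 0 = 0" using s_smult[of 0 0] by simp
lemma d_zero [simp]: "d 0 = 0" using d_smult[of 0 0] by simp
lemma d_one [simp]: "d 1 = 0" using d_mult[of 1 1] by (metis s_one mult_1 mult_1_right add_cancel_right_right)
lemma s_eq_zero [simp]: "\<sigma> a = 0 \<longleftrightarrow> a = 0" using s_inj[of a 0] by simp
lemma s_minus: "\<sigma> (a - c) = \<sigma> a - \<sigma> c" using s_add[of "a - c" c] by simp
lemma s_const [simp]: "\<sigma> [:k:] = [:k:]" using s_smult[of k 1] by simp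
lemma d_const [simp]: "d [:k:] = 0" using d_smult[of k 1] by simp

lemma s_pcompose: "\<sigma> p = pcompose p [:b, q:]"
proof (induction p)
  case (pCons k p)
  have "\<sigma> (pCons k p) = \<sigma> ([:k:] + [:0, 1:] * p)" by simp
  also have "\<dots> = [:k:] + [:b, q:] * \<sigma> p" by (simp only: s_add s_mult s_const sx)
  finally show ?case using pCons by (simp add: pcompose_pCons)
qed simp

lemma q_nonzero [simp]: "q \<noteq> 0"
proof
  assume "q = 0"
  then have "\<sigma> [:0, 1:] = \<sigma> [:b:]" using sx by simp
  then show False by (simp only: s_inj) simp
qed

lemma degree_s [simp]: "degree (\<sigma> p) = degree p"
  by (simp add: s_pcompose degree_pcompose)

lemma lead_coeff_s: "lead_coeff (\<sigma> p) = lead_coeff p * q ^ degree p"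
proof -
  have "lead_coeff (pcompose p [:b, q:]) = lead_coeff p * lead_coeff [:b, q:] ^ degree p"
    by (rule lead_coeff_comp) simp
  then show ?thesis by (simp add: s_pcompose)
qed

lemma spow_add: "(\<sigma> ^^ n) (a + c) = (\<sigma> ^^ n) a + (\<sigma> ^^ n) c"
  and spow_mult: "(\<sigma> ^^ n) (a * c) = (\<sigma> ^^ n) a * (\<sigma> ^^ n) c"
  and spow_const [simp]: "(\<sigma> ^^ n) [:k:] = [:k:]"
  and spow_eq_zero [simp]: "(\<sigma> ^^ n) a = 0 \<longleftrightarrow> a = 0"
  and degree_spow [simp]: "degree ((\<sigma> ^^ n) a) = degree a"
  by (induction n) (simp_all add: s_add s_mult)

lemma ring_S: "ring S" by (rule ring_ore_extension[OF aut der])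

lemma S_simps [simp]: "carrier S = UNIV" "a \<oplus>\<^bsub>S\<^esub> c = a + c" "a \<otimes>\<^bsub>S\<^esub> c = a \<star> c" "\<zero>\<^bsub>S\<^esub> = 0" "\<one>\<^bsub>S\<^esub> = 1"
  by (simp_all add: ore_extension_def)

text \<open>Reading \<open>mul\<close> as the product of a \<open>ring_1\<close> structure makes the
  type-class facts on distributivity, differences and powers available under the prefix
  \<open>R\<close>.\<close>

sublocale R: ring_1 1 mul "(+)" "0 :: 'k poly poly" "(-)" uminus
proof -
  interpret ring S by (rule ring_S)
  show "class.ring_1 1 mul (+) (0 :: 'k poly poly) (-) uminus"
    by unfold_locales (use m_assoc l_distr r_distr l_one r_one in \<open>simp_all\<close>)
qed

abbreviation rpow (infixr "\<up>" 80) where "rpow \<equiv> power.power 1 mul"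

lemma const_mul [simp]: "[:r:] \<star> p = smult r p"
  using ore_extension_const_mult[OF aut der, of r p] by simp

lemma smult_mul [simp]: "smult r p \<star> c = smult r (p \<star> c)"
  unfolding const_mul[symmetric] by (simp add: R.mult.assoc del: const_mul)

lemma theta_mul [simp]: "[:0, 1:] \<star> p = T p"
proof -
  have "[:0, 1:] \<star> p = (\<Sum>n\<le>1. smult (coeff [:0, 1:] n) ((T ^^ n) p))"
    by (simp add: ore_mult_def)
  then show ?thesis by simp
qed

lemma T_mul: "T p \<star> c = T (p \<star> c)"
  unfolding theta_mul[symmetric] by (simp add: R.mult.assoc del: theta_mul)

lemma coeff_T: "coeff (T p) n = (case n of 0 \<Rightarrow> 0 | Suc m \<Rightarrow> \<sigma> (coeff p m)) + d (coeff p n)"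
  by (cases n) (simp_all add: theta_mult_def coeff_map_poly)

lemma T_add: "T (a + c) = T a + T c"
  unfolding theta_mul[symmetric] by (rule R.distrib_left)

lemma T_smult: "T (smult a p) = smult (\<sigma> a) (T p) + smult (d a) p"
  by (rule poly_eqI) (simp add: coeff_T s_mult d_mult algebra_simps split: nat.split)

lemma T_zero [simp]: "T 0 = 0" using T_smult[of 0 0] by simp

lemma degree_T: "a \<noteq> 0 \<Longrightarrow> degree (T a) = Suc (degree a)"
  and lead_coeff_T: "a \<noteq> 0 \<Longrightarrow> lead_coeff (T a) = \<sigma> (lead_coeff a)"
proof -
  assume a: "a \<noteq> 0"
  have c: "coeff (T a) (Suc (degree a)) = \<sigma> (lead_coeff a)"
    by (simp add: coeff_T coeff_eq_0)
  have "degree (T a) \<le> Suc (degree a)"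
    by (rule degree_le) (auto simp: coeff_T coeff_eq_0 split: nat.split)
  moreover have "Suc (degree a) \<le> degree (T a)" by (rule le_degree) (use c a in simp)
  ultimately show "degree (T a) = Suc (degree a)" by simp
  then show "lead_coeff (T a) = \<sigma> (lead_coeff a)" using c by simp
qed

lemma T_eq_zero [simp]: "T a = 0 \<longleftrightarrow> a = 0"
  using degree_T[of a] by force

lemma Tpow: assumes "a \<noteq> 0"
  shows "(T ^^ n) a \<noteq> 0" and "degree ((T ^^ n) a) = n + degree a"
    and "lead_coeff ((T ^^ n) a) = (\<sigma> ^^ n) (lead_coeff a)"
proof -
  have "(T ^^ n) a \<noteq> 0 \<and> degree ((T ^^ n) a) = n + degree a \<and>
    lead_coeff ((T ^^ n) a) = (\<sigma> ^^ n) (lead_coeff a)"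
  proof (induction n)
    case (Suc n)
    then have IH: "(T ^^ n) a \<noteq> 0" "degree ((T ^^ n) a) = n + degree a"
      "lead_coeff ((T ^^ n) a) = (\<sigma> ^^ n) (lead_coeff a)" by blast+
    have "lead_coeff (T ((T ^^ n) a)) = \<sigma> ((\<sigma> ^^ n) (lead_coeff a))"
      unfolding lead_coeff_T[OF IH(1)] IH(3) ..
    then show ?case using degree_T[OF IH(1)] IH(1,2) by (metis T_eq_zero add_Suc funpow.simps(2) o_apply)
  qed (use assms in simp)
  then show "(T ^^ n) a \<noteq> 0" "degree ((T ^^ n) a) = n + degree a"
    "lead_coeff ((T ^^ n) a) = (\<sigma> ^^ n) (lead_coeff a)" by auto
qed

lemma mul_eq_sum: "a \<star> c = (\<Sum>n\<le>degree a. smult (coeff a n) ((T ^^ n) c))"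
  by (simp add: ore_mult_def)

text \<open>Only the top term of a contributes in top degree, and moving \<theta>^n past the leading
  coefficient of c twists it by \<sigma>^n. As \<sigma> is injective, S is a domain.\<close>

lemma degree_mul_lead:
  assumes "a \<noteq> 0" "c \<noteq> 0"
  shows "coeff (a \<star> c) (degree a + degree c) = lead_coeff a * (\<sigma> ^^ degree a) (lead_coeff c)"
    and "degree (a \<star> c) = degree a + degree c"
proof -
  have "coeff (a \<star> c) (degree a + degree c) = (\<Sum>n\<le>degree a. coeff a n * coeff ((T ^^ n) c) (degree a + degree c))"
    by (simp add: mul_eq_sum coeff_sum)
  also have "\<dots> = (\<Sum>n\<in>{degree a}. coeff a n * coeff ((T ^^ n) c) (degree a + degree c))"
    by (rule sum.mono_neutral_right) (use Tpow[OF assms(2)] in \<open>auto intro!: coeff_eq_0\<close>)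
  also have "\<dots> = lead_coeff a * (\<sigma> ^^ degree a) (lead_coeff c)"
    using Tpow(2,3)[OF assms(2), of "degree a"] by simp
  finally show c: "coeff (a \<star> c) (degree a + degree c) = lead_coeff a * (\<sigma> ^^ degree a) (lead_coeff c)" .
  have "degree (a \<star> c) \<le> degree a + degree c"
  proof (rule degree_le, intro allI impI)
    fix i assume "i > degree a + degree c"
    then show "coeff (a \<star> c) i = 0"
      using Tpow(2)[OF assms(2)] by (auto simp: mul_eq_sum coeff_sum intro!: sum.neutral coeff_eq_0)
  qed
  moreover have "degree a + degree c \<le> degree (a \<star> c)"
    by (rule le_degree) (use c assms in simp)
  ultimately show "degree (a \<star> c) = degree a + degree c" by simp
qed

lemma lead_coeff_mul: "a \<noteq> 0 \<Longrightarrow> c \<noteq> 0 \<Longrightarrow> lead_coeff (a \<star> c) = lead_coeff a * (\<sigma> ^^ degree a) (lead_coeff c)"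
  using degree_mul_lead by simp

lemma mul_eq_zero [simp]: "a \<star> c = 0 \<longleftrightarrow> a = 0 \<or> c = 0"
proof
  assume z: "a \<star> c = 0"
  show "a = 0 \<or> c = 0"
  proof (rule ccontr)
    assume "\<not> (a = 0 \<or> c = 0)"
    then show False using degree_mul_lead(1)[of a c] z by simp
  qed
qed auto

lemma mul_cancel_right: "a \<star> c = e \<star> c \<Longrightarrow> c \<noteq> 0 \<Longrightarrow> a = e"
  by (metis R.left_diff_distrib eq_iff_diff_eq_0 mul_eq_zero)

lemma monom_mul: "monom r n \<star> p = smult r ((T ^^ n) p)"
proof -
  have "monom r n \<star> p = (\<Sum>m\<le>degree (monom r n). smult (coeff (monom r n) m) ((T ^^ m) p))"
    by (rule mul_eq_sum)
  also have "\<dots> = (\<Sum>m\<in>{n}. smult (coeff (monom r n) m) ((T ^^ m) p))"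
    by (rule sum.mono_neutral_cong) (auto, metis degree_monom_eq order_refl)
  finally show ?thesis by simp
qed

lemma left_ideal_iff:
  "left_ideal J S \<longleftrightarrow> 0 \<in> J \<and> (\<forall>a\<in>J. \<forall>c\<in>J. a + c \<in> J) \<and> (\<forall>s. \<forall>a\<in>J. s \<star> a \<in> J)"
  by (simp add: left_ideal_def)

lemma left_idealI:
  assumes "0 \<in> J" "\<And>a c. a \<in> J \<Longrightarrow> c \<in> J \<Longrightarrow> a + c \<in> J"
    and "\<And>r a. a \<in> J \<Longrightarrow> smult r a \<in> J" "\<And>a. a \<in> J \<Longrightarrow> T a \<in> J"
  shows "left_ideal J S"
proof -
  have T: "(T ^^ n) a \<in> J" if "a \<in> J" for n a using that assms(4) by (induction n) auto
  have "s \<star> a \<in> J" if "a \<in> J" for s a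
  proof -
    have "(\<Sum>n\<in>A. smult (coeff s n) ((T ^^ n) a)) \<in> J" if "finite A" for A :: "nat set"
      using that by (induction A rule: finite_induct) (use assms T[OF \<open>a \<in> J\<close>] in auto)
    then show ?thesis by (simp add: mul_eq_sum)
  qed
  then show ?thesis using assms by (auto simp: left_ideal_iff)
qed

lemma left_idealD:
  assumes "left_ideal J S"
  shows "0 \<in> J" "a \<in> J \<Longrightarrow> c \<in> J \<Longrightarrow> a + c \<in> J" "a \<in> J \<Longrightarrow> s \<star> a \<in> J"
    "a \<in> J \<Longrightarrow> smult r a \<in> J" "a \<in> J \<Longrightarrow> T a \<in> J" "a \<in> J \<Longrightarrow> - a \<in> J" "a \<in> J \<Longrightarrow> c \<in> J \<Longrightarrow> a - c \<in> J"
proof -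
  show z: "0 \<in> J" and p: "\<And>a c. a \<in> J \<Longrightarrow> c \<in> J \<Longrightarrow> a + c \<in> J" and m: "\<And>a s. a \<in> J \<Longrightarrow> s \<star> a \<in> J"
    using assms by (auto simp: left_ideal_iff)
  show sm: "smult r a \<in> J" if "a \<in> J" for r a using m[OF that, of "[:r:]"] by simp
  show "a \<in> J \<Longrightarrow> T a \<in> J" using m[of a "[:0, 1:]"] by simp
  show neg: "- a \<in> J" if "a \<in> J" for a using sm[OF that, of "-1"] by simp
  show "a - c \<in> J" if "a \<in> J" "c \<in> J" for a c using p[OF that(1) neg[OF that(2)]] by simp
qed

lemma left_ideal_eqD:
  assumes "left_ideal J S" "a - c \<in> J" shows "a \<in> J \<longleftrightarrow> c \<in> J"
  using left_idealD(2)[OF assms(1,2), of c] left_idealD(7)[OF assms(1) _ assms(2), of a] by auto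

definition principal :: "'k poly poly \<Rightarrow> 'k poly poly set" where "principal g = range (\<lambda>s. s \<star> g)"

lemma left_ideal_principal: "left_ideal (principal g) S"
  unfolding left_ideal_iff principal_def
  by (auto simp: R.distrib_right[symmetric] R.mult.assoc[symmetric] image_iff intro: exI[of _ 0])

lemma mem_principal: "s \<star> g \<in> principal g" by (auto simp: principal_def)

lemma mem_principal_self: "g \<in> principal g" using mem_principal[of 1 g] by simp

lemma one_mem_left_ideal: "left_ideal J S \<Longrightarrow> 1 \<in> J \<Longrightarrow> J = UNIV"
  using left_idealD(3)[of J 1] by fastforce

text \<open>The exponents \<open>(i, n)\<close> of the leading monomials \<open>x\<^sup>i \<theta>\<^sup>n\<close>, ordered by the power of \<open>\<theta>\<close> first.\<close>

definition key :: "'k poly poly \<Rightarrow> nat \<times> nat" where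
  "key a = (degree (lead_coeff a), degree a)"

definition keys :: "'k poly poly set \<Rightarrow> (nat \<times> nat) set" where
  "keys J = {key a | a. a \<in> J \<and> a \<noteq> 0}"

abbreviation key_less :: "('k poly poly \<times> 'k poly poly) set" where
  "key_less \<equiv> inv_image (less_than <*lex*> less_than) (\<lambda>a. (degree a, degree (lead_coeff a)))"

lemma wf_key_less: "wf key_less"
  by (intro wf_inv_image wf_lex_prod wf_less_than)

text \<open>The leading monomials agree up to a scalar of the field K, so a scalar multiple of c
  cancels that of a. This is the division step behind all arguments with
  \<open>keys\<close>.\<close>

lemma reduce_key:
  assumes "a \<noteq> 0" "c \<noteq> 0" "key a = key c"
  obtains k where "k \<noteq> 0" "a - smult [:k:] c = 0 \<or> (a - smult [:k:] c, a) \<in> key_less"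
proof -
  define k where "k = lead_coeff (lead_coeff a) / lead_coeff (lead_coeff c)"
  have k: "k \<noteq> 0" using assms by (simp add: k_def)
  let ?e = "a - smult [:k:] c"
  have deg: "degree c = degree a" "degree (lead_coeff c) = degree (lead_coeff a)"
    using assms(3) by (auto simp: key_def)
  have le: "degree ?e \<le> degree a" by (rule degree_diff_le) (use deg in auto)
  have "?e = 0 \<or> (?e, a) \<in> key_less"
  proof (cases "?e = 0 \<or> degree ?e < degree a")
    case False
    then have eq: "degree ?e = degree a" and ne: "?e \<noteq> 0" using le by auto
    have l: "lead_coeff ?e = lead_coeff a - smult k (lead_coeff c)" using eq deg by simp
    have nz: "lead_coeff ?e \<noteq> 0" using ne leading_coeff_neq_0 by blast
    have "degree (lead_coeff ?e) \<le> degree (lead_coeff a)"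
      unfolding l by (rule degree_diff_le) (use deg in auto)
    moreover have "degree (lead_coeff ?e) \<noteq> degree (lead_coeff a)"
    proof
      assume "degree (lead_coeff ?e) = degree (lead_coeff a)"
      then have "lead_coeff (lead_coeff ?e) = lead_coeff (lead_coeff a) - k * lead_coeff (lead_coeff c)"
        using l deg by simp
      also have "\<dots> = 0" using assms by (simp add: k_def)
      finally show False using nz leading_coeff_neq_0 by blast
    qed
    ultimately show ?thesis using eq by auto
  qed auto
  then show ?thesis using that k by blast
qed

text \<open>Multiplication by x^(i'-i) \<theta>^(n'-n) realises the larger exponent, because
  \<sigma> preserves degrees.\<close>

lemma keys_up:
  assumes "left_ideal J S" "(i, n) \<in> keys J" "i \<le> i'" "n \<le> n'" shows "(i', n') \<in> keys J"
proof -
  obtain a where a: "a \<in> J" "a \<noteq> 0" "degree (lead_coeff a) = i" "degree a = n"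
    using assms(2) by (auto simp: keys_def key_def)
  let ?e = "smult (monom 1 (i' - i)) ((T ^^ (n' - n)) a)"
  have nz: "?e \<noteq> 0" using Tpow(1)[OF a(2), of "n' - n"] by simp
  have "degree ?e = n'" using Tpow(2)[OF a(2), of "n' - n"] a assms by (simp add: monom_eq_0_iff)
  moreover have "lead_coeff ?e = monom 1 (i' - i) * (\<sigma> ^^ (n' - n)) (lead_coeff a)"
    using Tpow(3)[OF a(2), of "n' - n"] by (simp add: lead_coeff_smult)
  then have "degree (lead_coeff ?e) = i'"
    using a assms by (subst \<open>lead_coeff ?e = _\<close>, subst degree_mult_eq) (auto simp: degree_monom_eq monom_eq_0_iff)
  moreover have "?e \<in> J" using assms(1) a(1) monom_mul[of "monom 1 (i' - i)" "n' - n" a] left_idealD(3) by metis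
  ultimately show ?thesis using nz by (auto simp: keys_def key_def intro!: exI[of _ ?e])
qed

lemma keys_mono: "J \<subseteq> J' \<Longrightarrow> keys J \<subseteq> keys J'" by (auto simp: keys_def)

text \<open>Well-founded division: subtracting from a an element of J' with the same key stays
  inside J and lowers the key.\<close>

lemma keys_eq_imp_eq:
  assumes J: "left_ideal J S" and J': "left_ideal J' S" and sub: "J' \<subseteq> J" "keys J \<subseteq> keys J'"
  shows "J = J'"
proof -
  have "a \<in> J \<longrightarrow> a \<in> J'" for a
  proof (induction a rule: wf_induct_rule[OF wf_key_less])
    case (1 a)
    show ?case
    proof (intro impI, cases "a = 0")
      case False
      assume a: "a \<in> J"
      then have "key a \<in> keys J'" using sub(2) False by (auto simp: keys_def)
      then obtain c where c: "c \<in> J'" "c \<noteq> 0" "key a = key c" by (auto simp: keys_def)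
      obtain k where k: "a - smult [:k:] c = 0 \<or> (a - smult [:k:] c, a) \<in> key_less"
        using reduce_key[OF False c(2,3)] by blast
      have c': "smult [:k:] c \<in> J'" using left_idealD(4)[OF J' c(1)] .
      then have "a - smult [:k:] c \<in> J" using a sub(1) left_idealD(7)[OF J] by blast
      then have "a - smult [:k:] c \<in> J'" using k 1 left_idealD(1)[OF J'] by auto
      then show "a \<in> J'" using left_ideal_eqD[OF J'] c' by blast
    qed (use left_idealD(1)[OF J'] in simp)
  qed
  then show ?thesis using sub(1) by auto
qed

end

section \<open>Combinatorics of exponents and the ascending chain condition\<close>

lemma bounded_mono_stabilizes:
  fixes f :: "nat \<Rightarrow> nat"
  assumes "\<And>i. f i \<le> f (Suc i)" "\<And>i. f i \<le> B"
  obtains n where "\<And>i. i \<ge> n \<Longrightarrow> f i = f n"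
proof -
  obtain n where n: "\<And>i. B - f n \<le> B - f i"
    using ex_has_least_nat[of "\<lambda>_. True" 0 "\<lambda>i. B - f i"] by auto
  have "f i = f n" if "i \<ge> n" for i
    using lift_Suc_mono_le[of f, OF assms(1) that] n[of i] assms(2)[of i] by linarith
  then show ?thesis using that by blast
qed

lemma antimono_stabilizes:
  fixes f :: "nat \<Rightarrow> nat"
  assumes "\<And>i. f (Suc i) \<le> f i"
  obtains n where "\<And>i. i \<ge> n \<Longrightarrow> f i = f n"
proof -
  obtain n where n: "\<And>i. f n \<le> f i" using ex_has_least_nat[of "\<lambda>_. True" 0 f] by auto
  have "f i = f n" if "i \<ge> n" for i
    using lift_Suc_antimono_le[of f, OF assms that] n[of i] by linarith
  then show ?thesis using that by blast
qed

text \<open>Dickson's lemma in dimension two: pass to a subsequence that is monotone in the first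
  coordinate, then to one that is monotone in the second.\<close>

lemma pair_sequence_le:
  fixes p :: "nat \<Rightarrow> nat \<times> nat"
  obtains i j where "i < j" "fst (p i) \<le> fst (p j)" "snd (p i) \<le> snd (p j)"
proof -
  have mono: "\<exists>r::nat \<Rightarrow> nat. strict_mono r \<and> (\<forall>i j. i \<le> j \<longrightarrow> f (r i) \<le> f (r j))" for f :: "nat \<Rightarrow> nat"
  proof -
    obtain r :: "nat \<Rightarrow> nat" where r: "strict_mono r" "monoseq (\<lambda>n. f (r n))" using seq_monosub by blast
    show ?thesis
    proof (cases "\<forall>m. \<forall>n\<ge>m. f (r m) \<le> f (r n)")
      case False
      then have dec: "f (r (Suc i)) \<le> f (r i)" for i using r(2) unfolding monoseq_def by auto
      obtain n where n: "\<And>i. i \<ge> n \<Longrightarrow> f (r i) = f (r n)"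
        using antimono_stabilizes[of "\<lambda>i. f (r i)", OF dec] by blast
      have "f (r (i + n)) = f (r n)" for i by (rule n) simp
      moreover have "strict_mono (\<lambda>i. r (i + n))" using r(1) by (simp add: strict_mono_def)
      ultimately show ?thesis by (intro exI[of _ "\<lambda>i. r (i + n)"]) simp
    qed (use r in blast)
  qed
  obtain r :: "nat \<Rightarrow> nat" where r: "strict_mono r" "\<And>i j. i \<le> j \<Longrightarrow> fst (p (r i)) \<le> fst (p (r j))"
    using mono[of "fst \<circ> p"] by auto
  obtain t :: "nat \<Rightarrow> nat" where t: "strict_mono t" "\<And>i j. i \<le> j \<Longrightarrow> snd (p (r (t i))) \<le> snd (p (r (t j)))"
    using mono[of "snd \<circ> p \<circ> r"] by auto
  have "t 0 < t 1" using t(1) by (simp add: strict_mono_def)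
  then show ?thesis using that[of "r (t 0)" "r (t 1)"] r t(2)[of 0 1] by (auto simp: strict_mono_def)
qed

context ore
begin

text \<open>In a strictly ascending chain each step brings a new key. By Dickson's lemma a later one
  lies above an earlier one, and then \<open>keys_up\<close> shows that it was not new.\<close>

lemma acc_left_ideals:
  assumes "\<And>i. left_ideal (J i) S" "\<And>i. J i \<subseteq> J (Suc i)"
  shows "\<exists>n. J (Suc n) = J n"
proof (rule ccontr)
  assume "\<not> ?thesis"
  then have "\<exists>p. p \<in> keys (J (Suc n)) - keys (J n)" for n
    using keys_eq_imp_eq[OF assms(1,1), of n "Suc n"] assms(2)[of n] by blast
  then obtain p where p: "\<And>n. p n \<in> keys (J (Suc n)) - keys (J n)" by metis
  obtain i j where ij: "i < j" "fst (p i) \<le> fst (p j)" "snd (p i) \<le> snd (p j)"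
    using pair_sequence_le by blast
  have "J (Suc i) \<subseteq> J j" using lift_Suc_mono_le[of J, OF assms(2)] ij(1) by (simp add: Suc_leI)
  then have "p i \<in> keys (J j)" using p[of i] keys_mono by blast
  then have "p j \<in> keys (J j)" using keys_up[OF assms(1), of "fst (p i)" "snd (p i)" j "fst (p j)" "snd (p j)"] ij by simp
  then show False using p[of j] by simp
qed

text \<open>The complement of \<open>keys I\<close> counts the K-dimension of S / I. Along a
  descending chain the complements grow inside a finite set.\<close>

lemma dcc_above_cofinite:
  assumes "finite (- keys I)" shows "dcc_above S I"
  unfolding dcc_above_def
proof (intro allI impI)
  fix J :: "nat \<Rightarrow> 'k poly poly set"
  assume J: "\<forall>i. left_ideal (J i) S \<and> I \<subseteq> J i \<and> J (Suc i) \<subseteq> J i"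
  have fin: "finite (- keys (J i))" for i
    by (rule finite_subset[OF _ assms]) (use keys_mono[of I "J i"] J in auto)
  have "card (- keys (J i)) \<le> card (- keys (J (Suc i)))" for i
    by (rule card_mono[OF fin]) (use keys_mono[of "J (Suc i)" "J i"] J in auto)
  moreover have "card (- keys (J i)) \<le> card (- keys I)" for i
    by (rule card_mono[OF assms]) (use keys_mono[of I "J i"] J in auto)
  ultimately obtain n where n: "\<And>i. i \<ge> n \<Longrightarrow> card (- keys (J i)) = card (- keys (J n))"
    using bounded_mono_stabilizes[of "\<lambda>i. card (- keys (J i))"] by blast
  show "\<exists>n. \<forall>i\<ge>n. J i = J n"
  proof (intro exI[of _ n] allI impI)
    fix i assume i: "n \<le> i"
    have sub: "J i \<subseteq> J n" using lift_Suc_antimono_le[of J] J i by blast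
    have "- keys (J n) = - keys (J i)"
      by (rule card_subset_eq[OF fin]) (use n[OF i] keys_mono[OF sub] in auto)
    then show "J i = J n" using keys_eq_imp_eq[of "J n" "J i"] J sub by auto
  qed
qed

end

section \<open>Descending chains above monolithic left ideals\<close>

context ore
begin

text \<open>The elements satisfying P form a left ideal that contains 1; the case of 0 is the
  multiple of 1 by 0.\<close>

lemma ore_induct [case_names one add smult T]:
  assumes "P 1" "\<And>s t. P s \<Longrightarrow> P t \<Longrightarrow> P (s + t)" "\<And>r s. P s \<Longrightarrow> P (smult r s)" "\<And>s. P s \<Longrightarrow> P (T s)"
  shows "P s"
proof -
  have "left_ideal {s. P s} S"
    by (rule left_idealI) (use assms assms(3)[OF assms(1), of 0] in auto)
  then show ?thesis using one_mem_left_ideal[of "{s. P s}"] assms(1) by auto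
qed

lemma principal_x_proper: "1 \<notin> principal [:[:0, 1:]:]"
proof
  assume "1 \<in> principal [:[:0, 1:]:]"
  then obtain s where s: "1 = s \<star> [:[:0, 1:]:]" by (auto simp: principal_def)
  then have nz: "s \<noteq> 0" by auto
  have "degree s = 0" using degree_mul_lead(2)[OF nz, of "[:[:0, 1:]:]"] s by simp
  then obtain r where "s = [:r:]" by (metis degree_eq_zeroE)
  then have "(1::'k poly poly) = [:r * [:0, 1:]:]" using s by simp
  then have "r * [:0, 1:] = 1" by (metis one_pCons pCons_eq_iff)
  then have "[:0, 1:] dvd (1 :: 'k poly)" by (metis dvd_triv_right)
  then show False by (simp add: is_unit_iff_degree)
qed

text \<open>If I were 0, the element f would lie in S x f, and cancelling f would make x left
  invertible.\<close>

lemma monolithic_nonzero: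
  assumes "monolithic S I" obtains P where "P \<in> I" "P \<noteq> 0"
proof -
  obtain f where I: "left_ideal I S" "f \<notin> I" "\<And>J. left_ideal J S \<Longrightarrow> I \<subset> J \<Longrightarrow> f \<in> J"
    using assms unfolding monolithic_def by blast
  have "I \<noteq> {0}"
  proof
    assume z: "I = {0}"
    have f: "f \<noteq> 0" using I(2) z by auto
    let ?g = "[:[:0, 1:]:] \<star> f"
    have "?g \<noteq> 0" using f by (simp del: const_mul)
    then have "I \<subset> principal ?g" using z mem_principal_self[of ?g] left_idealD(1)[OF left_ideal_principal] by blast
    then have "f \<in> principal ?g" using I(3) left_ideal_principal by blast
    then obtain s where "f = s \<star> ?g" by (auto simp: principal_def)
    then have "1 \<star> f = (s \<star> [:[:0, 1:]:]) \<star> f" by (simp add: R.mult.assoc del: const_mul)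
    then have "1 = s \<star> [:[:0, 1:]:]" using f mul_cancel_right by blast
    then show False using principal_x_proper mem_principal by metis
  qed
  then show ?thesis using that left_idealD(1)[OF I(1)] by blast
qed

subsection \<open>The Weyl algebra\<close>

text \<open>J / J' is finite-dimensional over K, so some nonzero polynomial in x annihilates it. If
  g is one of least degree, commuting it with \<theta> gives d(g), which also annihilates and has
  smaller degree. Hence g is constant and the quotient vanishes.\<close>

lemma weyl_finite_index:
  assumes sid: "\<sigma> = id" and c: "c \<noteq> 0" and dd: "\<And>r. d r = smult c (pderiv r)"
    and J: "left_ideal J S" and J': "left_ideal J' S" and sub: "J' \<subseteq> J" and fin: "finite (keys J - keys J')"
  shows "J = J'"
proof -
  interpret VS: vector_space "\<lambda>k (p :: 'k poly poly). smult [:k:] p"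
    by unfold_locales (simp_all add: smult_add_right smult_add_left[symmetric] mult.commute one_pCons[symmetric])
  define F where "F = keys J - keys J'"
  have "\<forall>e\<in>F. \<exists>a\<in>J. a \<noteq> 0 \<and> key a = e" by (auto simp: F_def keys_def)
  then obtain f where f: "\<And>e. e \<in> F \<Longrightarrow> f e \<in> J \<and> f e \<noteq> 0 \<and> key (f e) = e" by metis
  define B where "B = f ` F"
  have finB: "finite B" and BJ: "B \<subseteq> J" using fin f by (auto simp: B_def F_def)
  \<comment> \<open>Division by keys: a key in \<open>keys J'\<close> is removed by an element of
    J', any other by the chosen element of B with that key.\<close>
  have span: "a \<in> J \<longrightarrow> (\<exists>v\<in>VS.span B. a - v \<in> J')" for a
  proof (induction a rule: wf_induct_rule[OF wf_key_less])
    case (1 a)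
    show ?case
    proof (intro impI, cases "a = 0")
      case True
      then show "\<exists>v\<in>VS.span B. a - v \<in> J'" using left_idealD(1)[OF J'] VS.span_zero by (intro bexI[of _ 0]) auto
    next
      case False
      assume a: "a \<in> J"
      have IH: "\<exists>v\<in>VS.span B. e - v \<in> J'" if "e \<in> J" "e = 0 \<or> (e, a) \<in> key_less" for e
        using 1 that left_idealD(1)[OF J'] VS.span_zero by (cases "e = 0") (auto intro!: bexI[of _ 0])
      show "\<exists>v\<in>VS.span B. a - v \<in> J'"
      proof (cases "key a \<in> keys J'")
        case True
        then obtain e where e: "e \<in> J'" "e \<noteq> 0" "key a = key e" by (auto simp: keys_def)
        obtain k where k: "a - smult [:k:] e = 0 \<or> (a - smult [:k:] e, a) \<in> key_less"
          using reduce_key[OF False e(2,3)] by blast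
        have e': "smult [:k:] e \<in> J'" by (rule left_idealD(4)[OF J' e(1)])
        then obtain v where v: "v \<in> VS.span B" "a - smult [:k:] e - v \<in> J'"
          using IH k left_idealD(7)[OF J a] sub by blast
        have "a - v = (a - smult [:k:] e - v) + smult [:k:] e" by simp
        then show ?thesis using left_idealD(2)[OF J' v(2) e'] v(1) by auto
      next
        case False
        then have F: "key a \<in> F" using a \<open>a \<noteq> 0\<close> by (auto simp: F_def keys_def)
        obtain k where k: "a - smult [:k:] (f (key a)) = 0 \<or> (a - smult [:k:] (f (key a)), a) \<in> key_less"
          using reduce_key[OF \<open>a \<noteq> 0\<close>, of "f (key a)"] f[OF F] by auto
        have "smult [:k:] (f (key a)) \<in> J" using left_idealD(4)[OF J] f[OF F] by blast
        then obtain v where v: "v \<in> VS.span B" "a - smult [:k:] (f (key a)) - v \<in> J'"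
          using IH k left_idealD(7)[OF J a] by blast
        have "f (key a) \<in> B" using F by (auto simp: B_def)
        then have "smult [:k:] (f (key a)) + v \<in> VS.span B"
          by (intro VS.span_add[OF _ v(1)] VS.span_scale VS.span_base)
        moreover have "a - (smult [:k:] (f (key a)) + v) \<in> J'" using v(2) by (simp add: algebra_simps)
        ultimately show ?thesis by blast
      qed
    qed
  qed
  \<comment> \<open>Each x^k a has a representative \<open>v k\<close> in the finite-dimensional
    span of B. Either two of these coincide or they are linearly dependent, and both yield a nonzero
    polynomial that takes a into J'.\<close>
  have torsion: "\<exists>g. g \<noteq> 0 \<and> smult g a \<in> J'" if a: "a \<in> J" for a
  proof -
    have "\<exists>v\<in>VS.span B. smult (monom 1 k) a - v \<in> J'" for k
      using span left_idealD(4)[OF J a] by blast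
    then obtain v where v: "\<And>k. v k \<in> VS.span B" "\<And>k::nat. smult (monom 1 k) a - v k \<in> J'" by metis
    show ?thesis
    proof (cases "inj v")
      case False
      then obtain k l where kl: "k \<noteq> l" "v k = v l" by (auto simp: inj_def)
      have "smult (monom 1 k - monom 1 l) a = (smult (monom 1 k) a - v k) - (smult (monom 1 l) a - v l)"
        using kl by (simp add: smult_diff_left)
      then have "smult (monom 1 k - monom 1 l) a \<in> J'" using left_idealD(7)[OF J' v(2) v(2)] by metis
      moreover have "monom 1 k - monom 1 l \<noteq> (0 :: 'k poly)" using kl(1) by (metis degree_monom_eq eq_iff_diff_eq_0 one_neq_zero)
      ultimately show ?thesis by blast
    next
      case True
      have "VS.dependent (range v)"
        using VS.independent_span_bound[OF finB, of "range v"] v(1) True range_inj_infinite by blast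
      then obtain t u where t: "finite t" "t \<subseteq> range v" "(\<Sum>w\<in>t. smult [:u w:] w) = 0" "\<exists>w\<in>t. u w \<noteq> 0"
        unfolding VS.dependent_explicit by blast
      obtain A where A: "finite A" "t = v ` A" using t(1,2) by (meson finite_subset_image)
      let ?g = "\<Sum>k\<in>A. monom (u (v k)) k"
      have sum0: "(\<Sum>k\<in>A. smult [:u (v k):] (v k)) = 0"
        using t(3) sum.reindex[where h = v and A = A and g = "\<lambda>w. smult [:u w:] w"] inj_on_subset[OF True subset_UNIV, of A] by (simp add: A(2))
      have "(\<Sum>k\<in>C. smult [:u (v k):] (smult (monom 1 k) a - v k)) \<in> J'" if "finite C" for C
        using that by (induction C rule: finite_induct) (use left_idealD[OF J'] v(2) in auto)
      from this[OF A(1)] have "(\<Sum>k\<in>A. smult [:u (v k):] (smult (monom 1 k) a)) \<in> J'"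
        using sum0 by (simp add: smult_diff_right sum_subtractf)
      moreover have "(\<Sum>k\<in>A. smult [:u (v k):] (smult (monom 1 k) a)) = smult ?g a"
        by (induction A rule: infinite_finite_induct) (simp_all add: smult_add_left smult_monom)
      moreover have "?g \<noteq> 0"
      proof
        assume z: "?g = 0"
        obtain k where k: "k \<in> A" "u (v k) \<noteq> 0" using t(4) A(2) by auto
        have "coeff ?g k = u (v k)"
          using A(1) k(1) by (simp add: coeff_sum sum.delta)
        then show False using z k by simp
      qed
      ultimately show ?thesis by metis
    qed
  qed
  have "\<exists>g. g \<noteq> 0 \<and> (\<forall>a\<in>C. smult g a \<in> J')" if "finite C" "C \<subseteq> J" for C
    using that
  proof (induction C rule: finite_induct)
    case (insert a C)
    then obtain g g' where g: "g \<noteq> 0" "\<forall>a\<in>C. smult g a \<in> J'" "g' \<noteq> 0" "smult g' a \<in> J'" using torsion by blast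
    have "smult (g * g') e \<in> J'" if "e \<in> insert a C" for e
    proof (cases "e = a")
      case True
      then show ?thesis using left_idealD(4)[OF J' g(4), of g] by simp
    next
      case False
      then show ?thesis using left_idealD(4)[OF J', of "smult g e" g'] g(2) that by (simp add: mult.commute)
    qed
    then show ?case using g by (intro exI[of _ "g * g'"]) auto
  qed (auto intro: exI[of _ 1])
  from this[OF finB BJ] obtain g0 where g0: "g0 \<noteq> 0" "\<And>a. a \<in> B \<Longrightarrow> smult g0 a \<in> J'" by blast
  have "smult g0 a \<in> J'" if a: "a \<in> J" for a
  proof -
    obtain v where v: "v \<in> VS.span B" "a - v \<in> J'" using span a by blast
    have "smult g0 v \<in> J'"
      using v(1)
    proof (induction rule: VS.span_induct_alt)
      case base
      then show ?case using left_idealD(1)[OF J'] by simp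
    next
      case (step k x y)
      have "smult g0 (smult [:k:] x + y) = smult [:k:] (smult g0 x) + smult g0 y"
        by (simp add: smult_add_right mult.commute)
      then show ?case using left_idealD(2)[OF J' left_idealD(4)[OF J' g0(2)[OF step(1)]] step(2)] by metis
    qed
    moreover have "smult g0 a - smult g0 v \<in> J'" using left_idealD(4)[OF J' v(2), of g0] by (simp add: smult_diff_right)
    ultimately show ?thesis using left_ideal_eqD[OF J'] by blast
  qed
  define Q where "Q g \<longleftrightarrow> g \<noteq> 0 \<and> (\<forall>a\<in>J. smult g a \<in> J')" for g
  have "Q g0" using \<open>\<And>a. a \<in> J \<Longrightarrow> smult g0 a \<in> J'\<close> g0(1) by (simp add: Q_def)
  then obtain g where "Q g" and min: "\<And>g'. Q g' \<Longrightarrow> degree g \<le> degree g'"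
    using ex_has_least_nat[of Q g0 degree] by blast
  then have g: "g \<noteq> 0" "\<And>a. a \<in> J \<Longrightarrow> smult g a \<in> J'" by (auto simp: Q_def)
  \<comment> \<open>As \<sigma> = id, the commutator of \<theta> and g is d(g).\<close>
  have dg: "smult (d g) a \<in> J'" if "a \<in> J" for a
  proof -
    have "smult (d g) a = T (smult g a) - smult g (T a)" using sid T_smult[of g a] by simp
    then show ?thesis
      using left_idealD(7)[OF J' left_idealD(5)[OF J' g(2)[OF that]] g(2)[OF left_idealD(5)[OF J that]]] by simp
  qed
  have "degree g = 0"
  proof (rule ccontr)
    assume pos: "degree g \<noteq> 0"
    then have "d g \<noteq> 0" using c by (simp add: dd pderiv_eq_0_iff)
    then have "degree g \<le> degree (d g)" using min dg by (simp add: Q_def)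
    then show False using pos c Polynomial.degree_pderiv[of g] by (simp add: dd)
  qed
  then obtain k where k: "g = [:k:]" "k \<noteq> 0" using g(1) by (metis degree_eq_zeroE pCons_0_0)
  have "a \<in> J'" if "a \<in> J" for a
    using left_idealD(4)[OF J' g(2)[OF that], of "[:inverse k:]"] k by simp
  then show ?thesis using sub by auto
qed

lemma weyl_dcc:
  assumes sid: "\<sigma> = id" and c: "c \<noteq> 0" and dd: "\<And>r. d r = smult c (pderiv r)"
    and P: "P \<in> I" "P \<noteq> 0"
  shows "dcc_above S I"
  unfolding dcc_above_def
proof (intro allI impI)
  fix J :: "nat \<Rightarrow> 'k poly poly set"
  assume J: "\<forall>i. left_ideal (J i) S \<and> I \<subseteq> J i \<and> J (Suc i) \<subseteq> J i"
  then have Jl: "left_ideal (J i) S" for i by blast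
  obtain i0 j0 where key: "key P = (i0, j0)" by fastforce
  have PJ: "(i0, j0) \<in> keys (J m)" for m
    using P key J by (auto simp: keys_def intro!: exI[of _ P])
  \<comment> \<open>The key (i0, j0) belongs to all members of the chain, so their key sets can
    differ only in the strips i < i0 and j < j0. Among the finitely many lines of these strips,
    those that meet the key set become fewer and are eventually constant.\<close>
  define rows where "rows m = {i. i < i0 \<and> (\<exists>j. (i, j) \<in> keys (J m))}" for m
  define cols where "cols m = {j. j < j0 \<and> (\<exists>i. (i, j) \<in> keys (J m))}" for m
  have anti: "m \<le> m' \<Longrightarrow> J m' \<subseteq> J m" for m m' using lift_Suc_antimono_le[of J] J by blast
  have fin: "finite (rows m)" "finite (cols m)" for m by (auto simp: rows_def cols_def)
  have ranti: "rows m' \<subseteq> rows m" "cols m' \<subseteq> cols m" if "m \<le> m'" for m m'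
    using keys_mono[OF anti[OF that]] by (auto simp: rows_def cols_def)
  obtain n1 where n1: "\<And>i. i \<ge> n1 \<Longrightarrow> card (rows i) = card (rows n1)"
    using antimono_stabilizes[of "\<lambda>i. card (rows i)"] card_mono[OF fin(1) ranti(1)] by (metis le_SucI order_refl)
  obtain n2 where n2: "\<And>i. i \<ge> n2 \<Longrightarrow> card (cols i) = card (cols n2)"
    using antimono_stabilizes[of "\<lambda>i. card (cols i)"] card_mono[OF fin(2) ranti(2)] by (metis le_SucI order_refl)
  let ?n = "max n1 n2"
  show "\<exists>n. \<forall>i\<ge>n. J i = J n"
  proof (intro exI[of _ ?n] allI impI)
    fix m assume m: "m \<ge> ?n"
    have r: "rows m = rows ?n"
      by (rule card_subset_eq[OF fin(1) ranti(1)[OF m]]) (use n1[of m] n1[of ?n] m in simp)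
    have cl: "cols m = cols ?n"
      by (rule card_subset_eq[OF fin(2) ranti(2)[OF m]]) (use n2[of m] n2[of ?n] m in simp)
    have "\<forall>i\<in>rows m. \<exists>j. (i, j) \<in> keys (J m)" "\<forall>j\<in>cols m. \<exists>i. (i, j) \<in> keys (J m)"
      by (auto simp: rows_def cols_def)
    then obtain hr hc where hr: "\<And>i. i \<in> rows m \<Longrightarrow> (i, hr i) \<in> keys (J m)"
      and hc: "\<And>j. j \<in> cols m \<Longrightarrow> (hc j, j) \<in> keys (J m)" by metis
    \<comment> \<open>On a line that meets both key sets these differ in finitely many points, since
      each contains everything beyond some point.\<close>
    have "keys (J ?n) - keys (J m) \<subseteq> (\<Union>i<i0. {i} \<times> {..<hr i}) \<union> (\<Union>j<j0. {..<hc j} \<times> {j})"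
    proof clarify
      fix i j assume ij: "(i, j) \<in> keys (J ?n)" "(i, j) \<notin> keys (J m)"
        and not: "(i, j) \<notin> (\<Union>j<j0. {..<hc j} \<times> {j})"
      have "\<not> (i0 \<le> i \<and> j0 \<le> j)" using keys_up[OF Jl PJ, of i j m] ij(2) by blast
      then consider "i < i0" | "j < j0" by linarith
      then show "(i, j) \<in> (\<Union>i<i0. {i} \<times> {..<hr i})"
      proof cases
        case 1
        then have "i \<in> rows m" using ij(1) r by (auto simp: rows_def)
        then have "j < hr i" using keys_up[OF Jl hr, of i i j] ij(2) by (meson leI order_refl)
        then show ?thesis using 1 by auto
      next
        case 2
        then have "j \<in> cols m" using ij(1) cl by (auto simp: cols_def)
        then have "i < hc j" using keys_up[OF Jl hc, of j i j] ij(2) by (meson leI order_refl)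
        then show ?thesis using 2 not by auto
      qed
    qed
    then have "finite (keys (J ?n) - keys (J m))" by (rule finite_subset) auto
    then show "J m = J ?n" using weyl_finite_index[OF sid c dd Jl Jl anti[OF m]] by simp
  qed
qed

subsection \<open>Ore extensions that are finite over their centre\<close>

text \<open>The left multiple \<theta>^m P has as leading coefficient the image under \<sigma>^m of
  that of P. Multiplying by l, which all these conjugates divide, replaces the division of
  coefficients.\<close>

lemma pseudo_division:
  assumes I: "left_ideal I S" and P: "P \<in> I" "degree P > 0" and dvd: "\<And>i. (\<sigma> ^^ i) (lead_coeff P) dvd l"
  shows "\<exists>j r. degree r < degree P \<and> smult (l ^ j) t - r \<in> I"
proof (induction "degree t" arbitrary: t rule: less_induct)
  case less
  show ?case
  proof (cases "degree t < degree P")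
    case True
    then show ?thesis using left_idealD(1)[OF I] by (intro exI[of _ 0] exI[of _ t]) simp
  next
    case False
    let ?m = "degree t - degree P"
    have P0: "P \<noteq> 0" using P(2) by auto
    obtain l' where l': "l = (\<sigma> ^^ ?m) (lead_coeff P) * l'" using dvd by (auto simp: dvd_def)
    define u where "u = smult (l' * lead_coeff t) ((T ^^ ?m) P)"
    have dT: "degree ((T ^^ ?m) P) = degree t" using Tpow(2)[OF P0, of ?m] False by simp
    have cT: "coeff ((T ^^ ?m) P) (degree t) = (\<sigma> ^^ ?m) (lead_coeff P)" using Tpow(3)[OF P0, of ?m] dT by simp
    have uI: "u \<in> I" unfolding u_def
      using left_idealD(3)[OF I P(1), of "monom (l' * lead_coeff t) ?m"] by (simp add: monom_mul)
    have "degree (smult l t - u) < degree t"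
    proof (rule degree_lessI)
      show "smult l t - u \<noteq> 0 \<or> degree t > 0" using False P(2) by auto
      show "\<forall>k\<ge>degree t. coeff (smult l t - u) k = 0"
      proof (intro allI impI)
        fix k assume "degree t \<le> k"
        then consider "k = degree t" | "k > degree t" by linarith
        then show "coeff (smult l t - u) k = 0"
          by cases (use cT dT l' in \<open>simp_all add: u_def coeff_eq_0 mult_ac\<close>)
      qed
    qed
    then obtain j r where jr: "degree r < degree P" "smult (l ^ j) (smult l t - u) - r \<in> I" using less by blast
    have "smult (l ^ Suc j) t - r = (smult (l ^ j) (smult l t - u) - r) + smult (l ^ j) u"
      by (simp add: smult_diff_right mult.commute)
    then have "smult (l ^ Suc j) t - r \<in> I" using left_idealD(2)[OF I jr(2) left_idealD(4)[OF I uI]] by metis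
    then show ?thesis using jr(1) by blast
  qed
qed

lemma central_const:
  assumes "\<sigma> f = f" "d f = 0" shows "s \<star> [:f:] = smult f s"
proof (induction s rule: ore_induct)
  case (T s)
  then show ?case using assms by (simp add: T_mul T_smult)
qed (simp_all add: R.distrib_right smult_add_right mult.commute)

section \<open>Central elements and maximal left ideals\<close>

definition proper_maximal :: "'k poly poly set \<Rightarrow> bool" where
  "proper_maximal I \<longleftrightarrow> left_ideal I S \<and> 1 \<notin> I \<and> (\<forall>J. left_ideal J S \<and> I \<subset> J \<longrightarrow> 1 \<in> J)"

lemma proper_maximalD:
  assumes "proper_maximal I"
  shows "left_ideal I S" "1 \<notin> I" "left_ideal J S \<Longrightarrow> I \<subset> J \<Longrightarrow> 1 \<in> J"
  using assms by (auto simp: proper_maximal_def)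

text \<open>A form of Schur's lemma: on the simple module S / I a central element acts by zero or
  surjectively. The point is that I + c S is a left ideal.\<close>

lemma maximal_central_unit:
  assumes I: "proper_maximal I" and c: "\<And>s. s \<star> c = c \<star> s" "c \<notin> I"
  shows "\<exists>s. t - c \<star> s \<in> I"
proof -
  note Il = proper_maximalD(1)[OF I]
  let ?J = "{a + c \<star> s | a s. a \<in> I}"
  have "left_ideal ?J S" unfolding left_ideal_iff
  proof (intro conjI ballI allI)
    show "0 \<in> ?J" using left_idealD(1)[OF Il] by (auto intro!: exI[of _ 0])
    fix u v assume "u \<in> ?J" "v \<in> ?J"
    then obtain a s a' s' where h: "u = a + c \<star> s" "v = a' + c \<star> s'" "a \<in> I" "a' \<in> I" by blast
    have "u + v = (a + a') + c \<star> (s + s')" using h by (simp add: R.distrib_left)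
    then show "u + v \<in> ?J" using left_idealD(2)[OF Il h(3,4)] by blast
  next
    fix v u assume "u \<in> ?J"
    then obtain a s where h: "u = a + c \<star> s" "a \<in> I" by blast
    have "v \<star> u = v \<star> a + c \<star> (v \<star> s)" using h by (simp add: R.distrib_left R.mult.assoc[symmetric] c(1))
    then show "v \<star> u \<in> ?J" using left_idealD(3)[OF Il h(2)] by blast
  qed
  moreover have "I \<subset> ?J"
  proof
    show "I \<subseteq> ?J"
    proof
      fix a assume "a \<in> I"
      moreover have "a = a + c \<star> 0" by simp
      ultimately show "a \<in> ?J" by blast
    qed
    have "c = 0 + c \<star> 1" by simp
    then have "c \<in> ?J" using left_idealD(1)[OF Il] by blast
    then show "I \<noteq> ?J" using c(2) by blast
  qed
  ultimately have "1 \<in> ?J" by (rule proper_maximalD(3)[OF I])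
  then obtain a s where h: "1 = a + c \<star> s" "a \<in> I" by blast
  have "t - c \<star> (t \<star> s) = t \<star> (1 - c \<star> s)"
    by (simp add: R.right_diff_distrib R.mult.assoc[symmetric] c(1))
  also have "\<dots> = t \<star> a" using h(1) by (metis add_diff_cancel_right')
  finally show ?thesis using left_idealD(3)[OF Il h(2), of t] by metis
qed

text \<open>If \<sigma>^n = id, this is the norm of l for the cyclic group of powers of \<sigma>: it
  is \<sigma>-invariant and divisible by every conjugate of l.\<close>

definition norm_poly :: "nat \<Rightarrow> 'k poly \<Rightarrow> 'k poly" where "norm_poly n l = (\<Prod>i<n. (\<sigma> ^^ i) l)"

lemma s_prod: "\<sigma> (prod f A) = (\<Prod>i\<in>A. \<sigma> (f i))"
  by (induction A rule: infinite_finite_induct) (simp_all add: s_mult)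

lemma s_norm_poly:
  assumes "\<sigma> ^^ n = id" "n > 0" shows "\<sigma> (norm_poly n l) = norm_poly n l"
proof -
  obtain m where m: "n = Suc m" using assms(2) by (cases n) auto
  have "\<sigma> (norm_poly n l) = (\<Prod>i<n. (\<sigma> ^^ Suc i) l)" by (simp add: norm_poly_def s_prod)
  also have "\<dots> = (\<Prod>i<m. (\<sigma> ^^ Suc i) l) * (\<sigma> ^^ n) l" by (simp add: m)
  also have "\<dots> = (\<sigma> ^^ 0) l * (\<Prod>i<m. (\<sigma> ^^ Suc i) l)" using assms(1) by (simp add: mult.commute)
  also have "\<dots> = norm_poly n l" unfolding norm_poly_def m by (rule prod.lessThan_Suc_shift[symmetric])
  finally show ?thesis .
qed

lemma dvd_norm_poly:
  assumes "\<sigma> ^^ n = id" "n > 0" shows "(\<sigma> ^^ i) l dvd norm_poly n l"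
proof -
  have "(\<sigma> ^^ i) l = (\<sigma> ^^ (i mod n)) l" using assms(1) by (metis funpow_mod_eq id_apply)
  moreover have "(\<sigma> ^^ (i mod n)) l dvd norm_poly n l"
    unfolding norm_poly_def by (rule dvd_prodI) (use assms(2) in auto)
  ultimately show ?thesis by simp
qed

lemma norm_poly_eq_zero [simp]: "norm_poly n l = 0 \<longleftrightarrow> l = 0 \<and> n > 0"
  by (auto simp: norm_poly_def)

text \<open>If no nonzero constant lies in the maximal left ideal, the quotient embeds into a finite-dimensional
  \<open>K(x)\<close>-vector space in which denominators only involve the factors of one polynomial \<open>l\<close>;
  the central element \<open>1 + u l\<close> then cannot act surjectively.\<close>

lemma maximal_meets_Kx:
  assumes n: "\<sigma> ^^ n = id" "n > 0" and Zd: "\<And>f. \<sigma> f = f \<Longrightarrow> d f = 0"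
    and I: "proper_maximal I" and nz: "I \<noteq> {0}"
  shows "\<exists>f. f \<noteq> 0 \<and> \<sigma> f = f \<and> [:f:] \<in> I"
proof -
  note Il = proper_maximalD(1)[OF I]
  obtain P0 where "P0 \<in> I" "P0 \<noteq> 0" using nz left_idealD(1)[OF Il] by blast
  then obtain P where P: "P \<in> I" "P \<noteq> 0" and min: "\<And>Q. Q \<in> I \<Longrightarrow> Q \<noteq> 0 \<Longrightarrow> degree P \<le> degree Q"
    using ex_has_least_nat[of "\<lambda>P. P \<in> I \<and> P \<noteq> 0" P0 degree] by blast
  show ?thesis
  proof (cases "degree P = 0")
    case True
    then obtain f where f: "P = [:f:]" by (metis degree_eq_zeroE)
    have "f dvd norm_poly n f" using dvd_norm_poly[OF n, of 0 f] by simp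
    then obtain g where g: "norm_poly n f = f * g" by (auto simp: dvd_def)
    have "[:norm_poly n f:] = smult g P" by (simp add: f g mult.commute)
    then have "[:norm_poly n f:] \<in> I" using left_idealD(4)[OF Il P(1)] by simp
    then show ?thesis using s_norm_poly[OF n] P(2) f by (intro exI[of _ "norm_poly n f"]) simp
  next
    case False
    define l where "l = norm_poly n (lead_coeff P)"
    \<comment> \<open>The norm of x makes c = 1 + u l nonconstant, while c stays \<sigma>-invariant
      and prime to l.\<close>
    define u where "u = norm_poly n [:0, 1:]"
    define c where "c = 1 + u * l"
    have l0: "l \<noteq> 0" using P(2) by (simp add: l_def)
    have "[:0, 1:] dvd u" using dvd_norm_poly[OF n, of 0 "[:0, 1:]"] by (simp add: u_def)
    moreover have u0: "u \<noteq> 0" using n(2) by (simp add: u_def)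
    ultimately have "degree u > 0" using dvd_imp_degree_le[of "[:0, 1:]" u] by simp
    then have "degree (u * l) > 0" using l0 u0 by (simp add: degree_mult_eq)
    then have dc: "degree c > 0" unfolding c_def by (subst degree_add_eq_right) auto
    have sc: "\<sigma> c = c" using s_norm_poly[OF n] by (simp add: c_def s_add s_mult l_def u_def)
    have cen: "s \<star> [:c:] = [:c:] \<star> s" for s using central_const[OF sc Zd[OF sc]] by simp
    have "c \<noteq> 0" using dc by auto
    then have "[:c:] \<notin> I" using min[of "[:c:]"] False by auto
    then obtain s where s: "1 - [:c:] \<star> s \<in> I" using maximal_central_unit[OF I cen] by blast
    obtain j r where jr: "degree r < degree P" "smult (l ^ j) s - r \<in> I"
      using pseudo_division[OF Il P(1), of l s] False dvd_norm_poly[OF n] by (auto simp: l_def)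
    \<comment> \<open>From c s = 1 and l^j s = r modulo I follows l^j = c r modulo I. Both sides
      have smaller degree in \<theta> than P, so they are equal and c divides l^j.\<close>
    have "[:l ^ j:] - smult c r = smult (l ^ j) (1 - [:c:] \<star> s) + smult c (smult (l ^ j) s - r)"
      by (simp add: smult_diff_right one_pCons mult.commute)
    then have mem: "[:l ^ j:] - smult c r \<in> I"
      using left_idealD(2)[OF Il left_idealD(4)[OF Il s] left_idealD(4)[OF Il jr(2)]] by metis
    have "degree ([:l ^ j:] - smult c r) < degree P"
      using degree_diff_less[of "[:l ^ j:]" "degree P" "smult c r"] jr(1) False degree_smult_le[of c r]
      by (simp del: degree_smult_eq)
    then have "[:l ^ j:] = smult c r" using min[OF mem] by fastforce
    then have "l ^ j = c * coeff r 0" by (metis coeff_pCons_0 coeff_smult)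
    then have "c dvd l ^ j" by simp
    then have "c dvd 1"
    proof (induction j)
      case (Suc j)
      have "l ^ j = l ^ j * c - u * l ^ Suc j" by (simp add: c_def algebra_simps)
      then have "c dvd l ^ j" using Suc.prems by (metis dvd_diff dvd_mult dvd_triv_right)
      then show ?case by (rule Suc.IH)
    qed simp
    then show ?thesis using dc is_unit_iff_degree[OF \<open>c \<noteq> 0\<close>] by simp
  qed
qed

text \<open>Horner evaluation at w of a polynomial over K. It is multiplicative for every w because
  the scalars are central.\<close>

definition ev :: "'k poly poly \<Rightarrow> 'k poly \<Rightarrow> 'k poly poly" where
  "ev w p = fold_coeffs (\<lambda>k s. [:[:k:]:] + w \<star> s) p 0"

lemma ev_0 [simp]: "ev w 0 = 0" by (simp add: ev_def)

lemma ev_pCons [simp]: "ev w (pCons k p) = [:[:k:]:] + w \<star> ev w p"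
  by (cases "k = 0 \<and> p = 0") (auto simp: ev_def)

lemma const_comm: "s \<star> [:[:k:]:] = smult [:k:] s"
  by (rule central_const) simp_all

lemma mul_smult_const: "s \<star> smult [:k:] t = smult [:k:] (s \<star> t)"
  by (metis R.mult.assoc const_comm const_mul)

lemma ev_add: "ev w (p + r) = ev w p + ev w r"
proof (induction p r rule: poly_induct2)
  case (pCons a p b r)
  have "[:[:a + b:]:] = [:[:a:]:] + [:[:b:]:]" by simp
  then show ?case using pCons by (simp add: R.distrib_left)
qed simp

lemma ev_smult: "ev w (smult k p) = smult [:k:] (ev w p)"
  by (induction p) (simp_all add: smult_add_right mul_smult_const)

lemma ev_mult: "ev w (p * r) = ev w p \<star> ev w r"
  by (induction p) (simp_all add: ev_add ev_smult R.distrib_right R.mult.assoc)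

lemma ev_1 [simp]: "ev w 1 = 1"
  by (simp add: one_pCons)

lemma ev_central:
  assumes "\<And>s. s \<star> w = w \<star> s" shows "s \<star> ev w p = ev w p \<star> s"
proof (induction p)
  case (pCons k p)
  have "s \<star> (w \<star> ev w p) = (w \<star> ev w p) \<star> s"
    using pCons.IH by (simp add: R.mult.assoc[symmetric] assms) (simp add: R.mult.assoc)
  then show ?case by (simp add: R.distrib_left R.distrib_right const_comm)
qed simp

lemma ev_degree:
  assumes w: "lead_coeff w = 1" "degree w > 0" and "p \<noteq> 0"
  shows "degree (ev w p) = degree w * degree p \<and> lead_coeff (ev w p) = [:lead_coeff p:]"
  using assms(3)
proof (induction p)
  case (pCons k p)
  have w0: "w \<noteq> 0" using w by auto
  show ?case
  proof (cases "p = 0")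
    case False
    then have IH: "degree (ev w p) = degree w * degree p" "lead_coeff (ev w p) = [:lead_coeff p:]"
      using pCons.IH by auto
    have nz: "ev w p \<noteq> 0" using IH(2) False by auto
    have dw: "degree (w \<star> ev w p) = degree w * Suc (degree p)" using degree_mul_lead(2)[OF w0 nz] IH by simp
    have lw: "lead_coeff (w \<star> ev w p) = [:lead_coeff p:]"
      unfolding lead_coeff_mul[OF w0 nz] IH(2) w(1) by simp
    have lt: "degree [:[:k:]:] < degree (w \<star> ev w p)" unfolding dw using w(2) by simp
    show ?thesis using degree_add_eq_right[OF lt] lead_coeff_add_le[OF lt] dw lw False by simp
  qed (use pCons in simp)
qed simp


text \<open>This is I plus the K[w]-multiples of the listed elements. A list allows generators to be
  removed one at a time.\<close>

primrec wspan :: "'k poly poly \<Rightarrow> 'k poly poly set \<Rightarrow> 'k poly poly list \<Rightarrow> 'k poly poly set" where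
  "wspan w I [] = I"
| "wspan w I (v # vs) = {ev w g \<star> v + s | g s. s \<in> wspan w I vs}"

lemma wspan_closed:
  assumes I: "left_ideal I S"
  shows "s \<in> wspan w I vs \<Longrightarrow> t \<in> wspan w I vs \<Longrightarrow> s + t \<in> wspan w I vs"
    and "s \<in> wspan w I vs \<Longrightarrow> ev w g \<star> s \<in> wspan w I vs"
    and "I \<subseteq> wspan w I vs"
    and "v \<in> set vs \<Longrightarrow> ev w g \<star> v \<in> wspan w I vs"
proof (induction vs arbitrary: s t g)
  case Nil
  { case 1 then show ?case using left_idealD(2)[OF I] by simp
  next case 2 then show ?case using left_idealD(3)[OF I] by simp }
next
  case (Cons v' vs)
  have incl: "wspan w I vs \<subseteq> wspan w I (v' # vs)"
  proof
    fix s assume "s \<in> wspan w I vs"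
    moreover have "s = ev w 0 \<star> v' + s" by simp
    ultimately show "s \<in> wspan w I (v' # vs)" by (simp only: wspan.simps) blast
  qed
  have zero: "0 \<in> wspan w I vs" using Cons(3) left_idealD(1)[OF I] by blast
  { case 1
    then obtain g s' h t' where h: "s = ev w g \<star> v' + s'" "t = ev w h \<star> v' + t'" "s' \<in> wspan w I vs" "t' \<in> wspan w I vs"
      by auto
    have "s + t = ev w (g + h) \<star> v' + (s' + t')" using h by (simp add: ev_add R.distrib_right)
    then show ?case using Cons(1)[OF h(3,4)] by (simp only: wspan.simps) blast
  next
    case 2
    then obtain k s' where h: "s = ev w k \<star> v' + s'" "s' \<in> wspan w I vs" by auto
    have "ev w g \<star> s = ev w (g * k) \<star> v' + ev w g \<star> s'" using h by (simp add: ev_mult R.distrib_left R.mult.assoc)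
    then show ?case using Cons(2)[OF h(2)] by (simp only: wspan.simps) blast
  next
    case 3
    then show ?case using incl Cons(3) by blast
  next
    case 4
    show ?case
    proof (cases "v = v'")
      case True
      have "ev w g \<star> v = ev w g \<star> v' + 0" using True by simp
      then show ?thesis using zero by (simp only: wspan.simps) blast
    next
      case False
      then show ?thesis using 4 Cons(4) incl by auto
    qed }
qed auto

text \<open>If no nonzero polynomial in w lies in I, all of them act surjectively, so S / I is a
  divisible K[w]-module. A nonzero divisible module over K[w] is not finitely generated.\<close>

lemma wspan_not_all:
  assumes I: "proper_maximal I" and w: "\<And>s. s \<star> w = w \<star> s" and none: "\<And>g. g \<noteq> 0 \<Longrightarrow> ev w g \<notin> I"
  shows "wspan w I vs \<noteq> UNIV"
proof (induction vs)
  case Nil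
  then show ?case using proper_maximalD(2)[OF I] by auto
next
  case (Cons v vs)
  note Il = proper_maximalD(1)[OF I]
  show ?case
  proof
    assume all: "wspan w I (v # vs) = UNIV"
    have div: "\<exists>s'. s - ev w g \<star> s' \<in> I" if "g \<noteq> 0" for s g
      using maximal_central_unit[OF I ev_central[OF w] none[OF that]] by blast
    have evX: "ev w [:0, 1:] = w" by (simp add: one_pCons[symmetric])
    obtain s where s: "v - w \<star> s \<in> I" using div[of "[:0, 1:]" v] evX by auto
    have "s \<in> wspan w I (v # vs)" using all by simp
    then obtain g s' where h: "s = ev w g \<star> v + s'" "s' \<in> wspan w I vs" by auto
    \<comment> \<open>From v = w s modulo I and s = g(w) v + s' follows that 1 - w g(w) takes v into
      the span of the remaining generators. Its constant coefficient 1 makes it nonzero.\<close>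
    define p where "p = 1 - pCons 0 g"
    have p0: "p \<noteq> 0"
    proof
      assume "p = 0"
      then have "coeff p 0 = 0" by simp
      then show False by (simp add: p_def)
    qed
    have p1: "p + pCons 0 g = 1" by (simp add: p_def)
    have "ev w p \<star> v + ev w (pCons 0 g) \<star> v = v" unfolding R.distrib_right[symmetric] ev_add[symmetric] p1 by simp
    then have "ev w p \<star> v = (v - w \<star> s) + w \<star> s'" by (simp add: h(1) R.distrib_left R.mult.assoc algebra_simps)
    moreover have "w \<star> s' \<in> wspan w I vs" using wspan_closed(2)[OF Il h(2), of "[:0, 1:]"] evX by simp
    moreover have "v - w \<star> s \<in> wspan w I vs" using wspan_closed(3)[OF Il] s by blast
    ultimately have pv: "ev w p \<star> v \<in> wspan w I vs" using wspan_closed(1)[OF Il] by metis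
    \<comment> \<open>Since p(w) acts surjectively on S / I and takes v into the smaller span, that
      span is already everything.\<close>
    have "t \<in> wspan w I vs" for t
    proof -
      obtain t' where t': "t - ev w p \<star> t' \<in> I" using div[OF p0] by blast
      have "t' \<in> wspan w I (v # vs)" using all by simp
      then obtain k t'' where k: "t' = ev w k \<star> v + t''" "t'' \<in> wspan w I vs" by auto
      have "t = (t - ev w p \<star> t') + (ev w k \<star> (ev w p \<star> v) + ev w p \<star> t'')"
        using k(1) ev_central[OF w, of "ev w k" p] by (simp add: R.distrib_left R.mult.assoc[symmetric])
      moreover have "t - ev w p \<star> t' \<in> wspan w I vs" using t' wspan_closed(3)[OF Il] by auto
      ultimately show ?thesis using wspan_closed(1,2)[OF Il] pv k(2) by metis
    qed
    then show False using Cons by auto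
  qed
qed

text \<open>Once f(x) lies in I, the monomials x^i \<theta>^j with i < deg f and j < deg w generate
  S / I over K[w]. By \<open>wspan_not_all\<close> some nonzero polynomial in w must then lie in
  I.\<close>

lemma maximal_meets_Kw:
  assumes I: "proper_maximal I" and f: "[:f:] \<in> I" "f \<noteq> 0" "\<sigma> f = f" "d f = 0"
    and w: "\<And>s. s \<star> w = w \<star> s" "lead_coeff w = 1" "degree w > 0"
  shows "\<exists>g. g \<noteq> 0 \<and> ev w g \<in> I"
proof (rule ccontr)
  assume "\<not> ?thesis"
  then have none: "\<And>g. g \<noteq> 0 \<Longrightarrow> ev w g \<notin> I" by blast
  note Il = proper_maximalD(1)[OF I]
  obtain vs :: "'k poly poly list"
    where vs: "set vs = (\<lambda>(i, j). monom (monom 1 i) j) ` ({..<degree f} \<times> {..<degree w})"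
    using finite_list[of "(\<lambda>(i, j). monom (monom 1 i) j) ` ({..<degree f} \<times> {..<degree w})"] by auto
  note cl = wspan_closed[OF Il, where vs = vs and w = w]
  have w0: "w \<noteq> 0" using w by auto
  have "s \<in> wspan w I vs" for s
  proof (induction s rule: wf_induct_rule[OF wf_key_less])
    case (1 s)
    show ?case
    proof (cases "s = 0")
      case True
      then show ?thesis using cl(3) left_idealD(1)[OF Il] by blast
    next
      case False
      let ?i = "degree (lead_coeff s)" and ?m = "degree s"
      \<comment> \<open>An element of the span with the key of s. For i < deg f it is w^a x^i
        \<theta>^j, where a and j come from dividing the \<theta>-degree by deg w; otherwise it is a
        multiple of f, which lies in I.\<close>
      have "\<exists>e. e \<noteq> 0 \<and> key s = key e \<and> (\<forall>k. smult [:k:] e \<in> wspan w I vs)"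
      proof (cases "?i < degree f")
        case True
        let ?a = "?m div degree w" and ?j = "?m mod degree w"
        let ?v = "monom (monom 1 ?i) ?j :: 'k poly poly"
        let ?e = "ev w (monom 1 ?a) \<star> ?v"
        have v0: "?v \<noteq> 0" by (simp add: monom_eq_0_iff)
        have E: "degree (ev w (monom 1 ?a)) = degree w * ?a" "lead_coeff (ev w (monom 1 ?a)) = 1"
          using ev_degree[OF w(2,3), of "monom 1 ?a"] by (auto simp: monom_eq_0_iff degree_monom_eq one_pCons)
        have e0: "ev w (monom 1 ?a) \<noteq> 0" using E(2) by auto
        have "degree ?e = ?m" using degree_mul_lead(2)[OF e0 v0] E(1) by (simp add: degree_monom_eq monom_eq_0_iff)
        moreover have "lead_coeff ?e = (\<sigma> ^^ degree (ev w (monom 1 ?a))) (monom 1 ?i)"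
          unfolding lead_coeff_mul[OF e0 v0] E(2) by (simp add: degree_monom_eq monom_eq_0_iff)
        then have "degree (lead_coeff ?e) = ?i" by (simp add: degree_monom_eq)
        moreover have "?e \<noteq> 0" using e0 v0 by simp
        moreover have "smult [:k:] ?e \<in> wspan w I vs" for k
        proof -
          have "?v \<in> set vs" unfolding vs by (rule image_eqI[of _ _ "(?i, ?j)"]) (use True w(3) in auto)
          then have "ev w (smult k (monom 1 ?a)) \<star> ?v \<in> wspan w I vs" by (rule cl(4))
          then show ?thesis unfolding ev_smult by simp
        qed
        ultimately show ?thesis by (intro exI[of _ ?e]) (simp add: key_def)
      next
        case False
        let ?e = "monom (monom 1 (?i - degree f) * f) ?m"
        have nz: "monom 1 (?i - degree f) * f \<noteq> 0" using f(2) by (simp add: monom_eq_0_iff)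
        have "?e = monom (monom 1 (?i - degree f)) ?m \<star> [:f:]"
          using central_const[OF f(3,4)] by (simp add: smult_monom mult.commute)
        then have "?e \<in> I" using left_idealD(3)[OF Il f(1)] by metis
        then have "smult [:k:] ?e \<in> wspan w I vs" for k using left_idealD(4)[OF Il] cl(3) by blast
        moreover have "key s = key ?e" using nz False f(2)
          by (simp add: key_def degree_monom_eq degree_mult_eq monom_eq_0_iff)
        ultimately show ?thesis using nz by (intro exI[of _ ?e]) (simp add: monom_eq_0_iff)
      qed
      then obtain e where e: "e \<noteq> 0" "key s = key e" "\<And>k. smult [:k:] e \<in> wspan w I vs" by blast
      obtain k where k: "s - smult [:k:] e = 0 \<or> (s - smult [:k:] e, s) \<in> key_less"
        using reduce_key[OF False e(1,2)] by blast
      have "s - smult [:k:] e \<in> wspan w I vs"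
      proof (cases "s - smult [:k:] e = 0")
        case True
        then show ?thesis using cl(3) left_idealD(1)[OF Il] by (metis subsetD)
      next
        case False
        then have "(s - smult [:k:] e, s) \<in> key_less" using k by blast
        then show ?thesis by (rule 1)
      qed
      from cl(1)[OF this e(3)[of k]] show ?thesis by simp
    qed
  qed
  then show False using wspan_not_all[OF I w(1) none, of vs] by auto
qed

text \<open>Fitting's lemma for a central element on a uniform Noetherian module.\<close>

lemma central_nilpotent:
  assumes I: "left_ideal I S" "f \<notin> I" "\<And>J. left_ideal J S \<Longrightarrow> I \<subset> J \<Longrightarrow> f \<in> J"
    and c: "\<And>s. s \<star> c = c \<star> s" "c \<star> f \<in> I"
  shows "\<exists>k. c \<up> k \<in> I"
proof -
  have cp: "s \<star> (c \<up> k) = (c \<up> k) \<star> s" for s k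
  proof (induction k)
    case (Suc k)
    have "s \<star> (c \<star> (c \<up> k)) = (c \<star> s) \<star> (c \<up> k)" by (simp add: R.mult.assoc[symmetric] c(1))
    also have "\<dots> = c \<star> ((c \<up> k) \<star> s)" using Suc by (simp add: R.mult.assoc)
    finally show ?case by (simp add: R.mult.assoc)
  qed simp
  \<comment> \<open>The kernels of the powers of c on S / I form an ascending chain, which has to
    stop.\<close>
  define J where "J k = {s. (c \<up> k) \<star> s \<in> I}" for k
  have Jl: "left_ideal (J k) S" for k
    unfolding left_ideal_iff
  proof (intro conjI ballI allI)
    fix u s assume "s \<in> J k"
    then have "u \<star> ((c \<up> k) \<star> s) \<in> I" using left_idealD(3)[OF I(1)] by (simp add: J_def)
    then show "u \<star> s \<in> J k" by (simp add: J_def R.mult.assoc[symmetric] cp)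
  qed (use left_idealD[OF I(1)] in \<open>auto simp: J_def R.distrib_left\<close>)
  have "J k \<subseteq> J (Suc k)" for k
    using left_idealD(3)[OF I(1)] by (auto simp: J_def R.mult.assoc)
  then obtain k where k: "J (Suc k) = J k" using acc_left_ideals[OF Jl] by blast
  have "c \<up> k \<in> I"
  proof (rule ccontr)
    assume nk: "c \<up> k \<notin> I"
    let ?J = "{a + s \<star> (c \<up> k) | a s. a \<in> I}"
    have "left_ideal ?J S" unfolding left_ideal_iff
    proof (intro conjI ballI allI)
      show "0 \<in> ?J" using left_idealD(1)[OF I(1)] by (auto intro!: exI[of _ 0])
      fix u v assume "u \<in> ?J" "v \<in> ?J"
      then obtain a s a' s' where h: "u = a + s \<star> (c \<up> k)" "v = a' + s' \<star> (c \<up> k)" "a \<in> I" "a' \<in> I" by blast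
      have "u + v = (a + a') + (s + s') \<star> (c \<up> k)" using h by (simp add: R.distrib_right)
      then show "u + v \<in> ?J" using left_idealD(2)[OF I(1) h(3,4)] by blast
    next
      fix v u assume "u \<in> ?J"
      then obtain a s where h: "u = a + s \<star> (c \<up> k)" "a \<in> I" by blast
      have "v \<star> u = v \<star> a + (v \<star> s) \<star> (c \<up> k)" using h by (simp add: R.distrib_left R.mult.assoc)
      then show "v \<star> u \<in> ?J" using left_idealD(3)[OF I(1) h(2)] by blast
    qed
    moreover have "I \<subset> ?J"
    proof
      show "I \<subseteq> ?J"
      proof
        fix a assume "a \<in> I"
        moreover have "a = a + 0 \<star> (c \<up> k)" by simp
        ultimately show "a \<in> ?J" by blast
      qed
      have "c \<up> k = 0 + 1 \<star> (c \<up> k)" by simp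
      then have "c \<up> k \<in> ?J" using left_idealD(1)[OF I(1)] by blast
      then show "I \<noteq> ?J" using nk by blast
    qed
    \<comment> \<open>Modulo I, f = s c^k is killed by c. Thus s lies in the kernel of c^(k+1),
      which equals that of c^k, and f would be zero.\<close>
    ultimately have "f \<in> ?J" by (rule I(3))
    then obtain a s where h: "f = a + s \<star> (c \<up> k)" "a \<in> I" by blast
    have "c \<star> f - c \<star> a \<in> I" using left_idealD(3,7)[OF I(1)] c(2) h(2) by blast
    moreover have "c \<star> f - c \<star> a = c \<star> ((c \<up> k) \<star> s)" using h(1) cp[of s k] by (simp add: R.distrib_left)
    moreover have "c \<star> ((c \<up> k) \<star> s) = (c \<up> Suc k) \<star> s" by (simp only: R.power.power_Suc R.mult.assoc)
    ultimately have "s \<in> J k" using k by (auto simp: J_def)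
    then have "s \<star> (c \<up> k) \<in> I" by (simp add: J_def cp)
    then show False using I(2) h left_idealD(2)[OF I(1)] by auto
  qed
  then show ?thesis by blast
qed

text \<open>The annihilator M of the socle generator is a maximal left ideal, so it contains a
  central f(x) and a central g(w). Powers of both lie in I, and their keys on the two axes leave
  only finitely many exponents outside \<open>keys I\<close>.\<close>

lemma finite_over_centre_dcc:
  assumes n: "\<sigma> ^^ n = id" "n > 0" and Zd: "\<And>f. \<sigma> f = f \<Longrightarrow> d f = 0"
    and w: "\<And>s. s \<star> w = w \<star> s" "lead_coeff w = 1" "degree w > 0"
    and mono: "monolithic S I"
  shows "dcc_above S I"
proof -
  obtain e where I: "left_ideal I S" "e \<notin> I" "\<And>J. left_ideal J S \<Longrightarrow> I \<subset> J \<Longrightarrow> e \<in> J"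
    using mono unfolding monolithic_def by blast
  define M where "M = {s. s \<star> e \<in> I}"
  have Ml: "left_ideal M S"
    unfolding left_ideal_iff M_def using left_idealD[OF I(1)] by (auto simp: R.distrib_right R.mult.assoc)
  have M: "proper_maximal M" unfolding proper_maximal_def
  proof (intro conjI allI impI Ml)
    show "1 \<notin> M" using I(2) by (simp add: M_def)
    fix J assume "left_ideal J S \<and> M \<subset> J"
    then have J: "left_ideal J S" "M \<subset> J" by auto
    let ?J = "{a + s \<star> e | a s. a \<in> I \<and> s \<in> J}"
    have "left_ideal ?J S" unfolding left_ideal_iff
    proof (intro conjI ballI allI)
      show "0 \<in> ?J" using left_idealD(1)[OF I(1)] left_idealD(1)[OF J(1)] by (auto intro!: exI[of _ 0])
      fix u v assume "u \<in> ?J" "v \<in> ?J"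
      then obtain a s a' s' where h: "u = a + s \<star> e" "v = a' + s' \<star> e" "a \<in> I" "a' \<in> I" "s \<in> J" "s' \<in> J" by blast
      have "u + v = (a + a') + (s + s') \<star> e" using h by (simp add: R.distrib_right)
      then show "u + v \<in> ?J" using left_idealD(2)[OF I(1) h(3,4)] left_idealD(2)[OF J(1) h(5,6)] by blast
    next
      fix v u assume "u \<in> ?J"
      then obtain a s where h: "u = a + s \<star> e" "a \<in> I" "s \<in> J" by blast
      have "v \<star> u = v \<star> a + (v \<star> s) \<star> e" using h by (simp add: R.distrib_left R.mult.assoc)
      then show "v \<star> u \<in> ?J" using left_idealD(3)[OF I(1) h(2)] left_idealD(3)[OF J(1) h(3)] by blast
    qed
    moreover have "I \<subset> ?J"
    proof
      show "I \<subseteq> ?J"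
      proof
        fix a assume "a \<in> I"
        moreover have "a = a + 0 \<star> e" by simp
        ultimately show "a \<in> ?J" using left_idealD(1)[OF J(1)] by blast
      qed
      obtain s where s: "s \<in> J" "s \<notin> M" using J(2) by blast
      have "s \<star> e = 0 + s \<star> e" by simp
      then have "s \<star> e \<in> ?J" using s left_idealD(1)[OF I(1)] by blast
      then show "I \<noteq> ?J" using s by (auto simp: M_def)
    qed
    ultimately have "e \<in> ?J" by (rule I(3))
    then obtain a s where h: "e = a + s \<star> e" "a \<in> I" "s \<in> J" by blast
    have "(1 - s) \<star> e = a" using h(1) by (simp add: R.left_diff_distrib algebra_simps)
    then have "1 - s \<in> J" using h(2) J(2) by (auto simp: M_def)
    then show "1 \<in> J" using left_idealD(2)[OF J(1) _ h(3), of "1 - s"] by simp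
  qed
  have "M \<noteq> {0}"
  proof
    let ?x = "[:[:0, 1:]:] :: 'k poly poly"
    assume z: "M = {0}"
    have "?x \<noteq> 0" by simp
    then have "?x \<notin> M" using z by blast
    moreover have "0 \<in> principal ?x" by (rule left_idealD(1)[OF left_ideal_principal])
    ultimately have "M \<subset> principal ?x" using z mem_principal_self[of ?x] by blast
    then show False using proper_maximalD(3)[OF M left_ideal_principal] principal_x_proper by blast
  qed
  then obtain f where f: "f \<noteq> 0" "\<sigma> f = f" "[:f:] \<in> M" using maximal_meets_Kx[OF n Zd M] by blast
  obtain g where g: "g \<noteq> 0" "ev w g \<in> M" using maximal_meets_Kw[OF M f(3,1,2) Zd[OF f(2)] w] by blast
  have "\<exists>k. [:f:] \<up> k \<in> I"
    by (rule central_nilpotent[OF I]) (use f central_const[OF f(2) Zd[OF f(2)]] in \<open>auto simp: M_def\<close>)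
  then obtain k where k: "[:f:] \<up> k \<in> I" ..
  have fk: "[:f:] \<up> k = [:f ^ k:]" by (induction k) (simp_all add: one_pCons[symmetric])
  have "\<exists>k. ev w g \<up> k \<in> I"
    by (rule central_nilpotent[OF I]) (use g ev_central[OF w(1)] in \<open>auto simp: M_def\<close>)
  then obtain m where m: "ev w g \<up> m \<in> I" ..
  have gm: "ev w g \<up> m = ev w (g ^ m)" by (induction m) (simp_all add: ev_mult)
  have "(degree (f ^ k), 0) \<in> keys I"
    using k f(1) unfolding fk keys_def key_def by (auto intro!: exI[of _ "[:f ^ k:]"])
  moreover have E: "degree (ev w (g ^ m)) = degree w * degree (g ^ m)" "lead_coeff (ev w (g ^ m)) = [:lead_coeff (g ^ m):]"
    using ev_degree[OF w(2,3), of "g ^ m"] g(1) by auto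
  then have "ev w (g ^ m) \<noteq> 0" using g(1) by auto
  then have "(0, degree w * degree (g ^ m)) \<in> keys I"
    using m E unfolding gm keys_def key_def by (auto intro!: exI[of _ "ev w (g ^ m)"])
  ultimately have "a < degree (f ^ k) \<and> c < degree w * degree (g ^ m)" if "(a, c) \<notin> keys I" for a c
    using keys_up[OF I(1), of "degree (f ^ k)" 0 a c] keys_up[OF I(1), of 0 "degree w * degree (g ^ m)" a c] that
    by (meson le0 leI)
  then have "- keys I \<subseteq> {..<degree (f ^ k)} \<times> {..<degree w * degree (g ^ m)}" by auto
  then have "finite (- keys I)" by (rule finite_subset) simp
  then show ?thesis by (rule dcc_above_cofinite)
qed

end

section \<open>Monolithic left ideals without descending chain condition\<close>

context ore
begin

lemma lead_principal_const:
  assumes "t \<in> principal [:r:]"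
  shows "(\<sigma> ^^ degree t) r dvd lead_coeff t"
proof (cases "t = 0")
  case False
  obtain s where s: "t = s \<star> [:r:]" using assms by (auto simp: principal_def)
  have nz: "s \<noteq> 0" "[:r:] \<noteq> 0" using False s by auto
  have "degree t = degree s" using degree_mul_lead(2)[OF nz] s by simp
  moreover have "lead_coeff t = lead_coeff s * (\<sigma> ^^ degree s) r"
    unfolding s lead_coeff_mul[OF nz] by simp
  ultimately show ?thesis by simp
qed simp

text \<open>Take a representative of least degree n. A leading coefficient divisible by
  \<sigma>^n(r) could be removed by a left multiple of r. Together with
  \<open>lead_principal_const\<close> this gives a test for membership in S r.\<close>

lemma reduce_principal_const:
  assumes "s \<notin> principal [:r:]"
  obtains s' where "s - s' \<in> principal [:r:]" "degree s' \<le> degree s"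
    "\<not> (\<sigma> ^^ degree s') r dvd lead_coeff s'"
proof -
  note P = left_ideal_principal[of "[:r:]"]
  have "s - s \<in> principal [:r:]" using left_idealD(1)[OF P] by simp
  then obtain s' where s': "s - s' \<in> principal [:r:]"
    and min: "\<And>u. s - u \<in> principal [:r:] \<Longrightarrow> degree s' \<le> degree u"
    using ex_has_least_nat[of "\<lambda>u. s - u \<in> principal [:r:]" s degree] by blast
  have nz: "s' \<noteq> 0" using s' assms by auto
  have "\<not> (\<sigma> ^^ degree s') r dvd lead_coeff s'"
  proof
    assume "(\<sigma> ^^ degree s') r dvd lead_coeff s'"
    then obtain c where c: "lead_coeff s' = (\<sigma> ^^ degree s') r * c" by (auto simp: dvd_def)
    define e where "e = monom c (degree s') \<star> [:r:]"
    have r0: "[:r:] \<noteq> 0"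
    proof
      assume "[:r:] = 0"
      then have "lead_coeff s' = 0" using c spow_eq_zero[of "degree s'" 0] by simp
      then show False using nz leading_coeff_neq_0 by blast
    qed
    have ce: "coeff e (degree s') = lead_coeff s'"
      using Tpow(2,3)[OF r0, of "degree s'"] by (simp add: e_def monom_mul c mult.commute)
    have de: "coeff e i = 0" if "i > degree s'" for i
      using Tpow(2)[OF r0, of "degree s'"] that by (simp add: e_def monom_mul coeff_eq_0)
    have eP: "e \<in> principal [:r:]" unfolding e_def by (rule mem_principal)
    have "s - (s' - e) = (s - s') + e" by simp
    then have mem: "s - (s' - e) \<in> principal [:r:]" using left_idealD(2)[OF P s' eP] by metis
    have z: "coeff (s' - e) i = 0" if "i \<ge> degree s'" for i
      using that ce de[of i] coeff_eq_0[of s' i] by (cases "i = degree s'") auto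
    show False
    proof (cases "degree s' = 0")
      case True
      then have "s' - e = 0" using z by (intro poly_eqI) simp
      then show False using mem assms by simp
    next
      case False
      then have "degree (s' - e) < degree s'" using z by (intro degree_lessI) auto
      then show False using min[OF mem] by simp
    qed
  qed
  then show ?thesis using that s' min[OF \<open>s - s \<in> _\<close>] by blast
qed

text \<open>Cancelling f identifies S f / S g f with the simple module S / S g. The hypothesis
  \<open>ess\<close> says that it meets every nonzero submodule of S / S g f.\<close>

lemma monolithic_product:
  assumes g: "proper_maximal (principal g)" and f: "f \<noteq> 0"
    and ess: "\<And>J. left_ideal J S \<Longrightarrow> principal (g \<star> f) \<subset> J \<Longrightarrow> J \<inter> principal f \<subseteq> principal (g \<star> f) \<Longrightarrow> False"
  shows "monolithic S (principal (g \<star> f))"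
  unfolding monolithic_def
proof (intro conjI left_ideal_principal bexI[of _ f] allI impI)
  show "f \<notin> principal (g \<star> f)"
  proof
    assume "f \<in> principal (g \<star> f)"
    then obtain s where "1 \<star> f = (s \<star> g) \<star> f" by (auto simp: principal_def R.mult.assoc)
    then have "1 = s \<star> g" using f mul_cancel_right by blast
    then show False using proper_maximalD(2)[OF g] mem_principal by metis
  qed
  fix J assume "left_ideal J S \<and> principal (g \<star> f) \<subset> J"
  then have J: "left_ideal J S" "principal (g \<star> f) \<subset> J" by auto
  obtain s where s: "s \<star> f \<in> J" "s \<star> f \<notin> principal (g \<star> f)"
    using ess[OF J] by (auto simp: principal_def)
  let ?J = "{s. s \<star> f \<in> J}"
  have "left_ideal ?J S"
    unfolding left_ideal_iff using left_idealD[OF J(1)] by (auto simp: R.distrib_right R.mult.assoc)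
  moreover have "principal g \<subset> ?J"
  proof
    have "u \<star> g \<star> f \<in> J" for u using J(2) mem_principal[of u "g \<star> f"] by (auto simp: R.mult.assoc)
    then show "principal g \<subseteq> ?J" by (auto simp: principal_def)
    have "s \<notin> principal g" using s(2) mem_principal by (auto simp: principal_def R.mult.assoc)
    then show "principal g \<noteq> ?J" using s(1) by blast
  qed
  ultimately have "1 \<in> ?J" by (rule proper_maximalD(3)[OF g])
  then show "f \<in> J" by simp
qed simp

subsection \<open>Differential operators\<close>

lemma T_pCons: "T (pCons r h) = pCons (d r) ([:\<sigma> r:] + T h)"
  by (rule poly_eqI) (auto simp: coeff_T coeff_pCons split: nat.split)

lemma mul_theta: "h \<star> [:0, 1:] = pCons 0 h"
  by (induction h rule: ore_induct) (simp_all add: T_mul T_pCons R.distrib_right one_pCons)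

text \<open>These are the two top terms of the Leibniz rule for \<theta>^n r.\<close>

lemma Tpow_const_coeff:
  assumes sid: "\<And>r. \<sigma> r = r" and dr: "d r = p"
  shows "coeff ((T ^^ n) [:r:]) n = r" and "n > 0 \<Longrightarrow> coeff ((T ^^ n) [:r:]) (n - 1) = of_nat n * p"
    and "i > n \<Longrightarrow> coeff ((T ^^ n) [:r:]) i = 0"
proof -
  have cS: "coeff (T u) (Suc m) = coeff u m + d (coeff u (Suc m))" for u m
    unfolding coeff_T sid by simp
  have c0: "coeff (T u) 0 = d (coeff u 0)" for u by (simp add: coeff_T)
  have "coeff ((T ^^ n) [:r:]) n = r \<and> (n > 0 \<longrightarrow> coeff ((T ^^ n) [:r:]) (n - 1) = of_nat n * p) \<and>
    (\<forall>i>n. coeff ((T ^^ n) [:r:]) i = 0)"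
  proof (induction n)
    case (Suc n)
    let ?X = "(T ^^ n) [:r:]"
    have IH: "coeff ?X n = r" "n > 0 \<Longrightarrow> coeff ?X (n - 1) = of_nat n * p" "\<And>i. i > n \<Longrightarrow> coeff ?X i = 0"
      using Suc by blast+
    have "coeff (T ?X) (Suc n) = r" using IH(1) IH(3)[of "Suc n"] by (simp add: cS)
    moreover have "coeff (T ?X) n = of_nat (Suc n) * p"
    proof (cases n)
      case 0
      then show ?thesis using dr by (simp add: c0)
    next
      case (Suc m)
      then have "coeff (T ?X) n = coeff ?X m + d (coeff ?X n)" by (simp only: cS)
      then show ?thesis using IH(1,2) Suc dr by (simp add: algebra_simps)
    qed
    moreover have "coeff (T ?X) i = 0" if "i > Suc n" for i
    proof -
      obtain k where k: "i = Suc k" using \<open>i > Suc n\<close> by (cases i) auto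
      then show ?thesis using IH(3)[of k] IH(3)[of i] that unfolding k cS by simp
    qed
    ultimately show ?case by simp
  qed (auto simp: coeff_pCons split: nat.splits)
  then show "coeff ((T ^^ n) [:r:]) n = r" "n > 0 \<Longrightarrow> coeff ((T ^^ n) [:r:]) (n - 1) = of_nat n * p"
    "i > n \<Longrightarrow> coeff ((T ^^ n) [:r:]) i = 0" by blast+
qed

lemma linear_dvd_iff: "[:- a, 1:] dvd r \<longleftrightarrow> poly r a = (0 :: 'k)"
  by (simp add: poly_eq_0_iff_dvd)

text \<open>The terms with the full power of \<theta> cancel, and the second term of the Leibniz
  rule becomes the leading one.\<close>

lemma commutator_lead:
  assumes sid: "\<And>r. \<sigma> r = r" and dr: "d r = p" and n: "degree s = Suc n"
  shows "coeff (smult r s - s \<star> [:r:]) n = - (of_nat (Suc n) * p * lead_coeff s)"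
    and "i > n \<Longrightarrow> coeff (smult r s - s \<star> [:r:]) i = 0"
proof -
  note C = Tpow_const_coeff[OF sid dr]
  have sum: "coeff (s \<star> [:r:]) j = (\<Sum>k\<in>{..Suc n}. coeff s k * coeff ((T ^^ k) [:r:]) j)" for j
    by (simp add: mul_eq_sum n coeff_sum)
  have split: "{..Suc n} = insert (Suc n) (insert n {..<n})" by auto
  have "(\<Sum>k\<in>{..<n}. coeff s k * coeff ((T ^^ k) [:r:]) j) = 0" if "j \<ge> n" for j
    using that C(3) by (intro sum.neutral) simp
  then have two: "coeff (s \<star> [:r:]) j = coeff s (Suc n) * coeff ((T ^^ Suc n) [:r:]) j + coeff s n * coeff ((T ^^ n) [:r:]) j"
    if "j \<ge> n" for j
    using that unfolding sum split by (simp del: funpow.simps)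
  show "coeff (smult r s - s \<star> [:r:]) n = - (of_nat (Suc n) * p * lead_coeff s)"
    using two[of n] C(1)[of n] C(2)[of "Suc n"] by (simp add: n mult.commute mult.left_commute del: funpow.simps)
  show "coeff (smult r s - s \<star> [:r:]) i = 0" if "i > n"
  proof (cases "i = Suc n")
    case True
    then show ?thesis using two[of i] C(1)[of "Suc n"] C(3)[of n i] by (simp del: funpow.simps)
  next
    case False
    then have "i > Suc n" using that by simp
    then show ?thesis using two[of i] C(3)[of "Suc n" i] C(3)[of n i] that n
      by (simp add: coeff_eq_0 del: funpow.simps)
  qed
qed

lemma spow_id: "\<sigma> = id \<Longrightarrow> (\<sigma> ^^ n) = id"
  by (induction n) auto

text \<open>Modulo S (x - a) the degree n > 0 of a class is lowered by the commutator with x - a. At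
  a, the new leading coefficient is -n p(a) times the old one and hence nonzero in characteristic
  zero. In degree 0 a nonzero constant remains.\<close>

lemma linear_principal_maximal:
  assumes sid: "\<sigma> = id" and p: "d [:- a, 1:] = p" "poly p a \<noteq> 0"
  shows "proper_maximal (principal [:[:- a, 1:]:])"
  unfolding proper_maximal_def
proof (intro conjI allI impI left_ideal_principal)
  let ?r = "[:- a, 1:]"
  let ?P = "principal [:?r:]"
  note sn = spow_id[OF sid]
  show "1 \<notin> ?P"
    using lead_principal_const[of 1 ?r] by (auto simp: sn linear_dvd_iff)
  fix J assume "left_ideal J S \<and> ?P \<subset> J"
  then have J: "left_ideal J S" "?P \<subset> J" by auto
  then obtain s0 where "s0 \<in> J \<and> s0 \<notin> ?P" by blast
  then obtain s where s: "s \<in> J" "s \<notin> ?P" and min: "\<And>u. u \<in> J \<and> u \<notin> ?P \<Longrightarrow> degree s \<le> degree u"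
    using ex_has_least_nat[of "\<lambda>u. u \<in> J \<and> u \<notin> ?P" s0 degree] by blast
  obtain t where t: "s - t \<in> ?P" "degree t \<le> degree s" "\<not> ?r dvd lead_coeff t"
    using reduce_principal_const[OF s(2)] by (auto simp: sn)
  have tJ: "t \<in> J" using left_ideal_eqD[OF J(1), of s t] t(1) J(2) s(1) by blast
  have tP: "t \<notin> ?P" using left_ideal_eqD[OF left_ideal_principal t(1)] s(2) by simp
  have dt: "degree t = degree s" using min[of t] tJ tP t(2) by simp
  have rJ: "[:?r:] \<in> J" using J(2) mem_principal_self by blast
  show "1 \<in> J"
  proof (cases "degree t")
    case 0
    then obtain c where c: "t = [:c:]" by (metis degree_eq_zeroE)
    have ca: "poly c a \<noteq> 0" using t(3) by (simp add: c linear_dvd_iff)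
    have "?r dvd c - [:poly c a:]" by (simp add: linear_dvd_iff)
    then obtain u where u: "c - [:poly c a:] = ?r * u" by (auto simp: dvd_def)
    have "[:[:poly c a:]:] = t - smult u [:?r:]"
      using u by (simp add: c algebra_simps)
    then have "[:[:poly c a:]:] \<in> J" using left_idealD(7)[OF J(1) tJ left_idealD(4)[OF J(1) rJ]] by metis
    from left_idealD(4)[OF J(1) this, of "[:inverse (poly c a):]"] ca show ?thesis by (simp add: one_pCons)
  next
    case (Suc n)
    let ?e = "smult ?r t - t \<star> [:?r:]"
    note C = commutator_lead[OF _ p(1) Suc]
    have eJ: "?e \<in> J" using left_idealD(7)[OF J(1) left_idealD(4)[OF J(1) tJ] left_idealD(3)[OF J(1) rJ]] .
    have en: "coeff ?e n = - (of_nat (Suc n) * p * lead_coeff t)" using C(1) sid by simp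
    have ndvd: "\<not> ?r dvd coeff ?e n"
    proof -
      have "poly (coeff ?e n) a = - (of_nat (Suc n) * poly p a * poly (lead_coeff t) a)"
        unfolding en by (simp del: of_nat_Suc)
      moreover have "poly (lead_coeff t) a \<noteq> 0" using t(3) by (simp add: linear_dvd_iff)
      ultimately have "poly (coeff ?e n) a \<noteq> 0" using p(2) by (simp del: of_nat_Suc)
      then show ?thesis by (simp add: linear_dvd_iff)
    qed
    have "degree ?e \<le> n" by (rule degree_le) (use C(2) sid in simp)
    moreover have "n \<le> degree ?e" by (rule le_degree) (use ndvd in auto)
    ultimately have de: "degree ?e = n" by simp
    have "?e \<notin> ?P" using lead_principal_const[of ?e ?r] ndvd unfolding de by (auto simp: sn)
    then have "degree s \<le> n" using min[of ?e] eJ de by simp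
    then show ?thesis using dt Suc by simp
  qed
qed

text \<open>Choose a with p(a) nonzero and I = S (x - a) \<theta>. The quotient S / S \<theta> is
  K[x] with \<theta> acting as p d/dx, and its submodules p^k K[x] descend strictly since p is not
  constant.\<close>

lemma differential_no_dcc:
  assumes sid: "\<sigma> = id" and dd: "\<And>r. d r = p * pderiv r" and p: "degree p > 0"
  shows "\<exists>I. monolithic S I \<and> \<not> dcc_above S I"
proof -
  note sn = spow_id[OF sid]
  have p0: "p \<noteq> 0" using p by auto
  obtain a where a: "poly p a \<noteq> 0"
    using poly_roots_finite[OF p0] infinite_UNIV_char_0 by (metis (mono_tags, lifting) Collect_cong UNIV_def)
  let ?r = "[:- a, 1:]"
  let ?P = "principal [:?r:]"
  let ?I = "principal ([:?r:] \<star> [:0, 1:])"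
  have dr: "d ?r = p" by (simp add: dd pderiv_pCons)
  have gmax: "proper_maximal ?P" by (rule linear_principal_maximal[OF sid dr a])
  have IP: "pCons 0 e \<in> ?I \<longleftrightarrow> e \<in> ?P" for e
  proof
    assume "pCons 0 e \<in> ?I"
    then obtain u where "pCons 0 e = (u \<star> [:?r:]) \<star> [:0, 1:]" by (auto simp: principal_def R.mult.assoc)
    then have "e = u \<star> [:?r:]" by (simp add: mul_theta)
    then show "e \<in> ?P" using mem_principal by metis
  next
    assume "e \<in> ?P"
    then obtain u where "e = u \<star> [:?r:]" by (auto simp: principal_def)
    then have "pCons 0 e = u \<star> ([:?r:] \<star> [:0, 1:])" unfolding R.mult.assoc[symmetric] unfolding mul_theta by simp
    then show "pCons 0 e \<in> ?I" using mem_principal by metis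
  qed
  have Theta: "u \<in> principal [:0, 1:] \<longleftrightarrow> coeff u 0 = 0" for u
    by (cases u) (auto simp: principal_def mul_theta)
  have "monolithic S ?I"
  proof (rule monolithic_product[OF gmax])
    fix J assume J: "left_ideal J S" "?I \<subset> J" and ess: "J \<inter> principal [:0, 1:] \<subseteq> ?I"
    obtain u0 where "u0 \<in> J" "u0 \<notin> ?I" using J(2) by blast
    then have "u0 \<in> J \<and> coeff u0 0 \<noteq> 0" using ess Theta by blast
    then obtain u where u: "u \<in> J" "coeff u 0 \<noteq> 0"
      and min: "\<And>v. v \<in> J \<and> coeff v 0 \<noteq> 0 \<Longrightarrow> degree (coeff u 0) \<le> degree (coeff v 0)"
      using ex_has_least_nat[of "\<lambda>u. u \<in> J \<and> coeff u 0 \<noteq> 0" u0 "\<lambda>u. degree (coeff u 0)"] by blast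
    obtain f h where fh: "u = pCons f h" by (cases u)
    have f0: "f \<noteq> 0" using u(2) fh by simp
    have sf: "\<sigma> f = f" using sid by simp
    \<comment> \<open>The constant term of \<theta> u - H u is the remainder of d(f) by f.
      Minimality of the degree of f makes it zero, so f divides d(f) and the element lies in S
      \<theta>.\<close>
    let ?H = "d f div f"
    let ?e = "[:f:] + T h - smult ?H h"
    have Tu: "T u - smult ?H u = pCons (d f - ?H * f) ?e"
      by (simp add: fh T_pCons sf)
    have mem: "T u - smult ?H u \<in> J" using left_idealD(7)[OF J(1) left_idealD(5)[OF J(1) u(1)] left_idealD(4)[OF J(1) u(1)]] .
    have rem: "d f - ?H * f = d f mod f" by (simp add: minus_div_mult_eq_mod)
    have c0: "coeff (T u - smult ?H u) 0 = d f mod f" unfolding Tu rem by simp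
    have fdvd: "d f mod f = 0"
    proof (rule ccontr)
      assume nz: "d f mod f \<noteq> 0"
      then have "degree f \<le> degree (d f mod f)" using min[of "T u - smult ?H u"] mem c0 unfolding fh by (metis coeff_pCons_0)
      then show False using degree_mod_less[OF f0, of "d f"] nz by simp
    qed
    have mem': "pCons 0 ?e \<in> J" using mem unfolding Tu rem fdvd .
    have "pCons 0 ?e \<in> principal [:0, 1:]" unfolding Theta by simp
    then have "pCons 0 ?e \<in> ?I" using ess mem' by blast
    then have eP: "?e \<in> ?P" unfolding IP .
    note Pl = left_ideal_principal[of "[:?r:]"]
    \<comment> \<open>The cofactor f + (\<theta> - H) h lies in S (x - a). If h does too, then so
      does f. Otherwise a reduced representative k of h would raise its own leading coefficient by
      one degree, where it would have to be divisible by x - a.\<close>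
    have "?r dvd f"
    proof (cases "h \<in> ?P")
      case True
      have "T h - smult ?H h \<in> ?P" using left_idealD(7)[OF Pl left_idealD(5)[OF Pl True] left_idealD(4)[OF Pl True]] .
      then have "?e - (T h - smult ?H h) \<in> ?P" using left_idealD(7)[OF Pl eP] by blast
      then have "[:f:] \<in> ?P" by simp
      then show ?thesis using lead_principal_const[of "[:f:]" ?r] by simp
    next
      case False
      then obtain k where k: "h - k \<in> ?P" "\<not> ?r dvd lead_coeff k"
        using reduce_principal_const[OF False] by (auto simp: sn)
      have k0: "k \<noteq> 0" using k(2) by auto
      let ?m = "[:f:] + T k - smult ?H k"
      have "?e - ?m = T (h - k) - smult ?H (h - k)"
        using T_add[of "h - k" k] by (simp add: smult_diff_right)
      then have "?e - ?m \<in> ?P" using left_idealD(7)[OF Pl left_idealD(5)[OF Pl k(1)] left_idealD(4)[OF Pl k(1)]] by metis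
      then have mP: "?m \<in> ?P" using left_ideal_eqD[OF Pl] eP by blast
      have cm: "coeff ?m i = coeff (T k) i" if "i \<ge> Suc (degree k)" for i
        using that by (cases i) (auto simp: coeff_eq_0)
      have "coeff ?m (Suc (degree k)) = lead_coeff k"
        using cm[of "Suc (degree k)"] lead_coeff_T[OF k0] degree_T[OF k0] sid by simp
      moreover have "degree ?m = Suc (degree k)"
      proof (rule antisym)
        show "degree ?m \<le> Suc (degree k)"
          using cm degree_T[OF k0] by (intro degree_le) (simp add: coeff_eq_0)
        show "Suc (degree k) \<le> degree ?m"
          using \<open>coeff ?m (Suc (degree k)) = lead_coeff k\<close> k0 by (intro le_degree) simp
      qed
      ultimately show ?thesis using lead_principal_const[OF mP] k(2) by (simp add: sn)
    qed
    then have fa: "poly f a = 0" by (simp add: linear_dvd_iff)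
    then have df: "degree f > 0" using f0 by (metis degree_eq_zeroE gr0I pCons_0_0 poly_pCons mult_zero_right add_0_right poly_0)
    have f': "pderiv f \<noteq> 0" using df by (simp add: pderiv_eq_0_iff)
    have "f dvd p * pderiv f" using fdvd by (simp add: dd mod_eq_0_iff_dvd)
    \<comment> \<open>Since f divides p f' and p(a) is nonzero, f vanishes at a to at most the order
      of f'. In characteristic zero its order is one more.\<close>
    then have "Polynomial.order a f \<le> Polynomial.order a (p * pderiv f)"
      using p0 f' by (intro dvd_imp_order_le) simp_all
    also have "\<dots> = Polynomial.order a p + Polynomial.order a (pderiv f)" using p0 f' by (intro order_mult) simp
    also have "Polynomial.order a p = 0" using a by (simp add: order_root)
    finally have "Polynomial.order a f \<le> Polynomial.order a (pderiv f)" by simp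
    moreover have "Polynomial.order a f = Suc (Polynomial.order a (pderiv f))"
      using f' fa f0 by (intro order_pderiv) (simp_all add: order_root)
    ultimately show False by simp
  qed simp
  moreover have "\<not> dcc_above S ?I"
  proof
    assume dcc: "dcc_above S ?I"
    \<comment> \<open>The preimage of p^k K[x] under the map to S / S \<theta>, which takes constant
      terms.\<close>
    define J where "J k = {u. p ^ k dvd coeff u 0}" for k
    have "left_ideal (J k) S" for k
    proof (rule left_idealI)
      fix u assume "u \<in> J k"
      then obtain v where v: "coeff u 0 = p ^ k * v" by (auto simp: J_def dvd_def)
      have "p * pderiv (p ^ k) = smult (of_nat k) (p ^ k * pderiv p)"
      proof (cases k)
        case (Suc m)
        show ?thesis unfolding Suc pderiv_power_Suc by (simp add: mult.assoc del: of_nat_Suc)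
      qed simp
      then have "p * pderiv (p ^ k * v) = p ^ k * (p * pderiv v + smult (of_nat k) (v * pderiv p))"
        unfolding pderiv_mult distrib_left by (metis (no_types, lifting) mult.assoc mult.left_commute mult_smult_right)
      then show "T u \<in> J k" by (simp add: J_def coeff_T dd v)
    qed (auto simp: J_def)
    moreover have "?I \<subseteq> J k" for k
    proof -
      have "s \<star> ([:?r:] \<star> [:0, 1:]) = pCons 0 (s \<star> [:?r:])" for s
        unfolding R.mult.assoc[symmetric] unfolding mul_theta ..
      then show ?thesis by (auto simp: principal_def J_def)
    qed
    moreover have "J (Suc k) \<subseteq> J k" for k
      unfolding J_def by (auto elim: dvd_trans[rotated])
    ultimately obtain n where n: "J (Suc n) = J n"
      using dcc unfolding dcc_above_def by (metis le_Suc_eq order_refl)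
    have "[:p ^ n:] \<in> J n" by (simp add: J_def)
    then have "[:p ^ n:] \<in> J (Suc n)" using n by blast
    then have "p ^ Suc n dvd coeff [:p ^ n:] 0" unfolding J_def by blast
    then have "p ^ Suc n dvd p ^ n" by (simp only: coeff_pCons_0)
    then have "degree (p ^ Suc n) \<le> degree (p ^ n)" using p0 by (intro dvd_imp_degree_le) simp_all
    then show False using p p0 by (simp add: degree_mult_eq)
  qed
  ultimately show ?thesis by blast
qed


text \<open>The module is an extension of \<open>S / S r\<close> by \<open>S / S g\<close>.  The eigenvectors \<open>z\<^sup>k\<close> of \<open>x\<close> in the former
  have pairwise different eigenvalues \<open>a\<^sub>k\<close>, whereas \<open>x - a\<^sub>k\<close> is not surjective on the latter.\<close>

lemma eigenvector_no_dcc: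
  fixes r l :: "'k poly" and a c :: "nat \<Rightarrow> 'k" and z g :: "'k poly poly"
  assumes z: "\<And>f. z \<star> [:f:] = smult (\<sigma> f) z" "degree z = 1" "\<And>s. \<exists>s'. s \<star> z = z \<star> s'"
    and g: "degree g = 1" "z - [:[:m:]:] \<in> principal g" "m \<noteq> 0" "\<And>i. (\<sigma> ^^ i) (lead_coeff g) dvd l"
    and gmax: "proper_maximal (principal g)"
    and a: "\<And>k. (\<sigma> ^^ k) r = smult (c k) [:- a k, 1:]" "\<And>k. c k \<noteq> 0" "inj a"
    and la: "\<And>k. poly l (a k) \<noteq> 0" and za: "\<And>k. poly (lead_coeff (z \<up> k)) (a k) \<noteq> 0"
  shows "\<exists>I. monolithic S I \<and> \<not> dcc_above S I"
proof -
  let ?P = "principal [:r:]"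
  let ?I = "principal (g \<star> [:r:])"
  note Pl = left_ideal_principal[of "[:r:]"]
  have z0: "z \<noteq> 0" and g0: "g \<noteq> 0" using z(2) g(1) by auto
  have r0: "r \<noteq> 0" using a(1)[of 0] a(2)[of 0] by auto
  have dvd: "(\<sigma> ^^ k) r dvd f \<longleftrightarrow> poly f (a k) = 0" for k f
    unfolding a(1) smult_dvd_iff poly_eq_0_iff_dvd using a(2) by simp
  have zr: "(z \<up> k) \<star> [:f:] = smult ((\<sigma> ^^ k) f) (z \<up> k)" for k f
  proof (induction k)
    case (Suc k)
    have "(z \<up> Suc k) \<star> [:f:] = z \<star> ([:(\<sigma> ^^ k) f:] \<star> (z \<up> k))"
      using Suc by (simp add: R.mult.assoc)
    also have "\<dots> = smult (\<sigma> ((\<sigma> ^^ k) f)) (z \<star> (z \<up> k))"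
      unfolding R.mult.assoc[symmetric] z(1) by simp
    finally show ?case by simp
  qed simp
  have dz: "z \<up> k \<noteq> 0 \<and> degree (z \<up> k) = k" for k
  proof (induction k)
    case (Suc k)
    then show ?case using degree_mul_lead(2)[OF z0, of "z \<up> k"] z0 z(2) by simp
  qed simp
  have znorm: "\<exists>s'. s \<star> (z \<up> k) = (z \<up> k) \<star> s'" for s k
  proof (induction k arbitrary: s)
    case (Suc k)
    obtain s' where s': "s \<star> z = z \<star> s'" using z(3) by blast
    obtain s'' where s'': "s' \<star> (z \<up> k) = (z \<up> k) \<star> s''" using Suc by blast
    have "s \<star> (z \<up> Suc k) = (s \<star> z) \<star> (z \<up> k)" by (simp add: R.mult.assoc)
    also have "\<dots> = z \<star> (s' \<star> (z \<up> k))" unfolding s' by (simp add: R.mult.assoc)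
    also have "\<dots> = (z \<up> Suc k) \<star> s''" unfolding s'' by (simp add: R.mult.assoc)
    finally show ?case by blast
  qed simp
  \<comment> \<open>\<sigma>^n(r) is a scalar times x - a_n, where the leading coefficient of z^n
    does not vanish. Modulo S r every leading coefficient in degree n can therefore be reduced to a
    scalar multiple of that of z^n.\<close>
  have split: "\<exists>t k u. s = smult [:k:] (z \<up> degree s) + t + u \<star> [:r:] \<and> (degree t < degree s \<or> t = 0)" for s
  proof -
    let ?n = "degree s"
    define k where "k = poly (lead_coeff s) (a ?n) / poly (lead_coeff (z \<up> ?n)) (a ?n)"
    have "(\<sigma> ^^ ?n) r dvd lead_coeff s - smult k (lead_coeff (z \<up> ?n))"
      unfolding dvd using za[of ?n] by (simp add: k_def)
    then obtain e where e: "lead_coeff s - smult k (lead_coeff (z \<up> ?n)) = (\<sigma> ^^ ?n) r * e" by (rule dvdE)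
    have rr0: "[:r:] \<noteq> 0" using r0 by simp
    define u where "u = monom e ?n"
    define t where "t = s - smult [:k:] (z \<up> ?n) - u \<star> [:r:]"
    have cu: "coeff (u \<star> [:r:]) ?n = e * (\<sigma> ^^ ?n) r" "i > ?n \<Longrightarrow> coeff (u \<star> [:r:]) i = 0" for i
      using Tpow(2,3)[OF rr0, of ?n] by (simp_all add: u_def monom_mul coeff_eq_0)
    have ct: "coeff t i = 0" if "i \<ge> ?n" for i
    proof (cases "i = ?n")
      case True
      then show ?thesis using e cu(1) dz[of ?n] by (simp add: t_def algebra_simps)
    next
      case False
      then have "i > ?n" using that by simp
      then show ?thesis using cu(2)[of i] dz[of ?n] by (simp add: t_def coeff_eq_0)
    qed
    have "degree t < ?n \<or> t = 0"
    proof (cases "?n = 0")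
      case True
      then show ?thesis using ct by (intro disjI2 poly_eqI) simp
    next
      case False
      then have "degree t < ?n" using ct by (intro degree_lessI) auto
      then show ?thesis ..
    qed
    moreover have "s = smult [:k:] (z \<up> ?n) + t + u \<star> [:r:]" by (simp add: t_def)
    ultimately show ?thesis by blast
  qed
  have one: "z \<star> [:[:k:]:] = smult [:k:] z" for k by (simp add: z(1))
  have zm: "(z \<up> k) - [:[:m ^ k:]:] \<in> principal g" for k
  proof (induction k)
    case 0
    have "(z \<up> 0) - [:[:m ^ 0:]:] = 0" by (simp add: one_pCons[symmetric])
    then show ?case using left_idealD(1)[OF left_ideal_principal] by simp
  next
    case (Suc k)
    have "(z \<up> Suc k) - [:[:m ^ Suc k:]:] = z \<star> ((z \<up> k) - [:[:m ^ k:]:]) + smult [:m ^ k:] (z - [:[:m:]:])"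
      by (simp add: R.right_diff_distrib one smult_diff_right mult.commute)
    then show ?case
      using left_idealD(2)[OF left_ideal_principal left_idealD(3)[OF left_ideal_principal Suc] left_idealD(4)[OF left_ideal_principal g(2)]]
      by metis
  qed
  have "monolithic S ?I"
  proof (rule monolithic_product[OF gmax])
    fix J assume J: "left_ideal J S" "?I \<subset> J" and ess: "J \<inter> ?P \<subseteq> ?I"
    \<comment> \<open>A = J + S r, which stands for the image of J in S / S r.\<close>
    define A where "A = {s. \<exists>h. s + h \<star> [:r:] \<in> J}"
    have AD: "s \<in> A \<Longrightarrow> t \<in> A \<Longrightarrow> s + t \<in> A" "s \<in> A \<Longrightarrow> u \<star> s \<in> A" for s t u
    proof -
      assume "s \<in> A"
      then obtain h where h: "s + h \<star> [:r:] \<in> J" by (auto simp: A_def)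
      { assume "t \<in> A"
        then obtain h' where h': "t + h' \<star> [:r:] \<in> J" by (auto simp: A_def)
        have "(s + t) + (h + h') \<star> [:r:] = (s + h \<star> [:r:]) + (t + h' \<star> [:r:])" by (simp add: R.distrib_right)
        then have "(s + t) + (h + h') \<star> [:r:] \<in> J" using left_idealD(2)[OF J(1) h h'] by metis
        then show "s + t \<in> A" unfolding A_def by blast }
      have "u \<star> s + (u \<star> h) \<star> [:r:] = u \<star> (s + h \<star> [:r:])" by (simp add: R.distrib_left R.mult.assoc)
      then have "u \<star> s + (u \<star> h) \<star> [:r:] \<in> J" using left_idealD(3)[OF J(1) h] by metis
      then show "u \<star> s \<in> A" unfolding A_def by blast
    qed
    have PA: "t \<star> [:r:] \<in> A" for t
    proof -
      have "t \<star> [:r:] + (- t) \<star> [:r:] \<in> J" using left_idealD(1)[OF J(1)] by (simp add: R.distrib_right[symmetric])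
      then show ?thesis unfolding A_def by blast
    qed
    have JA: "J \<subseteq> A"
    proof
      fix s assume "s \<in> J"
      then have "s + 0 \<star> [:r:] \<in> J" by simp
      then show "s \<in> A" unfolding A_def by blast
    qed
    obtain s0 where "s0 \<in> J" "s0 \<notin> ?I" using J(2) by blast
    then have "s0 \<in> A \<and> s0 \<notin> ?P" using ess JA by blast
    then obtain s where s: "s \<in> A" "s \<notin> ?P" and min: "\<And>u. u \<in> A \<and> u \<notin> ?P \<Longrightarrow> degree s \<le> degree u"
      using ex_has_least_nat[of "\<lambda>u. u \<in> A \<and> u \<notin> ?P" s0 degree] by blast
    define n where "n = degree s"
    obtain t k u where tku: "s = smult [:k:] (z \<up> n) + t + u \<star> [:r:]" "degree t < n \<or> t = 0"
      using split[of s] unfolding n_def by blast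
    have st: "smult [:k:] (z \<up> n) + t = s + (- u) \<star> [:r:]" by (simp add: tku(1))
    have kA: "smult [:k:] (z \<up> n) + t \<in> A" unfolding st by (rule AD(1)[OF s(1) PA])
    have kP: "smult [:k:] (z \<up> n) + t \<notin> ?P"
    proof
      assume "smult [:k:] (z \<up> n) + t \<in> ?P"
      from left_idealD(2)[OF Pl this mem_principal[of u "[:r:]"]] show False using s(2) tku(1) by simp
    qed
    have k0: "k \<noteq> 0"
    proof
      assume "k = 0"
      then have "t \<in> A" "t \<notin> ?P" using kA kP by simp_all
      moreover from this have "t \<noteq> 0" using left_idealD(1)[OF Pl] by auto
      ultimately show False using min[of t] tku(2) n_def by auto
    qed
    let ?x = "[:- a n, 1:]"
    \<comment> \<open>z^n is an eigenvector of x modulo S r, because z^n r = \<sigma>^n(r)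
      z^n.\<close>
    have xz: "smult ?x (z \<up> n) = smult [:inverse (c n):] (z \<up> n) \<star> [:r:]"
      using a(1)[of n] a(2)[of n] by (simp add: zr field_simps)
    \<comment> \<open>Multiplication by x - a_n kills k z^n, so (x - a_n) t lies in A and, by
      minimality of n, in S r. As the a_i are distinct, x - a_n is injective on classes of degree
      below n, so t itself lies in S r.\<close>
    have tP: "t \<in> ?P"
    proof (rule ccontr)
      assume nt: "t \<notin> ?P"
      then have tn: "degree t < n" using tku(2) left_idealD(1)[OF Pl] by auto
      have "[:?x:] \<star> (smult [:k:] (z \<up> n) + t) \<in> A" by (rule AD(2)[OF kA])
      moreover have "smult t' (smult [:k:] (z \<up> n)) = smult [:k:] (smult t' (z \<up> n))" for t' by (simp add: mult.commute)
      ultimately have "smult [:k:] (smult ?x (z \<up> n)) + smult ?x t \<in> A" by (simp only: const_mul smult_add_right)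
      moreover have "smult ?x t = (smult [:k:] (smult ?x (z \<up> n)) + smult ?x t) + (- smult [:k:] (smult [:inverse (c n):] (z \<up> n))) \<star> [:r:]"
        unfolding xz by simp
      ultimately have xtA: "smult ?x t \<in> A" using AD(1)[OF _ PA] by metis
      have xtP: "smult ?x t \<in> ?P"
      proof (rule ccontr)
        assume "smult ?x t \<notin> ?P"
        then have "n \<le> degree (smult ?x t)" using min[of "smult ?x t"] xtA n_def by simp
        then show False using tn degree_smult_le[of ?x t] by simp
      qed
      obtain t' where t': "t - t' \<in> ?P" "degree t' \<le> degree t" "\<not> (\<sigma> ^^ degree t') r dvd lead_coeff t'"
        using reduce_principal_const[OF nt] by blast
      have "smult ?x t - smult ?x t' \<in> ?P" using left_idealD(4)[OF Pl t'(1), of ?x] by (simp add: smult_diff_right)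
      then have "smult ?x t' \<in> ?P" using left_ideal_eqD[OF Pl] xtP by blast
      then have "(\<sigma> ^^ degree (smult ?x t')) r dvd lead_coeff (smult ?x t')" by (rule lead_principal_const)
      moreover have "degree (smult ?x t') = degree t'" by (simp add: degree_smult_eq)
      ultimately have "poly (?x * lead_coeff t') (a (degree t')) = 0" unfolding dvd by (simp add: lead_coeff_smult)
      moreover have "a (degree t') \<noteq> a n" using a(3) t'(2) tn by (auto dest: injD)
      moreover have "poly (lead_coeff t') (a (degree t')) \<noteq> 0" using t'(3) unfolding dvd .
      ultimately show False by simp
    qed
    then obtain v where v: "t = v \<star> [:r:]" by (auto simp: principal_def)
    obtain h0 where h0: "smult [:k:] (z \<up> n) + t + h0 \<star> [:r:] \<in> J" using kA unfolding A_def by blast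
    define h where "h = v + h0"
    have hJ: "smult [:k:] (z \<up> n) + h \<star> [:r:] \<in> J" using h0 by (simp add: v h_def R.distrib_right add.assoc)
    \<comment> \<open>(x - a_n)(k z^n + h r) = e r belongs to J and to S r, hence to S g r, so e
      lies in S g. Modulo S g, where z^n is congruent to m^n, this makes a nonzero constant
      divisible by x - a_n.\<close>
    define e where "e = smult [:k * inverse (c n):] (z \<up> n) + smult ?x h"
    have "e \<star> [:r:] = smult [:k:] (smult [:inverse (c n):] (z \<up> n) \<star> [:r:]) + smult ?x (h \<star> [:r:])"
      by (simp add: e_def R.distrib_right mult.commute)
    also have "\<dots> = smult ?x (smult [:k:] (z \<up> n) + h \<star> [:r:])"
      unfolding xz[symmetric] by (simp add: smult_add_right mult.commute)
    finally have "e \<star> [:r:] \<in> J" using left_idealD(4)[OF J(1) hJ] by metis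
    then have "e \<star> [:r:] \<in> ?I" using ess mem_principal by blast
    then obtain w where "e \<star> [:r:] = (w \<star> g) \<star> [:r:]" by (auto simp: principal_def R.mult.assoc)
    then have "e = w \<star> g" using r0 mul_cancel_right by (metis pCons_eq_0_iff)
    then have eg: "e \<in> principal g" using mem_principal by metis
    note Gl = left_ideal_principal[of g]
    obtain j y where y: "degree y < degree g" "smult (l ^ j) h - y \<in> principal g"
      using pseudo_division[OF Gl mem_principal_self, of l h] g(1,4) by auto
    obtain f where f: "y = [:f:]" using y(1) g(1) by (metis degree_eq_zeroE less_one)
    let ?k = "k * inverse (c n)"
    \<comment> \<open>Multiplication by l^j turns h into a polynomial f in x. The resulting element
      of S g has degree 0 in \<theta>, so it is zero, and evaluation at a_n contradicts the fact
      that l does not vanish there.\<close>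
    have "smult (l ^ j) e - smult (l ^ j) (smult [:?k:] ((z \<up> n) - [:[:m ^ n:]:])) - smult ?x (smult (l ^ j) h - y)
        = [:l ^ j * [:?k * m ^ n:] + ?x * f:]"
      by (simp add: e_def f smult_add_right smult_diff_right mult.commute)
    moreover have "smult (l ^ j) e - smult (l ^ j) (smult [:?k:] ((z \<up> n) - [:[:m ^ n:]:])) - smult ?x (smult (l ^ j) h - y) \<in> principal g"
      by (rule left_idealD(7)[OF Gl left_idealD(7)[OF Gl left_idealD(4)[OF Gl eg]
            left_idealD(4)[OF Gl left_idealD(4)[OF Gl zm]]] left_idealD(4)[OF Gl y(2)]])
    ultimately have cg: "[:l ^ j * [:?k * m ^ n:] + ?x * f:] \<in> principal g" by simp
    have "l ^ j * [:?k * m ^ n:] + ?x * f = 0"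
    proof (rule ccontr)
      assume nz: "\<not> ?thesis"
      obtain w where w: "[:l ^ j * [:?k * m ^ n:] + ?x * f:] = w \<star> g" using cg by (auto simp: principal_def)
      then have "w \<noteq> 0" using nz by auto
      then have "degree (w \<star> g) \<ge> 1" using degree_mul_lead(2)[of w g] g0 g(1) by simp
      then show False unfolding w[symmetric] by simp
    qed
    then have "poly (l ^ j * [:?k * m ^ n:] + ?x * f) (a n) = 0" by simp
    then show False using la[of n] k0 a(2)[of n] g(3) by (simp add: poly_power)
  qed (use r0 in simp)
  moreover have "\<not> dcc_above S ?I"
  proof
    assume dcc: "dcc_above S ?I"
    define J where "J k = {s \<star> (z \<up> k) + t \<star> [:r:] | s t. True}" for k
    have "left_ideal (J k) S" for k unfolding left_ideal_iff
    proof (intro conjI ballI allI)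
      show "0 \<in> J k" unfolding J_def by (auto intro!: exI[of _ 0])
      fix u v assume "u \<in> J k" "v \<in> J k"
      then obtain s t s' t' where h: "u = s \<star> (z \<up> k) + t \<star> [:r:]" "v = s' \<star> (z \<up> k) + t' \<star> [:r:]" unfolding J_def by blast
      have "u + v = (s + s') \<star> (z \<up> k) + (t + t') \<star> [:r:]" using h by (simp add: R.distrib_right)
      then show "u + v \<in> J k" unfolding J_def by blast
    next
      fix v u assume "u \<in> J k"
      then obtain s t where h: "u = s \<star> (z \<up> k) + t \<star> [:r:]" unfolding J_def by blast
      have "v \<star> u = (v \<star> s) \<star> (z \<up> k) + (v \<star> t) \<star> [:r:]" using h by (simp add: R.distrib_left R.mult.assoc)
      then show "v \<star> u \<in> J k" unfolding J_def by blast
    qed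
    moreover have "?I \<subseteq> J k" for k
    proof
      fix e assume "e \<in> ?I"
      then obtain s where "e = 0 \<star> (z \<up> k) + (s \<star> g) \<star> [:r:]" by (auto simp: principal_def R.mult.assoc)
      then show "e \<in> J k" unfolding J_def by blast
    qed
    moreover have "J (Suc k) \<subseteq> J k" for k
    proof
      fix e assume "e \<in> J (Suc k)"
      then obtain s t where "e = (s \<star> z) \<star> (z \<up> k) + t \<star> [:r:]" by (auto simp: J_def R.mult.assoc)
      then show "e \<in> J k" unfolding J_def by blast
    qed
    ultimately obtain n where n: "J (Suc n) = J n"
      using dcc[unfolded dcc_above_def, rule_format, of J] by (metis le_Suc_eq order_refl)
    have "z \<up> n = 1 \<star> (z \<up> n) + 0 \<star> [:r:]" by simp
    then have "z \<up> n \<in> J n" unfolding J_def by blast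
    then have "z \<up> n \<in> J (Suc n)" using n by blast
    then obtain s t where st: "z \<up> n = s \<star> (z \<up> Suc n) + t \<star> [:r:]" unfolding J_def by blast
    \<comment> \<open>With z^(n+1) on the left, s' may be replaced by a polynomial in z modulo the
      left ideal S r.\<close>
    obtain s' where s': "s \<star> (z \<up> Suc n) = (z \<up> Suc n) \<star> s'" using znorm by blast
    have span: "\<exists>p. s - ev z p \<in> ?P" for s
    proof (induction "degree s" arbitrary: s rule: less_induct)
      case less
      obtain t k u where tku: "s = smult [:k:] (z \<up> degree s) + t + u \<star> [:r:]" "degree t < degree s \<or> t = 0"
        using split by blast
      have "\<exists>p. t - ev z p \<in> ?P"
      proof (cases "t = 0")
        case True
        then show ?thesis using left_idealD(1)[OF Pl] by (intro exI[of _ 0]) simp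
      qed (use tku(2) less in blast)
      then obtain p where p: "t - ev z p \<in> ?P" by blast
      have em: "ev z (monom 1 i) = z \<up> i" for i
        by (induction i) (simp_all add: monom_Suc monom_0 one_pCons[symmetric])
      have "s - ev z (smult k (monom 1 (degree s)) + p) = s - smult [:k:] (z \<up> degree s) - ev z p"
        by (simp only: ev_add ev_smult em diff_diff_add)
      also have "\<dots> = (t - ev z p) + u \<star> [:r:]" using tku(1) by (simp add: algebra_simps)
      finally have "s - ev z (smult k (monom 1 (degree s)) + p) = (t - ev z p) + u \<star> [:r:]" .
      then show ?case using left_idealD(2)[OF Pl p mem_principal[of u]] by metis
    qed
    obtain p where p: "s' - ev z p \<in> ?P" using span by blast
    have em: "ev z (monom 1 i) = z \<up> i" for i
      by (induction i) (simp_all add: monom_Suc monom_0 one_pCons[symmetric])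
    \<comment> \<open>X^n - X^(n+1) p is nonzero, yet its value at z would lie in S r. The leading
      coefficient of that value is a scalar times that of a power z^N, which \<sigma>^N(r) does not
      divide.\<close>
    let ?Q = "monom 1 n - monom 1 (Suc n) * p"
    have "ev z ?Q + ev z (monom 1 (Suc n) * p) = z \<up> n" unfolding ev_add[symmetric] by (simp add: em)
    then have "ev z ?Q = (z \<up> n) - (z \<up> Suc n) \<star> ev z p" unfolding ev_mult em by (simp add: algebra_simps)
    also have "\<dots> = (z \<up> Suc n) \<star> (s' - ev z p) + t \<star> [:r:]"
      unfolding R.right_diff_distrib s'[symmetric] using st by (simp add: algebra_simps)
    finally have QP: "ev z ?Q \<in> ?P"
      using left_idealD(2)[OF Pl left_idealD(3)[OF Pl p] mem_principal] by metis
    have evlead: "degree (ev z Q) = degree Q \<and> lead_coeff (ev z Q) = smult (lead_coeff Q) (lead_coeff (z \<up> degree Q))"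
      if "Q \<noteq> 0" for Q
      using that
    proof (induction Q)
      case (pCons k Q)
      show ?case
      proof (cases "Q = 0")
        case False
        then have IH: "degree (ev z Q) = degree Q" "lead_coeff (ev z Q) = smult (lead_coeff Q) (lead_coeff (z \<up> degree Q))"
          using pCons.IH by auto
        have "lead_coeff (z \<up> degree Q) \<noteq> 0" using dz[of "degree Q"] leading_coeff_neq_0 by blast
        then have nz: "ev z Q \<noteq> 0" using IH(2) False by (metis leading_coeff_0_iff smult_eq_0_iff)
        have d: "degree (z \<star> ev z Q) = Suc (degree Q)" using degree_mul_lead(2)[OF z0 nz] IH(1) z(2) by simp
        have "lead_coeff (z \<star> ev z Q) = lead_coeff z * (\<sigma> ^^ degree z) (lead_coeff (ev z Q))" by (rule lead_coeff_mul[OF z0 nz])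
        also have "\<dots> = smult (lead_coeff Q) (lead_coeff z * (\<sigma> ^^ degree z) (lead_coeff (z \<up> degree Q)))"
          unfolding IH(2) by (simp add: z(2) s_smult)
        also have "\<dots> = smult (lead_coeff Q) (lead_coeff (z \<star> (z \<up> degree Q)))"
          using lead_coeff_mul[OF z0, of "z \<up> degree Q"] dz by simp
        finally have L: "lead_coeff (z \<star> ev z Q) = smult (lead_coeff Q) (lead_coeff (z \<up> Suc (degree Q)))" by simp
        have lt: "degree [:[:k:]:] < degree (z \<star> ev z Q)" unfolding d by simp
        show ?thesis using degree_add_eq_right[OF lt] lead_coeff_add_le[OF lt] d L False by simp
      qed (use pCons in simp)
    qed simp
    have Q0: "?Q \<noteq> 0"
    proof
      assume "?Q = 0"
      then have "coeff ?Q n = 0" by simp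
      moreover have "coeff (monom 1 (Suc n) * p) n = 0" by (simp add: coeff_monom_mult)
      ultimately show False by simp
    qed
    let ?N = "degree ?Q"
    have "(\<sigma> ^^ degree (ev z ?Q)) r dvd lead_coeff (ev z ?Q)" by (rule lead_principal_const[OF QP])
    then have "(\<sigma> ^^ ?N) r dvd smult (lead_coeff ?Q) (lead_coeff (z \<up> ?N))" using evlead[OF Q0] by metis
    then have "lead_coeff ?Q * poly (lead_coeff (z \<up> ?N)) (a ?N) = 0" unfolding dvd by simp
    then show False using za[of ?N] Q0 leading_coeff_neq_0 by (metis mult_eq_0_iff)
  qed
  ultimately show ?thesis by blast
qed


section \<open>Normal elements and the case where \<sigma> is a translation\<close>

lemma principal_degree: "u \<in> principal g \<Longrightarrow> u \<noteq> 0 \<Longrightarrow> degree g \<le> degree u"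
  using degree_mul_lead(2) by (fastforce simp: principal_def)

lemma linear_mul_const: "[:h, 1:] \<star> [:f:] = [:d f + h * f, \<sigma> f:]"
proof -
  have "[:h, 1:] = [:0, 1:] + [:h:]" by simp
  then have "[:h, 1:] \<star> [:f:] = [:0, 1:] \<star> [:f:] + [:h:] \<star> [:f:]" by (metis R.distrib_right)
  then show ?thesis by (simp add: T_pCons)
qed

lemma s_surj: "\<exists>f'. f = \<sigma> f'"
  using aut by (simp add: ring_automorphism_def bij_def surj_def)

text \<open>S is generated by K[x] and \<theta> + h. Each polynomial moves past z, as f z = z
  \<sigma>^(-1)(f), and \<theta> + h does so by hypothesis.\<close>

lemma normal_element:
  assumes z: "\<And>f. z \<star> [:f:] = smult (\<sigma> f) z" and t: "[:h, 1:] \<star> z = z \<star> t'"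
  shows "\<exists>s'. s \<star> z = z \<star> s'"
proof (induction s rule: ore_induct)
  case one
  show ?case by (intro exI[of _ 1]) simp
next
  case (add s t)
  then show ?case by (metis R.distrib_left R.distrib_right)
next
  case (smult f s)
  then obtain s' where s': "s \<star> z = z \<star> s'" by blast
  obtain f' where f': "f = \<sigma> f'" using s_surj by blast
  have "smult f s \<star> z = smult f z \<star> s'" using s' by simp
  also have "\<dots> = z \<star> ([:f':] \<star> s')" unfolding f' z[symmetric] by (rule R.mult.assoc)
  finally show ?case by blast
next
  case (T s)
  then obtain s' where s': "s \<star> z = z \<star> s'" by blast
  obtain f' where f': "h = \<sigma> f'" using s_surj by blast
  have th: "[:0, 1:] = [:h, 1:] - [:h:]" by simp
  have "T s \<star> z = [:0, 1:] \<star> (z \<star> s')" using s' by (simp add: T_mul)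
  also have "\<dots> = ([:h, 1:] \<star> z) \<star> s' - smult h z \<star> s'" by (simp only: th R.left_diff_distrib R.mult.assoc const_mul smult_mul)
  also have "smult h z = z \<star> [:f':]" by (simp add: z f')
  also have "([:h, 1:] \<star> z) \<star> s' - (z \<star> [:f':]) \<star> s' = z \<star> (t' \<star> s' - [:f':] \<star> s')"
    unfolding t by (simp only: R.mult.assoc R.right_diff_distrib)
  finally show ?case by blast
qed

text \<open>With f also z f = \<sigma>(f) z lies in J, and modulo J it is congruent to m
  \<sigma>(f).\<close>

lemma shift_const_mem:
  assumes z: "\<And>f. z \<star> [:f:] = smult (\<sigma> f) z" and J: "left_ideal J S" "z - [:[:m:]:] \<in> J" "m \<noteq> 0" "[:f:] \<in> J"
  shows "[:\<sigma> f:] \<in> J"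
proof -
  have "z \<star> [:f:] - smult (\<sigma> f) (z - [:[:m:]:]) \<in> J"
    using left_idealD(7)[OF J(1) left_idealD(3)[OF J(1,4)] left_idealD(4)[OF J(1,2)]] .
  moreover have "z \<star> [:f:] - smult (\<sigma> f) (z - [:[:m:]:]) = [:smult m (\<sigma> f):]"
    by (simp add: z smult_diff_right)
  ultimately have "[:smult m (\<sigma> f):] \<in> J" by simp
  from left_idealD(4)[OF J(1) this, of "[:inverse m:]"] J(3) show ?thesis by simp
qed

text \<open>An invariant polynomial takes the same value at all n b, which are infinitely many
  points in characteristic zero.\<close>

lemma shift_invariant_const:
  assumes q: "q = 1" "b \<noteq> 0" and f: "\<sigma> f = f" shows "degree f = 0"
proof -
  have step: "poly f (v + b) = poly f v" for v
  proof -
    have "poly (\<sigma> f) v = poly f (b + v)" using q by (simp add: s_pcompose poly_pcompose)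
    then show ?thesis using f by (simp add: add.commute)
  qed
  have "poly f (of_nat n * b) = poly f 0" for n
  proof (induction n)
    case (Suc n)
    then show ?case using step[of "of_nat n * b"] by (simp add: algebra_simps)
  qed simp
  then have "range (\<lambda>n. of_nat n * b) \<subseteq> {v. poly (f - [:poly f 0:]) v = 0}" by auto
  moreover have "infinite (range (\<lambda>n. of_nat n * b))"
    by (rule range_inj_infinite) (use q in \<open>auto simp: inj_def\<close>)
  ultimately have "f - [:poly f 0:] = 0" using poly_roots_finite finite_subset by blast
  then have "f = [:poly f 0:]" by simp
  then show ?thesis by (metis degree_pCons_0)
qed

text \<open>Applying d to x f = f x in both orders leaves b d(f) = (\<sigma>(f) - f) d(x). So d is
  inner, and \<theta> can be shifted to an element z with z f = \<sigma>(f) z.\<close>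

lemma shift_derivation:
  assumes q: "q = 1" "b \<noteq> 0"
  shows "d f = (\<sigma> f - f) * smult (inverse b) (d [:0, 1:])"
proof -
  have "d ([:0, 1:] * f) = d (f * [:0, 1:])" by (simp only: mult.commute)
  then have "[:b, q:] * d f + d [:0, 1:] * f = \<sigma> f * d [:0, 1:] + d f * [:0, 1:]"
    by (simp only: d_mult sx)
  then have "smult b (d f) = (\<sigma> f - f) * d [:0, 1:]" using q(1) by (simp add: algebra_simps)
  then have "smult (inverse b) (smult b (d f)) = (\<sigma> f - f) * smult (inverse b) (d [:0, 1:])" by simp
  then show ?thesis using q(2) by simp
qed

text \<open>Here z = \<theta> + d(x)/b, g = z - 1 and r = x; the eigenvalues -k b come from
  \<sigma>^k(x) = x + k b. S / S g is K[x] with z acting as \<sigma>. It is simple because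
  \<sigma>(f) - f has smaller degree than f and vanishes only for constants.\<close>

lemma shift_no_dcc:
  assumes q: "q = 1" "b \<noteq> 0"
  shows "\<exists>I. monolithic S I \<and> \<not> dcc_above S I"
proof -
  define e where "e = smult (inverse b) (d [:0, 1:])"
  have de: "d f = (\<sigma> f - f) * e" for f unfolding e_def by (rule shift_derivation[OF q])
  define z :: "'k poly poly" where "z = [:e, 1:]"
  define g :: "'k poly poly" where "g = [:e - 1, 1:]"
  have z: "z \<star> [:f:] = smult (\<sigma> f) z" for f
    unfolding z_def linear_mul_const by (simp add: de algebra_simps)
  have dz: "degree z = 1" "lead_coeff z = 1" and dg: "degree g = 1" "lead_coeff g = 1" by (simp_all add: z_def g_def)
  have zg: "z - [:[:1:]:] = g" by (simp add: z_def g_def one_pCons)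
  have one: "(\<sigma> ^^ i) 1 = 1" for i using spow_const[of i 1] by (simp add: one_pCons)
  show ?thesis
  proof (rule eigenvector_no_dcc[where z = z and g = g and m = 1 and l = 1 and r = "[:0, 1:]" and c = "\<lambda>_. 1"
        and a = "\<lambda>k. - (of_nat k * b)"])
    show "z \<star> [:f:] = smult (\<sigma> f) z" for f by (rule z)
    show "degree z = 1" "degree g = 1" by fact+
    show "\<exists>s'. s \<star> z = z \<star> s'" for s by (rule normal_element[OF z, of e z]) (simp add: z_def)
    show "z - [:[:1:]:] \<in> principal g" unfolding zg by (rule mem_principal_self)
    show "(\<sigma> ^^ i) (lead_coeff g) dvd 1" for i unfolding dg(2) one by simp
    show "(\<sigma> ^^ k) [:0, 1:] = smult 1 [:- (- (of_nat k * b)), 1:]" for k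
      by (induction k) (simp_all add: s_pcompose pcompose_pCons q algebra_simps)
    show "inj (\<lambda>k. - (of_nat k * b))" using q by (auto simp: inj_def)
    show "poly (lead_coeff (z \<up> k)) (- (of_nat k * b)) \<noteq> 0" for k
    proof -
      have "z \<up> k \<noteq> 0 \<and> lead_coeff (z \<up> k) = 1"
      proof (induction k)
        case (Suc k)
        have "lead_coeff (z \<star> (z \<up> k)) = lead_coeff z * (\<sigma> ^^ degree z) (lead_coeff (z \<up> k))"
          by (rule lead_coeff_mul) (use Suc dz in auto)
        then have "lead_coeff (z \<up> Suc k) = 1" using Suc dz one by simp
        then show ?case by (metis leading_coeff_0_iff one_neq_zero)
      qed simp
      then show ?thesis by simp
    qed
    show "proper_maximal (principal g)" unfolding proper_maximal_def
    proof (intro conjI allI impI left_ideal_principal)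
      show "1 \<notin> principal g" using principal_degree[of 1 g] dg by auto
      fix J assume "left_ideal J S \<and> principal g \<subset> J"
      then have J: "left_ideal J S" "principal g \<subset> J" by auto
      then obtain s where s: "s \<in> J" "s \<notin> principal g" by blast
      obtain j y where y: "degree y < degree g" "smult (1 ^ j) s - y \<in> principal g"
        using pseudo_division[OF left_ideal_principal[of g] mem_principal_self, of 1 s] dg one by auto
      obtain f0 where f0: "y = [:f0:]" using y(1) dg(1) by (metis degree_eq_zeroE less_one)
      have "s - y \<in> J" using y(2) J(2) by auto
      then have "[:f0:] \<in> J" using left_ideal_eqD[OF J(1)] s(1) f0 by blast
      moreover have "f0 \<noteq> 0" using y(2) s(2) f0 by auto
      ultimately have "[:f0:] \<in> J \<and> f0 \<noteq> 0" by simp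
      then obtain f where f: "[:f:] \<in> J" "f \<noteq> 0" and min: "\<And>h. [:h:] \<in> J \<and> h \<noteq> 0 \<Longrightarrow> degree f \<le> degree h"
        using ex_has_least_nat[of "\<lambda>f. [:f:] \<in> J \<and> f \<noteq> 0" f0 degree] by blast
      have gJ: "z - [:[:1:]:] \<in> J" unfolding zg using J(2) mem_principal_self by blast
      have "[:\<sigma> f:] \<in> J" by (rule shift_const_mem[OF z J(1) gJ _ f(1)]) simp
      then have mem: "[:\<sigma> f - f:] \<in> J" using left_idealD(7)[OF J(1) _ f(1)] by fastforce
      have "degree f = 0"
      proof (rule ccontr)
        assume pos: "degree f \<noteq> 0"
        then have ne: "\<sigma> f - f \<noteq> 0" using shift_invariant_const[OF q, of f] by auto
        have "degree (\<sigma> f - f) < degree f"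
        proof (rule degree_lessI)
          show "\<forall>k\<ge>degree f. coeff (\<sigma> f - f) k = 0"
          proof (intro allI impI)
            fix k assume "degree f \<le> k"
            then show "coeff (\<sigma> f - f) k = 0"
              using lead_coeff_s[of f] q(1) by (cases "k = degree f") (auto simp: coeff_eq_0)
          qed
        qed (use pos in simp)
        then show False using min[of "\<sigma> f - f"] mem ne by simp
      qed
      then obtain k where k: "f = [:k:]" by (metis degree_eq_zeroE)
      from left_idealD(4)[OF J(1) f(1), of "[:inverse k:]"] f(2) show "1 \<in> J" by (simp add: k one_pCons)
    qed
  qed simp_all
qed

end

text \<open>For \<open>q \<noteq> 1\<close> the substitution \<open>y = x + b/(q-1)\<close>, \<open>t = \<theta> - h\<close> leads to the relation \<open>t y = q y t + c\<close>;
  the element \<open>z = t y - y t\<close> is then normal.\<close>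

locale normalized_ore = ore \<sigma> d q b for \<sigma> d :: "'k::field_char_0 poly \<Rightarrow> 'k poly" and q b :: 'k +
  fixes y h :: "'k poly" and c :: 'k
  assumes y: "lead_coeff y = 1" "degree y = 1" and sy: "\<sigma> y = smult q y"
    and dy: "d y = smult (1 - q) (h * y) + [:c:]"
begin

definition t :: "'k poly poly" where "t = [:- h, 1:]"
definition \<delta> :: "'k poly \<Rightarrow> 'k poly" where "\<delta> f = d f - h * f + h * \<sigma> f"
definition z :: "'k poly poly" where "z = smult (smult (q - 1) y) t + [:[:c:]:]"

lemma t_const: "t \<star> [:f:] = smult (\<sigma> f) t + [:\<delta> f:]"
  unfolding t_def linear_mul_const by (simp add: \<delta>_def algebra_simps)

lemma ty: "t \<star> [:y:] = smult (smult q y) t + [:[:c:]:]"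
  unfolding t_const sy by (simp add: \<delta>_def dy sy algebra_simps smult_diff_left)

lemma y_nonzero [simp]: "y \<noteq> 0" using y by auto

text \<open>K[x] = K[y], since y is monic of degree one.\<close>

lemma y_induct [case_names zero step]:
  assumes "P 0" "\<And>k f. P f \<Longrightarrow> P ([:k:] + y * f)" shows "P f"
proof -
  have y_eq: "y = [:coeff y 0, 1:]"
  proof (rule poly_eqI)
    fix i show "coeff y i = coeff [:coeff y 0, 1:] i"
      using y by (cases i; cases "i - 1") (auto simp: coeff_eq_0)
  qed
  define \<beta> where "\<beta> = coeff y 0"
  have \<beta>: "y = [:\<beta>, 1:]" using y_eq unfolding \<beta>_def .
  have "P (pcompose f y)" for f
    by (induction f) (simp_all add: assms pcompose_pCons)
  from this[of "pcompose f [:- \<beta>, 1:]"] have "P (pcompose f (pcompose [:- \<beta>, 1:] y))"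
    by (simp only: pcompose_assoc)
  moreover have "pcompose [:- \<beta>, 1:] y = [:0, 1:]" by (simp add: \<beta> pcompose_pCons)
  ultimately show ?thesis by simp
qed

lemma zy: "z \<star> [:y:] = smult (smult q y) z"
proof -
  have "z \<star> [:y:] = smult (smult (q - 1) y) (smult (smult q y) t + [:[:c:]:]) + [:smult c y:]"
    by (simp add: z_def R.distrib_right ty)
  also have "\<dots> = smult (smult q y) z"
    by (simp add: z_def smult_add_right smult_diff_right algebra_simps smult_diff_left)
  finally show ?thesis .
qed

lemma z_const: "z \<star> [:f:] = smult (\<sigma> f) z"
proof (induction f rule: y_induct)
  case (step k f)
  have e: "[:[:k:] + y * f:] = [:[:k:]:] + [:y:] \<star> [:f:]" by simp
  have "z \<star> [:[:k:] + y * f:] = smult [:k:] z + (z \<star> [:y:]) \<star> [:f:]"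
    unfolding e R.distrib_left const_comm R.mult.assoc ..
  also have "\<dots> = smult [:k:] z + smult (smult q y) (smult (\<sigma> f) z)" unfolding zy by (simp add: step)
  also have "\<dots> = smult (\<sigma> ([:k:] + y * f)) z" by (simp add: s_add s_mult sy smult_add_left)
  finally show ?case .
qed simp

text \<open>Expand z f = \<sigma>(f) z with z = (q - 1) y t + c and compare constant terms: \<delta>
  is c times the q-difference quotient in y.\<close>

lemma delta_eq: "smult (q - 1) (y * \<delta> f) = smult c (\<sigma> f - f)"
proof -
  have "smult (smult (q - 1) y) (t \<star> [:f:]) + smult f [:[:c:]:] = smult (\<sigma> f) z"
    using z_const[of f] by (simp add: z_def R.distrib_right mult.commute)
  then have "coeff (smult (smult (q - 1) y) (smult (\<sigma> f) t + [:\<delta> f:]) + smult f [:[:c:]:]) 0 = coeff (smult (\<sigma> f) z) 0"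
    unfolding t_const by simp
  then show ?thesis by (simp add: z_def t_def algebra_simps smult_diff_right smult_diff_left smult_add_right)
qed

lemma s_y_power: "\<sigma> (y ^ n) = smult (q ^ n) (y ^ n)"
  by (induction n) (simp_all add: s_mult sy mult.commute)

lemma delta_y_power:
  assumes "q \<noteq> 1" shows "\<delta> (y ^ Suc n) = smult (c * (q ^ Suc n - 1) / (q - 1)) (y ^ n)"
proof -
  have "smult c (smult (q ^ Suc n) Y - Y) = smult (c * (q ^ Suc n - 1)) Y" for Y
    by (simp add: smult_diff_right smult_diff_left right_diff_distrib del: power_Suc)
  then have "smult (q - 1) (y * \<delta> (y ^ Suc n)) = smult (c * (q ^ Suc n - 1)) (y ^ Suc n)"
    unfolding delta_eq s_y_power .
  then have "y * smult (q - 1) (\<delta> (y ^ Suc n)) = y * smult (c * (q ^ Suc n - 1)) (y ^ n)"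
    unfolding mult_smult_right power_Suc .
  then have "smult (q - 1) (\<delta> (y ^ Suc n)) = smult (c * (q ^ Suc n - 1)) (y ^ n)"
    using mult_left_cancel[OF y_nonzero] by blast
  then have "smult (inverse (q - 1)) (smult (q - 1) (\<delta> (y ^ Suc n))) = smult (inverse (q - 1)) (smult (c * (q ^ Suc n - 1)) (y ^ n))"
    by simp
  then show ?thesis using assms by (simp add: divide_inverse mult.commute del: power_Suc)
qed

lemma tz: "t \<star> z = z \<star> smult [:q:] t"
proof -
  have zt: "z = [:smult (q - 1) y:] \<star> t + [:[:c:]:]" by (simp add: z_def)
  have e: "t \<star> [:smult (q - 1) y:] = smult [:q - 1:] (t \<star> [:y:])"
    using mul_smult_const[of t "q - 1" "[:y:]"] by simp
  have "t \<star> z = smult [:q - 1:] (smult (smult q y) (t \<star> t) + smult [:c:] t) + smult [:c:] t"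
    unfolding zt R.distrib_left R.mult.assoc[symmetric] e ty const_comm by (simp add: R.distrib_right)
  also have "\<dots> = smult [:q:] (smult (smult (q - 1) y) (t \<star> t) + smult [:c:] t)"
    by (simp add: smult_add_right smult_diff_right algebra_simps smult_diff_left) (simp add: smult_add_left[symmetric])
  also have "\<dots> = smult [:q:] (z \<star> t)" by (simp add: z_def R.distrib_right)
  finally show ?thesis by (simp add: mul_smult_const)
qed

lemma z_normal: "\<exists>s'. s \<star> z = z \<star> s'"
  by (rule normal_element[OF z_const, of "- h"]) (use tz in \<open>simp add: t_def\<close>)

lemma y_power_lead: "degree (y ^ n) = n" "lead_coeff (y ^ n) = 1"
proof -
  show "degree (y ^ n) = n" using y(2) by (simp add: degree_power_eq)
  show "lead_coeff (y ^ n) = 1" unfolding lead_coeff_power y(1) by simp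
qed

text \<open>Subtracting the multiple of y^n with the same leading coefficient would leave an
  eigenvector of smaller degree for the eigenvalue q^n, although in that degree the eigenvalue has
  to be a different power of q.\<close>

lemma s_eigenvector:
  assumes nru: "\<And>n. n > 0 \<Longrightarrow> q ^ n \<noteq> 1" and f: "\<sigma> f = smult (q ^ degree f) f"
  shows "f = smult (lead_coeff f) (y ^ degree f)"
proof (rule ccontr)
  assume ne: "f \<noteq> smult (lead_coeff f) (y ^ degree f)"
  let ?n = "degree f"
  define e where "e = f - smult (lead_coeff f) (y ^ ?n)"
  have e0: "e \<noteq> 0" using ne by (simp add: e_def)
  have "\<sigma> e = smult (q ^ ?n) e" unfolding e_def s_minus s_smult s_y_power f by (simp add: smult_diff_right mult.commute)
  then have "lead_coeff e * q ^ degree e = q ^ ?n * lead_coeff e" using lead_coeff_s[of e] by (metis lead_coeff_smult)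
  then have eq: "q ^ degree e = q ^ ?n" using e0 by simp
  have ce: "coeff e k = 0" if "k \<ge> ?n" for k
    using that y_power_lead[of ?n] by (cases "k = ?n") (auto simp: e_def coeff_eq_0)
  have "degree e < ?n"
  proof (rule degree_lessI)
    show "e \<noteq> 0 \<or> 0 < ?n" using e0 by simp
  qed (use ce in simp)
  moreover from this have "q ^ (?n - degree e) = 1" using eq by (simp add: power_diff)
  ultimately show False using nru[of "?n - degree e"] by simp
qed

text \<open>As z is congruent to m, the polynomials in J are stable under \<sigma>. One of least
  degree n is an eigenvector, because \<sigma>(f) - q^n f has smaller degree, hence a multiple of
  y^n. The hypothesis \<open>low\<close> then descends to 1.\<close>

lemma minimal_y_power:
  assumes nru: "\<And>n. n > 0 \<Longrightarrow> q ^ n \<noteq> 1"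
    and J: "left_ideal J S" "z - [:[:m:]:] \<in> J" "m \<noteq> 0" "[:f0:] \<in> J" "f0 \<noteq> 0"
    and low: "\<And>n. [:y ^ Suc n:] \<in> J \<Longrightarrow> [:y ^ n:] \<in> J"
  shows "1 \<in> J"
proof -
  obtain f where f: "[:f:] \<in> J" "f \<noteq> 0" and min: "\<And>h. [:h:] \<in> J \<and> h \<noteq> 0 \<Longrightarrow> degree f \<le> degree h"
    using ex_has_least_nat[of "\<lambda>f. [:f:] \<in> J \<and> f \<noteq> 0" f0 degree] J(4,5) by blast
  let ?n = "degree f"
  have "[:\<sigma> f:] \<in> J" by (rule shift_const_mem[OF z_const J(1,2,3) f(1)])
  from left_idealD(7)[OF J(1) this left_idealD(4)[OF J(1) f(1), of "[:q ^ ?n:]"]]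
  have mem: "[:\<sigma> f - smult (q ^ ?n) f:] \<in> J" by simp
  have sf: "\<sigma> f = smult (q ^ ?n) f"
  proof (rule ccontr)
    assume ne: "\<sigma> f \<noteq> smult (q ^ ?n) f"
    have z: "coeff (\<sigma> f - smult (q ^ ?n) f) k = 0" if "k \<ge> ?n" for k
      using lead_coeff_s[of f] that by (cases "k = ?n") (auto simp: coeff_eq_0)
    have "degree (\<sigma> f - smult (q ^ ?n) f) < ?n"
      by (rule degree_lessI) (use ne z in auto)
    then show False using min[of "\<sigma> f - smult (q ^ ?n) f"] mem ne by simp
  qed
  define k where "k = lead_coeff f"
  have fk: "f = smult k (y ^ ?n)" and k: "k \<noteq> 0" using s_eigenvector[OF nru sf] f(2) by (simp_all add: k_def)
  from left_idealD(4)[OF J(1) f(1), of "[:inverse k:]"] have "[:smult (inverse k) f:] \<in> J" by simp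
  then have "[:smult (inverse k) (smult k (y ^ ?n)):] \<in> J" using fk by simp
  then have yn: "[:y ^ ?n:] \<in> J" using k by simp
  have "[:y ^ m:] \<in> J \<Longrightarrow> 1 \<in> J" for m
    by (induction m) (use low in \<open>auto simp: one_pCons\<close>)
  then show ?thesis using yn by blast
qed

text \<open>r = y - 1 has the conjugates q^k (y - q^(-k)), so a_k is the point where y equals
  q^(-k), and powers of y do not vanish there. For c \<noteq> 0 the simple module is S / S t, on
  whose generator z is c. For c = 0 the element z is a multiple of t, so g = z - 1 is taken
  instead.\<close>

lemma nonroot_no_dcc:
  assumes nru: "\<And>n. n > 0 \<Longrightarrow> q ^ n \<noteq> 1"
  shows "\<exists>I. monolithic S I \<and> \<not> dcc_above S I"
proof -
  have q1: "q \<noteq> 1" using nru[of 1] by simp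
  have qinj: "q ^ i = q ^ j \<Longrightarrow> i = j" for i j
  proof (induction i j rule: linorder_wlog)
    case (le i j)
    then have "q ^ (j - i) = 1" by (simp add: power_diff)
    then show ?case using nru[of "j - i"] le(1) by fastforce
  qed simp
  define \<beta> where "\<beta> = coeff y 0"
  have y_eq: "y = [:\<beta>, 1:]"
  proof (rule poly_eqI)
    fix i show "coeff y i = coeff [:\<beta>, 1:] i"
      using y by (cases i; cases "i - 1") (auto simp: coeff_eq_0 \<beta>_def)
  qed
  have spow_y: "(\<sigma> ^^ k) y = smult (q ^ k) y" for k
    by (induction k) (simp_all add: s_smult sy mult.commute)
  let ?r = "[:\<beta> - 1, 1:]"
  define a where "a k = inverse (q ^ k) - \<beta>" for k
  have ya: "poly y (a k) = inverse (q ^ k)" for k by (simp add: y_eq a_def)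
  have sr: "(\<sigma> ^^ k) ?r = smult (q ^ k) [:- a k, 1:]" for k
  proof -
    have "?r = y + [:- 1:]" by (simp add: y_eq)
    then have "(\<sigma> ^^ k) ?r = smult (q ^ k) y + [:- 1:]" by (simp only: spow_add spow_y spow_const)
    then show ?thesis by (simp add: y_eq a_def algebra_simps)
  qed
  have inja: "inj a" using qinj by (auto simp: inj_def a_def)
  have dz: "degree z = 1" and lz: "lead_coeff z = smult (q - 1) y"
    using q1 by (simp_all add: z_def t_def)
  have lead_zpow: "z \<up> k \<noteq> 0 \<and> (\<exists>w. w \<noteq> 0 \<and> lead_coeff (z \<up> k) = smult w (y ^ k))" for k
  proof (induction k)
    case (Suc k)
    then obtain w where w: "w \<noteq> 0" "lead_coeff (z \<up> k) = smult w (y ^ k)" by blast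
    have "z \<noteq> 0" using dz by auto
    then have "lead_coeff (z \<star> (z \<up> k)) = lead_coeff z * (\<sigma> ^^ degree z) (lead_coeff (z \<up> k))"
      using Suc by (intro lead_coeff_mul) auto
    also have "\<dots> = smult ((q - 1) * (w * q ^ k)) (y ^ Suc k)"
      unfolding w(2) lz unfolding dz by (simp add: s_smult s_y_power mult.commute)
    finally have L: "lead_coeff (z \<up> Suc k) = smult ((q - 1) * (w * q ^ k)) (y ^ Suc k)" by simp
    moreover have "(q - 1) * (w * q ^ k) \<noteq> 0" using w(1) q1 by simp
    moreover from this have "z \<up> Suc k \<noteq> 0" using L by (metis leading_coeff_0_iff power_not_zero smult_eq_0_iff y_nonzero)
    ultimately show ?case by blast
  qed (auto intro!: exI[of _ 1])
  have za: "poly (lead_coeff (z \<up> k)) (a k) \<noteq> 0" for k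
    using lead_zpow[of k] by (auto simp: ya poly_power)
  show ?thesis
  proof (cases "c = 0")
    case False
    have dt: "degree t = 1" "lead_coeff t = 1" by (simp_all add: t_def)
    have one: "(\<sigma> ^^ i) 1 = 1" for i using spow_const[of i 1] by (simp add: one_pCons)
    have zc: "z - [:[:c:]:] \<in> principal t"
      using mem_principal[of "[:smult (q - 1) y:]" t] by (simp add: z_def)
    show ?thesis
    proof (rule eigenvector_no_dcc[where z = z and g = t and m = c and l = 1 and r = ?r and c = "\<lambda>k. q ^ k" and a = a])
      show "z \<star> [:f:] = smult (\<sigma> f) z" for f by (rule z_const)
      show "\<exists>s'. s \<star> z = z \<star> s'" for s by (rule z_normal)
      show "(\<sigma> ^^ i) (lead_coeff t) dvd 1" for i unfolding dt(2) one by simp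
      show "(\<sigma> ^^ k) ?r = smult (q ^ k) [:- a k, 1:]" for k by (rule sr)
      show "poly (lead_coeff (z \<up> k)) (a k) \<noteq> 0" for k by (rule za)
      show "proper_maximal (principal t)" unfolding proper_maximal_def
      proof (intro conjI allI impI left_ideal_principal)
        show "1 \<notin> principal t" using principal_degree[of 1 t] dt by auto
        fix J assume "left_ideal J S \<and> principal t \<subset> J"
        then have J: "left_ideal J S" "principal t \<subset> J" by auto
        then obtain s where s: "s \<in> J" "s \<notin> principal t" by blast
        obtain j u where u: "degree u < degree t" "smult (1 ^ j) s - u \<in> principal t"
          using pseudo_division[OF left_ideal_principal[of t] mem_principal_self, of 1 s] dt one by auto
        obtain f where f: "u = [:f:]" using u(1) dt(1) by (metis degree_eq_zeroE less_one)
        have "s - u \<in> J" using u(2) J(2) by auto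
        then have fJ: "[:f:] \<in> J" using left_ideal_eqD[OF J(1)] s(1) f by blast
        have f0: "f \<noteq> 0" using u(2) s(2) f by auto
        have zJ: "z - [:[:c:]:] \<in> J" using zc J(2) by blast
        have tJ: "t \<in> J" using mem_principal_self J(2) by blast
        show "1 \<in> J"
        proof (rule minimal_y_power[OF nru J(1) zJ False fJ f0])
          fix n assume yn: "[:y ^ Suc n:] \<in> J"
          define k where "k = c * (q ^ Suc n - 1) / (q - 1)"
          have k0: "k \<noteq> 0" using False nru[of "Suc n"] q1 by (simp add: k_def del: power_Suc)
          \<comment> \<open>On S / S t the element t acts as c times the q-derivative in y, and no
            q-integer of positive index vanishes.\<close>
          have "t \<star> [:y ^ Suc n:] - smult (\<sigma> (y ^ Suc n)) t = [:smult k (y ^ n):]"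
            unfolding t_const delta_y_power[OF q1] k_def by (simp del: power_Suc)
          then have "[:smult k (y ^ n):] \<in> J"
            using left_idealD(7)[OF J(1) left_idealD(3)[OF J(1) yn] left_idealD(4)[OF J(1) tJ]] by metis
          from left_idealD(4)[OF J(1) this, of "[:inverse k:]"] k0 show "[:y ^ n:] \<in> J" by simp
        qed auto
      qed
    qed (use False dz dt zc inja q1 in \<open>auto simp: ya\<close>)
  next
    case True
    let ?g = "z - [:[:1:]:]"
    have zE: "z = smult (smult (q - 1) y) t" by (subst z_def) (simp only: True pCons_0_0 add_0_right)
    have dyE: "d y = smult (1 - q) (h * y)" unfolding dy True by simp
    have dg: "degree ?g = 1" and lg: "lead_coeff ?g = smult (q - 1) y"
      using q1 by (simp_all add: zE t_def)
    have g0: "?g \<noteq> 0" using dg by auto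
    \<comment> \<open>For c = 0 right multiples by y are also left multiples by y.\<close>
    have Y: "\<exists>v. u \<star> [:y:] = smult y v" for u
    proof (induction u rule: ore_induct)
      case one
      show ?case by (intro exI[of _ 1]) (simp add: one_pCons)
    next
      case (add u v)
      then obtain u' v' where "u \<star> [:y:] = smult y u'" "v \<star> [:y:] = smult y v'" by blast
      then have "(u + v) \<star> [:y:] = smult y (u' + v')" by (simp add: R.distrib_right smult_add_right)
      then show ?case by blast
    next
      case (smult f u)
      then obtain u' where "u \<star> [:y:] = smult y u'" by blast
      then have "smult f u \<star> [:y:] = smult y (smult f u')" by (simp add: mult.commute)
      then show ?case by blast
    next
      case (T u)
      then obtain u' where "u \<star> [:y:] = smult y u'" by blast
      then have "T u \<star> [:y:] = smult y (smult [:q:] (T u') + smult (smult (1 - q) h) u')"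
        by (simp add: T_mul T_smult sy dyE smult_add_right mult.commute)
      then show ?case by blast
    qed
    \<comment> \<open>In y s = u z - u the term u z is divisible by y on the left, so u is as well,
      and y cancels. Hence the powers of y produced by pseudo-division are harmless: S / S g is a
      copy of K[y, 1/y].\<close>
    have y_inj: "s \<in> principal ?g" if ys: "smult y s \<in> principal ?g" for s
    proof -
      obtain u where u: "smult y s = u \<star> ?g" using ys by (auto simp: principal_def)
      obtain v where v: "u \<star> [:y:] = smult y v" using Y by blast
      have "z = smult [:q - 1:] ([:y:] \<star> t)" by (simp add: zE)
      then have "u \<star> z = smult y (smult [:q - 1:] (v \<star> t))"
        by (simp only: mul_smult_const R.mult.assoc[symmetric] v) (simp add: mult.commute)
      moreover have "u \<star> ?g = u \<star> z - u" by (simp add: R.right_diff_distrib one_pCons[symmetric])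
      ultimately have "u = smult y (smult [:q - 1:] (v \<star> t) - s)" using u by (simp add: smult_diff_right algebra_simps)
      then obtain u' where u': "u = smult y u'" by blast
      have "smult y (s - u' \<star> ?g) = 0" using u unfolding u' by (simp add: smult_diff_right)
      then have "s = u' \<star> ?g" by simp
      then show ?thesis using mem_principal by metis
    qed
    have y_pow_inj: "s \<in> principal ?g" if "smult (y ^ j) s \<in> principal ?g" for s j
      using that
    proof (induction j)
      case (Suc j)
      then have "smult y (smult (y ^ j) s) \<in> principal ?g" by simp
      then show ?case using y_inj Suc.IH by blast
    qed simp
    have lgd: "(\<sigma> ^^ i) (lead_coeff ?g) dvd y" for i
    proof -
      have "(\<sigma> ^^ i) (smult (q - 1) y) = smult ((q - 1) * q ^ i) y"
        using spow_mult[of i "[:q - 1:]" y] by (simp add: spow_y mult.commute)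
      then show ?thesis unfolding lg using q1 by (simp add: smult_dvd_iff)
    qed
    show ?thesis
    proof (rule eigenvector_no_dcc[where z = z and g = ?g and m = 1 and l = y and r = ?r and c = "\<lambda>k. q ^ k" and a = a])
      show "z \<star> [:f:] = smult (\<sigma> f) z" for f by (rule z_const)
      show "\<exists>s'. s \<star> z = z \<star> s'" for s by (rule z_normal)
      show "(\<sigma> ^^ i) (lead_coeff ?g) dvd y" for i by (rule lgd)
      show "(\<sigma> ^^ k) ?r = smult (q ^ k) [:- a k, 1:]" for k by (rule sr)
      show "poly (lead_coeff (z \<up> k)) (a k) \<noteq> 0" for k by (rule za)
      show "?g \<in> principal ?g" by (rule mem_principal_self)
      show "degree ?g = 1" by (rule dg)
      show "proper_maximal (principal ?g)" unfolding proper_maximal_def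
      proof (intro conjI allI impI left_ideal_principal)
        show "1 \<notin> principal ?g" using principal_degree[of 1 ?g] dg by auto
        fix J assume "left_ideal J S \<and> principal ?g \<subset> J"
        then have J: "left_ideal J S" "principal ?g \<subset> J" by auto
        then obtain s where s: "s \<in> J" "s \<notin> principal ?g" by blast
        obtain j u where u: "degree u < degree ?g" "smult (y ^ j) s - u \<in> principal ?g"
          using pseudo_division[OF left_ideal_principal[of ?g] mem_principal_self _ lgd, of s] dg by auto
        obtain f where f: "u = [:f:]" using u(1) dg by (metis degree_eq_zeroE less_one)
        have "smult (y ^ j) s - u \<in> J" using u(2) J(2) by blast
        then have fJ: "[:f:] \<in> J" using left_ideal_eqD[OF J(1)] left_idealD(4)[OF J(1) s(1)] f by blast
        have f0: "f \<noteq> 0"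
        proof
          assume "f = 0"
          then have "smult (y ^ j) s \<in> principal ?g" using u(2) f by simp
          then show False using y_pow_inj s(2) by blast
        qed
        have zJ: "?g \<in> J" using J(2) mem_principal_self by blast
        show "1 \<in> J"
        proof (rule minimal_y_power[OF nru J(1) zJ _ fJ f0])
          fix n assume yn: "[:y ^ Suc n:] \<in> J"
          have d0: "\<delta> (y ^ Suc n) = 0" unfolding delta_y_power[OF q1] True by simp
          have "t \<star> [:y ^ Suc n:] = smult (smult (q ^ Suc n) (y ^ Suc n)) t"
            unfolding t_const d0 s_y_power by simp
          then have m1: "smult (smult (q ^ Suc n) (y ^ Suc n)) t \<in> J" using left_idealD(3)[OF J(1) yn] by metis
          \<comment> \<open>y^n = (q - 1) y^(n+1) t - y^n g, where y^(n+1) t lies in J because it is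
            a scalar multiple of t y^(n+1).\<close>
          have "smult [:(q - 1) / q ^ Suc n:] (smult (smult (q ^ Suc n) (y ^ Suc n)) t) - smult (y ^ n) ?g = [:y ^ n:]"
            by (simp add: zE smult_diff_right mult.commute)
          moreover have "smult [:(q - 1) / q ^ Suc n:] (smult (smult (q ^ Suc n) (y ^ Suc n)) t) - smult (y ^ n) ?g \<in> J"
            by (rule left_idealD(7)[OF J(1) left_idealD(4)[OF J(1) m1] left_idealD(4)[OF J(1) zJ]])
          ultimately show "[:y ^ n:] \<in> J" by simp
        qed auto
      qed
    qed (use dz inja q1 in \<open>auto simp: ya\<close>)
  qed
qed

end

section \<open>Presentations by generators and relations\<close>

definition skew_rels :: "'k::field \<Rightarrow> 'k \<Rightarrow> (generator list \<Rightarrow> 'k) set" where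
  "skew_rels p e = {\<lambda>w. word [GY, GX] w - p * word [GX, GY] w - e * word [] w}"

lemma skew_rels_plane: "quantum_plane_rels p = skew_rels p 0"
  by (simp add: quantum_plane_rels_def skew_rels_def)

lemma skew_rels_weyl: "quantum_weyl_rels p = skew_rels p 1"
  by (simp add: quantum_weyl_rels_def skew_rels_def)

abbreviation FA :: "(generator list \<Rightarrow> 'k::field) ring" where "FA \<equiv> free_algebra"

interpretation F: ring "FA :: (generator list \<Rightarrow> 'k::field) ring" by (rule ring_free_algebra)

lemma free_simps:
  "\<zero>\<^bsub>FA\<^esub> = (\<lambda>w. 0 :: 'k::field)" "f \<oplus>\<^bsub>FA\<^esub> g = (\<lambda>w. f w + g w)" "\<one>\<^bsub>FA\<^esub> = word []"
  "f \<in> carrier FA \<longleftrightarrow> finite {w. f w \<noteq> 0}"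
  "(f \<otimes>\<^bsub>FA\<^esub> g) w = (\<Sum>(u, v) | u @ v = w. f u * g v)"
  by (simp_all add: free_algebra_def word_def fun_eq_iff)

lemma free_minus:
  assumes "f \<in> carrier FA" "g \<in> carrier FA" shows "f \<ominus>\<^bsub>FA\<^esub> g = (\<lambda>w. f w - (g w :: 'k::field))"
proof -
  have m: "(\<lambda>w. - g w) \<in> carrier FA" using assms(2) by (simp add: free_simps)
  have "\<ominus>\<^bsub>FA\<^esub> g = (\<lambda>w. - g w)"
    by (rule F.minus_equality[OF _ assms(2) m]) (simp add: free_simps)
  then show ?thesis by (simp add: a_minus_def free_simps)
qed

lemma word_carrier [simp]: "word w \<in> carrier FA"
  by (simp add: free_simps word_def)

lemma word_mult: "(word u \<otimes>\<^bsub>FA\<^esub> f) w = (\<Sum>(u', v)\<in>{(u', v). u' @ v = w \<and> u' = u}. (f v :: 'k::field))"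
proof -
  have "(word u \<otimes>\<^bsub>FA\<^esub> f) w = (\<Sum>(u', v)\<in>{(u', v). u' @ v = w}. word u u' * f v)" by (simp add: free_simps)
  also have "\<dots> = (\<Sum>(u', v)\<in>{(u', v). u' @ v = w \<and> u' = u}. f v)"
    by (rule sum.mono_neutral_cong_right) (auto simp: finite_splits word_def split: if_splits)
  finally show ?thesis .
qed

lemma word_mult_word: "word u \<otimes>\<^bsub>FA\<^esub> word v = (word (u @ v) :: generator list \<Rightarrow> 'k::field)"
proof
  fix w
  show "(word u \<otimes>\<^bsub>FA\<^esub> word v) w = (word (u @ v) w :: 'k)"
  proof (cases "\<exists>v'. w = u @ v'")
    case True
    then obtain v' where v': "w = u @ v'" by blast
    then have "{(u', v). u' @ v = w \<and> u' = u} = {(u, v')}" by auto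
    then show ?thesis unfolding word_mult by (simp add: v' word_def)
  next
    case False
    then have e: "{(u', v). u' @ v = w \<and> u' = u} = {}" by auto
    show ?thesis unfolding word_mult e using False by (auto simp: word_def)
  qed
qed

lemma free_const_carrier [simp]: "free_const k \<in> carrier FA"
proof -
  have "{w. free_const k w \<noteq> 0} \<subseteq> {[]}" by (auto simp: free_const_def word_def)
  from finite_subset[OF this] show ?thesis by (simp add: free_simps)
qed

lemma free_const_mult: "free_const k \<otimes>\<^bsub>FA\<^esub> f = (\<lambda>w. k * (f w :: 'k::field))"
proof
  fix w
  have "(free_const k \<otimes>\<^bsub>FA\<^esub> f) w = (\<Sum>(u, v)\<in>{(u, v). u @ v = w}. free_const k u * f v)" by (simp add: free_simps)
  also have "\<dots> = (\<Sum>(u, v)\<in>{([] :: generator list, w)}. k * f v)"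
    by (rule sum.mono_neutral_cong_right) (auto simp: finite_splits free_const_def word_def split: if_splits)
  finally show "(free_const k \<otimes>\<^bsub>FA\<^esub> f) w = k * f w" by simp
qed

lemma free_span:
  assumes f: "f \<in> carrier FA" and zero: "(\<lambda>w. 0) \<in> P"
    and add: "\<And>g h. g \<in> P \<Longrightarrow> h \<in> P \<Longrightarrow> (\<lambda>w. g w + h w) \<in> P"
    and word: "\<And>k w. f w \<noteq> 0 \<Longrightarrow> (\<lambda>v. k * word w v) \<in> P"
  shows "f \<in> (P :: (generator list \<Rightarrow> 'k::field) set)"
proof -
  have "(\<lambda>v. if v \<in> A then f v else 0) \<in> P" if "finite A" "A \<subseteq> {w. f w \<noteq> 0}" for A
    using that
  proof (induction A rule: finite_induct)
    case (insert w A)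
    have "(\<lambda>v. if v \<in> insert w A then f v else 0) = (\<lambda>v. f w * word w v + (if v \<in> A then f v else 0))"
      using insert(2) by (auto simp: fun_eq_iff word_def)
    then show ?case using add[OF word insert.IH] insert.prems by auto
  qed (use zero in simp)
  from this[of "{w. f w \<noteq> 0}"] f have "(\<lambda>v. if f v \<noteq> 0 then f v else 0) \<in> P" by (simp add: free_simps)
  moreover have "(\<lambda>v. if f v \<noteq> 0 then f v else 0) = f" by auto
  ultimately show ?thesis by simp
qed

abbreviation normal_word :: "nat \<Rightarrow> nat \<Rightarrow> generator list" where
  "normal_word i j \<equiv> replicate i GX @ replicate j GY"

definition normal_forms :: "(generator list \<Rightarrow> 'k::field) set" where
  "normal_forms = {g \<in> carrier FA. \<forall>w. g w \<noteq> 0 \<longrightarrow> (\<exists>i j. w = normal_word i j)}"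

text \<open>The elements congruent to a normal form are closed under left multiplication by both
  letters, hence include all words. This is existence; independence of the normal words is read off
  later from their images in S.\<close>

lemma normal_ordering:
  fixes p e :: "'k::field" and f :: "generator list \<Rightarrow> 'k"
  assumes f: "f \<in> carrier FA"
  shows "\<exists>g\<in>normal_forms. f \<ominus>\<^bsub>FA\<^esub> g \<in> Idl\<^bsub>FA\<^esub> (skew_rels p e)"
proof -
  let ?rel = "\<lambda>w. word [GY, GX] w - p * word [GX, GY] w - e * word [] w :: 'k"
  define I where "I = Idl\<^bsub>FA\<^esub> (skew_rels p e)"
  have relc: "?rel \<in> carrier FA"
  proof -
    have "{w. ?rel w \<noteq> 0} \<subseteq> {[GY, GX], [GX, GY], []}" by (auto simp: word_def)
    from finite_subset[OF this] show ?thesis by (simp add: free_simps)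
  qed
  have sub: "skew_rels p e \<subseteq> carrier FA" using relc by (simp add: skew_rels_def)
  interpret I: ideal I "FA :: (generator list \<Rightarrow> 'k) ring" unfolding I_def by (rule F.genideal_ideal[OF sub])
  have relI: "?rel \<in> I" using F.genideal_self[OF sub] by (auto simp: I_def skew_rels_def)
  have I_scale: "(\<lambda>w. k * g w) \<in> I" if "g \<in> I" for k g
    using I.I_l_closed[OF that free_const_carrier, of k] by (simp add: free_const_mult)
  have I_add: "(\<lambda>w. g w + h w) \<in> I" if "g \<in> I" "h \<in> I" for g h
    using I.a_closed[OF that] by (simp add: free_simps)
  have I_zero: "(\<lambda>w. 0) \<in> I" using I.zero_closed by (simp add: free_simps)
  have IC: "I \<subseteq> carrier FA" by (rule I.a_subset)
  have fin_add: "(\<lambda>w. g w + h w) \<in> carrier FA" if "g \<in> carrier FA" "h \<in> carrier FA" for g h :: "generator list \<Rightarrow> 'k"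
    using F.a_closed[OF that] by (simp add: free_simps)
  have fin_scale: "(\<lambda>w. k * h w) \<in> carrier FA" if "h \<in> carrier FA" for k and h :: "generator list \<Rightarrow> 'k"
    using F.m_closed[OF free_const_carrier that, of k] by (simp add: free_const_mult)
  define C where "C = {f. \<exists>g\<in>normal_forms. \<exists>h\<in>I. \<forall>w. f w = g w + h w}"
  have CI: "f \<in> C" if "g \<in> normal_forms" "h \<in> I" "\<And>w. f w = g w + h w" for f g h
    using that unfolding C_def by blast
  have CE: "\<exists>g h. f = (\<lambda>w. g w + h w) \<and> g \<in> normal_forms \<and> h \<in> I" if "f \<in> C" for f
    using that unfolding C_def by (auto simp: fun_eq_iff)
  have N_carrier: "g \<in> carrier FA" if "g \<in> normal_forms" for g :: "generator list \<Rightarrow> 'k"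
    using that by (simp add: normal_forms_def)
  have N_add: "(\<lambda>w. g w + h w) \<in> normal_forms" if "g \<in> normal_forms" "h \<in> normal_forms" for g h :: "generator list \<Rightarrow> 'k"
    unfolding normal_forms_def
  proof (intro CollectI conjI allI impI)
    show "(\<lambda>w. g w + h w) \<in> carrier FA" using fin_add N_carrier that by blast
    fix w assume "g w + h w \<noteq> 0"
    then have "g w \<noteq> 0 \<or> h w \<noteq> 0" by auto
    then show "\<exists>i j. w = normal_word i j" using that by (auto simp: normal_forms_def)
  qed
  have N_scale: "(\<lambda>w. k * h w) \<in> normal_forms" if "h \<in> normal_forms" for k and h :: "generator list \<Rightarrow> 'k"
    using that fin_scale[of h k] by (auto simp: normal_forms_def)
  have N_word: "word (normal_word i j) \<in> (normal_forms :: (generator list \<Rightarrow> 'k) set)" for i j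
    using word_carrier by (auto simp: normal_forms_def word_def split: if_splits)
  have N_zero: "(\<lambda>w. 0) \<in> (normal_forms :: (generator list \<Rightarrow> 'k) set)" by (simp add: normal_forms_def free_simps)
  have NC: "g \<in> C" if "g \<in> normal_forms" for g
    by (rule CI[OF that I_zero]) simp
  have C_I: "g \<in> C" if "g \<in> I" for g
    by (rule CI[OF N_zero that]) simp
  have C_add: "(\<lambda>w. g w + h w) \<in> C" if gh: "g \<in> C" "h \<in> C" for g h
  proof -
    obtain g1 g2 h1 h2 where e: "g = (\<lambda>w. g1 w + g2 w)" "h = (\<lambda>w. h1 w + h2 w)"
        "g1 \<in> normal_forms" "g2 \<in> I" "h1 \<in> normal_forms" "h2 \<in> I" using CE gh by metis
    show ?thesis by (rule CI[OF N_add[OF e(3,5)] I_add[OF e(4,6)]]) (simp add: e algebra_simps)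
  qed
  have C_scale: "(\<lambda>w. k * g w) \<in> C" if g: "g \<in> C" for k g
  proof -
    obtain g1 g2 where e: "g = (\<lambda>w. g1 w + g2 w)" "g1 \<in> normal_forms" "g2 \<in> I" using CE[OF g] by blast
    show ?thesis by (rule CI[OF N_scale[where k = k, OF e(2)] I_scale[where k = k, OF e(3)]]) (simp add: e algebra_simps)
  qed
  have C_carrier: "g \<in> carrier FA" if "g \<in> C" for g
    using CE[OF that] N_carrier IC fin_add by blast
  have dist: "word u \<otimes>\<^bsub>FA\<^esub> (\<lambda>w. g w + h w) = (\<lambda>w. (word u \<otimes>\<^bsub>FA\<^esub> g) w + (word u \<otimes>\<^bsub>FA\<^esub> h) w)"
    for u and g h :: "generator list \<Rightarrow> 'k"
    by (auto simp: fun_eq_iff word_mult case_prod_unfold sum.distrib)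
  have scal: "word u \<otimes>\<^bsub>FA\<^esub> (\<lambda>w. k * g w) = (\<lambda>w. k * (word u \<otimes>\<^bsub>FA\<^esub> g) w)" for u k and g :: "generator list \<Rightarrow> 'k"
    by (auto simp: fun_eq_iff word_mult case_prod_unfold sum_distrib_left)
  have X_N: "word [GX] \<otimes>\<^bsub>FA\<^esub> g \<in> normal_forms" if g: "g \<in> normal_forms" for g :: "generator list \<Rightarrow> 'k"
    unfolding normal_forms_def
  proof (intro CollectI conjI allI impI)
    show "word [GX] \<otimes>\<^bsub>FA\<^esub> g \<in> carrier FA" using N_carrier[OF g] by simp
    fix w assume "(word [GX] \<otimes>\<^bsub>FA\<^esub> g) w \<noteq> 0"
    then obtain x where "x \<in> {(u', v). u' @ v = w \<and> u' = [GX]}" "(case x of (u', v) \<Rightarrow> g v) \<noteq> 0"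
      unfolding word_mult by (rule sum.not_neutral_contains_not_neutral)
    then obtain v where v: "w = GX # v" "g v \<noteq> 0" by auto
    then obtain i j where "v = normal_word i j" using g by (auto simp: normal_forms_def)
    then have "w = normal_word (Suc i) j" using v by simp
    then show "\<exists>i j. w = normal_word i j" by blast
  qed
  have X_C: "word [GX] \<otimes>\<^bsub>FA\<^esub> g \<in> C" if g: "g \<in> C" for g
  proof -
    obtain g1 g2 where e: "g = (\<lambda>w. g1 w + g2 w)" "g1 \<in> normal_forms" "g2 \<in> I" using CE[OF g] by blast
    show ?thesis unfolding e(1) dist
      by (rule C_add[OF NC[OF X_N[OF e(2)]] C_I[OF I.I_l_closed[OF e(3) word_carrier]]])
  qed
  \<comment> \<open>Modulo the relation, y x^(i+1) y^j = p x (y x^i y^j) + e x^i y^j, and the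
    bracket is covered by induction.\<close>
  have Y_word: "word (GY # normal_word i j) \<in> C" for i j
  proof (induction i)
    case 0
    have "word (GY # normal_word 0 j) = (word (normal_word 0 (Suc j)) :: generator list \<Rightarrow> 'k)" by simp
    then show ?case using NC[OF N_word, of 0 "Suc j"] by simp
  next
    case (Suc i)
    let ?w = "normal_word i j"
    have "?rel \<otimes>\<^bsub>FA\<^esub> word ?w = (\<lambda>w. word (GY # GX # ?w) w - p * word (GX # GY # ?w) w - e * word ?w w)"
    proof -
      have r: "?rel = word [GY, GX] \<ominus>\<^bsub>FA\<^esub> free_const p \<otimes>\<^bsub>FA\<^esub> word [GX, GY] \<ominus>\<^bsub>FA\<^esub> free_const e \<otimes>\<^bsub>FA\<^esub> word []"
        by (subst free_minus, simp, simp, subst free_minus, simp, simp) (simp add: free_const_mult)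
      have d: "(f1 \<ominus>\<^bsub>FA\<^esub> f2) \<otimes>\<^bsub>FA\<^esub> f3 = f1 \<otimes>\<^bsub>FA\<^esub> f3 \<ominus>\<^bsub>FA\<^esub> f2 \<otimes>\<^bsub>FA\<^esub> f3"
        if "f1 \<in> carrier FA" "f2 \<in> carrier FA" "f3 \<in> carrier FA" for f1 f2 f3 :: "generator list \<Rightarrow> 'k"
        using that by (simp add: a_minus_def F.l_distr F.l_minus)
      have "?rel \<otimes>\<^bsub>FA\<^esub> word ?w = word [GY, GX] \<otimes>\<^bsub>FA\<^esub> word ?w \<ominus>\<^bsub>FA\<^esub> free_const p \<otimes>\<^bsub>FA\<^esub> (word [GX, GY] \<otimes>\<^bsub>FA\<^esub> word ?w)
          \<ominus>\<^bsub>FA\<^esub> free_const e \<otimes>\<^bsub>FA\<^esub> (word [] \<otimes>\<^bsub>FA\<^esub> word ?w)"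
        unfolding r by (simp add: d F.m_assoc)
      also have "\<dots> = (\<lambda>w. word (GY # GX # ?w) w - p * word (GX # GY # ?w) w - e * word ?w w)"
        unfolding word_mult_word
        by (subst free_minus, simp, simp, subst free_minus, simp, simp) (simp add: free_const_mult)
      finally show ?thesis .
    qed
    then have r: "(\<lambda>w. word (GY # GX # ?w) w - p * word (GX # GY # ?w) w - e * word ?w w) \<in> C"
      using C_I[OF I.I_r_closed[OF relI word_carrier, of ?w]] by simp
    have "word (GX # GY # ?w) \<in> C" using X_C[OF Suc] by (simp add: word_mult_word)
    from C_add[OF r C_add[OF C_scale[OF this, of p] C_scale[OF NC[OF N_word, of i j], of e]]]
    show ?case by simp
  qed
  have Y_C: "word [GY] \<otimes>\<^bsub>FA\<^esub> g \<in> C" if g: "g \<in> C" for g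
  proof -
    obtain g1 g2 where e: "g = (\<lambda>w. g1 w + g2 w)" "g1 \<in> normal_forms" "g2 \<in> I" using CE[OF g] by blast
    have "g1 \<in> {g. word [GY] \<otimes>\<^bsub>FA\<^esub> g \<in> C}"
    proof (rule free_span[OF N_carrier[OF e(2)]])
      have "word [GY] \<otimes>\<^bsub>FA\<^esub> (\<lambda>w. 0) = (\<lambda>w. 0 :: 'k)" by (simp add: fun_eq_iff word_mult)
      then show "(\<lambda>w. 0) \<in> {g. word [GY] \<otimes>\<^bsub>FA\<^esub> g \<in> C}" using C_I[OF I_zero] by simp
    next
      fix g h assume "g \<in> {g. word [GY] \<otimes>\<^bsub>FA\<^esub> g \<in> C}" "h \<in> {g. word [GY] \<otimes>\<^bsub>FA\<^esub> g \<in> C}"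
      then show "(\<lambda>w. g w + h w) \<in> {g. word [GY] \<otimes>\<^bsub>FA\<^esub> g \<in> C}" using C_add by (simp add: dist)
    next
      fix k w assume "g1 w \<noteq> 0"
      then obtain i j where w: "w = normal_word i j" using e(2) by (auto simp: normal_forms_def)
      show "(\<lambda>v. k * word w v) \<in> {g. word [GY] \<otimes>\<^bsub>FA\<^esub> g \<in> C}"
        using C_scale[OF Y_word[of i j], of k] by (simp add: scal word_mult_word w)
    qed
    then show ?thesis unfolding e(1) dist
      using C_add C_I[OF I.I_l_closed[OF e(3) word_carrier]] by blast
  qed
  have words: "word w \<in> C" for w
  proof (induction w)
    case Nil
    show ?case using NC[OF N_word, of 0 0] by simp
  next
    case (Cons x w)
    have "word (x # w) = word [x] \<otimes>\<^bsub>FA\<^esub> (word w :: generator list \<Rightarrow> 'k)" by (simp add: word_mult_word)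
    then show ?case using X_C[OF Cons] Y_C[OF Cons] by (cases x) simp_all
  qed
  have "f \<in> C" by (rule free_span[OF f]) (use C_I[OF I_zero] C_add C_scale words in auto)
  then obtain g h where gh: "f = (\<lambda>w. g w + h w)" "g \<in> normal_forms" "h \<in> I" using CE by blast
  have "f \<ominus>\<^bsub>FA\<^esub> g = h" unfolding free_minus[OF f N_carrier[OF gh(2)]] by (simp add: gh(1))
  then show ?thesis using gh unfolding I_def by blast
qed

section \<open>Evaluation of words in an Ore extension\<close>

context ore
begin

lemma key_add:
  assumes "a \<noteq> 0" "e \<noteq> 0" "key a \<noteq> key e"
  shows "a + e \<noteq> 0 \<and> (key (a + e) = key a \<or> key (a + e) = key e)"
proof -
  have *: "u + v \<noteq> 0 \<and> key (u + v) = key v" if "degree u < degree v" for u v :: "'k poly poly"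
    using that degree_add_eq_right[OF that] lead_coeff_add_le[OF that] by (auto simp: key_def)
  have **: "u + v \<noteq> 0 \<and> key (u + v) = key v"
    if "degree u = degree v" "degree (lead_coeff u) < degree (lead_coeff v)" for u v :: "'k poly poly"
  proof -
    have c: "coeff (u + v) (degree v) = lead_coeff u + lead_coeff v" using that(1) by simp
    have d: "degree (lead_coeff u + lead_coeff v) = degree (lead_coeff v)" using that(2) by (rule degree_add_eq_right)
    then have nz: "lead_coeff u + lead_coeff v \<noteq> 0" using that(2) by auto
    have dv: "degree (u + v) = degree v"
    proof (rule antisym)
      show "degree (u + v) \<le> degree v" using degree_add_le[of u "degree v" v] that(1) by simp
      show "degree v \<le> degree (u + v)" by (rule le_degree) (use c nz in simp)
    qed
    have "u + v \<noteq> 0" using c nz by (metis coeff_0)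
    moreover have "key (u + v) = key v" by (simp only: key_def dv c d)
    ultimately show ?thesis by blast
  qed
  consider "degree a < degree e" | "degree e < degree a"
    | "degree a = degree e" "degree (lead_coeff a) < degree (lead_coeff e)"
    | "degree e = degree a" "degree (lead_coeff e) < degree (lead_coeff a)"
    using assms(3) unfolding key_def by fastforce
  then show ?thesis
  proof cases
    case 1 then show ?thesis using *[of a e] by blast
  next
    case 2 then show ?thesis using *[of e a] by (simp add: add.commute)
  next
    case 3 then show ?thesis using **[of a e] by blast
  next
    case 4 then show ?thesis using **[of e a] by (simp add: add.commute)
  qed
qed

text \<open>Leading monomials with different exponents cannot cancel, so elements with distinct keys
  are linearly independent.\<close>

lemma sum_distinct_keys_nonzero:
  assumes "finite A" "A \<noteq> {}" "\<And>w. w \<in> A \<Longrightarrow> v w \<noteq> 0" "inj_on (\<lambda>w. key (v w)) A"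
  shows "sum v A \<noteq> 0 \<and> key (sum v A) \<in> (\<lambda>w. key (v w)) ` A"
  using assms
proof (induction A rule: finite_ne_induct)
  case (insert w A)
  then have IH: "sum v A \<noteq> 0" "key (sum v A) \<in> (\<lambda>w. key (v w)) ` A" by (auto simp: inj_on_def)
  have "key (v w) \<noteq> key (sum v A)" using IH(2) insert.hyps insert.prems(2) by (auto simp: inj_on_def)
  then show ?case using key_add[of "v w" "sum v A"] IH insert by auto
qed simp

primrec word_eval :: "'k poly poly \<Rightarrow> 'k poly poly \<Rightarrow> generator list \<Rightarrow> 'k poly poly" where
  "word_eval X Y [] = 1"
| "word_eval X Y (g # w) = (case g of GX \<Rightarrow> X | GY \<Rightarrow> Y) \<star> word_eval X Y w"

lemma word_eval_append: "word_eval X Y (u @ v) = word_eval X Y u \<star> word_eval X Y v"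
  by (induction u) (simp_all add: R.mult.assoc)

definition free_eval :: "'k poly poly \<Rightarrow> 'k poly poly \<Rightarrow> (generator list \<Rightarrow> 'k) \<Rightarrow> 'k poly poly" where
  "free_eval X Y f = (\<Sum>w | f w \<noteq> 0. smult [:f w:] (word_eval X Y w))"

lemma free_eval_superset:
  assumes "finite A" "{w. f w \<noteq> 0} \<subseteq> A"
  shows "free_eval X Y f = (\<Sum>w\<in>A. smult [:f w:] (word_eval X Y w))"
  unfolding free_eval_def by (rule sum.mono_neutral_left) (use assms in auto)

lemma free_eval_word: "free_eval X Y (word w) = word_eval X Y w"
  by (subst free_eval_superset[of "{w}"]) (auto simp: word_def one_pCons[symmetric])

lemma free_eval_add:
  assumes "f \<in> carrier FA" "g \<in> carrier FA"
  shows "free_eval X Y (\<lambda>w. f w + g w) = free_eval X Y f + free_eval X Y g"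
proof -
  let ?A = "{w. f w \<noteq> 0} \<union> {w. g w \<noteq> 0}"
  have fin: "finite ?A" using assms by (simp add: free_simps)
  have "smult [:f w + g w:] (word_eval X Y w) = smult [:f w:] (word_eval X Y w) + smult [:g w:] (word_eval X Y w)" for w
    by (simp add: smult_add_left[symmetric])
  moreover have "{w. f w + g w \<noteq> 0} \<subseteq> ?A" "{w. f w \<noteq> 0} \<subseteq> ?A" "{w. g w \<noteq> 0} \<subseteq> ?A" by auto
  ultimately show ?thesis by (simp add: free_eval_superset[OF fin] sum.distrib)
qed

lemma free_eval_mult:
  assumes "f \<in> carrier FA" "g \<in> carrier FA"
  shows "free_eval X Y (f \<otimes>\<^bsub>FA\<^esub> g) = free_eval X Y f \<star> free_eval X Y g"
proof -
  let ?A = "{w. f w \<noteq> 0}" and ?B = "{w. g w \<noteq> 0}"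
  let ?C = "(\<lambda>(u, v). u @ v) ` (?A \<times> ?B)"
  have fin: "finite ?A" "finite ?B" using assms by (simp_all add: free_simps)
  have eq: "(f \<otimes>\<^bsub>FA\<^esub> g) w = (\<Sum>x\<in>{x \<in> ?A \<times> ?B. (case x of (u, v) \<Rightarrow> u @ v) = w}. f (fst x) * g (snd x))" for w
  proof -
    have "(f \<otimes>\<^bsub>FA\<^esub> g) w = (\<Sum>x\<in>{(u, v). u @ v = w}. f (fst x) * g (snd x))"
      by (simp add: free_simps case_prod_unfold)
    also have "\<dots> = (\<Sum>x\<in>{x \<in> ?A \<times> ?B. (case x of (u, v) \<Rightarrow> u @ v) = w}. f (fst x) * g (snd x))"
      by (rule sum.mono_neutral_right) (auto simp: finite_splits)
    finally show ?thesis .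
  qed
  have sup: "{w. (f \<otimes>\<^bsub>FA\<^esub> g) w \<noteq> 0} \<subseteq> ?C"
  proof
    fix w assume "w \<in> {w. (f \<otimes>\<^bsub>FA\<^esub> g) w \<noteq> 0}"
    then have "(\<Sum>x\<in>{x \<in> ?A \<times> ?B. (case x of (u, v) \<Rightarrow> u @ v) = w}. f (fst x) * g (snd x)) \<noteq> 0"
      unfolding eq by simp
    then obtain x where "x \<in> {x \<in> ?A \<times> ?B. (case x of (u, v) \<Rightarrow> u @ v) = w}"
      by (rule sum.not_neutral_contains_not_neutral)
    then show "w \<in> ?C" by (intro image_eqI[of _ _ x]) auto
  qed
  let ?W = "word_eval X Y"
  let ?h = "\<lambda>x. smult [:f (fst x) * g (snd x):] (?W (fst x @ snd x))"
  have csum: "smult [:sum k A:] v = (\<Sum>x\<in>A. smult [:k x:] v)" for k :: "generator list \<times> generator list \<Rightarrow> 'k" and A v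
  proof -
    have "[:sum k A:] = (\<Sum>x\<in>A. [:k x:])"
    proof (induction A rule: infinite_finite_induct)
      case (insert x F)
      have "[:sum k (insert x F):] = [:k x:] + [:sum k F:]" using insert(1,2) by simp
      also have "\<dots> = [:k x:] + (\<Sum>x\<in>F. [:k x:])" unfolding insert(3) ..
      also have "\<dots> = (\<Sum>x\<in>insert x F. [:k x:])" using insert(1,2) by simp
      finally show ?case .
    qed simp_all
    then show ?thesis by (simp add: smult_sum)
  qed
  have "free_eval X Y (f \<otimes>\<^bsub>FA\<^esub> g) = (\<Sum>w\<in>?C. smult [:(f \<otimes>\<^bsub>FA\<^esub> g) w:] (?W w))"
    by (rule free_eval_superset[OF _ sup]) (use fin in simp)
  also have "\<dots> = (\<Sum>w\<in>?C. \<Sum>x\<in>{x \<in> ?A \<times> ?B. (case x of (u, v) \<Rightarrow> u @ v) = w}. ?h x)"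
    unfolding eq csum by (intro sum.cong refl) auto
  also have "\<dots> = (\<Sum>x\<in>?A \<times> ?B. ?h x)"
    by (rule sum.group) (use fin in auto)
  also have "\<dots> = (\<Sum>u\<in>?A. \<Sum>v\<in>?B. smult [:f u * g v:] (?W (u @ v)))"
    by (simp add: sum.cartesian_product case_prod_unfold)
  also have "\<dots> = (\<Sum>u\<in>?A. \<Sum>v\<in>?B. smult [:f u:] (?W u) \<star> smult [:g v:] (?W v))"
    by (intro sum.cong refl) (simp add: word_eval_append mul_smult_const)
  also have "\<dots> = free_eval X Y f \<star> free_eval X Y g"
  proof -
    have l: "(\<Sum>u\<in>A. F u) \<star> c = (\<Sum>u\<in>A. F u \<star> c)" for A :: "generator list set" and F c
      by (induction A rule: infinite_finite_induct) (simp_all add: R.distrib_right)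
    have r: "c \<star> (\<Sum>u\<in>A. F u) = (\<Sum>u\<in>A. c \<star> F u)" for A :: "generator list set" and F c
      by (induction A rule: infinite_finite_induct) (simp_all add: R.distrib_left)
    show ?thesis unfolding free_eval_def by (simp only: l) (simp only: r)
  qed
  finally show ?thesis .
qed

lemma free_eval_const: "free_eval X Y (free_const k) = ore_const k"
  by (subst free_eval_superset[of "{[]}"]) (auto simp: free_const_def word_def ore_const_def split: if_splits)

text \<open>The letters go to \<open>y\<close> and \<open>th\<close>, which satisfy the relation.
  The normal words go to elements with the distinct keys (i, j), so no nonzero normal form is
  killed; by \<open>normal_ordering\<close> the kernel is exactly the ideal of the relation.\<close>

lemma presented_iso:
  fixes p e :: 'k
  assumes y: "degree y = 1" and th: "degree th = 1" "lead_coeff th = [:l:]" "l \<noteq> 0"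
    and rel: "th \<star> [:y:] = smult (smult p y) th + [:[:e:]:]"
  shows "K_algebra_isomorphic S ore_const (presented_algebra (skew_rels p e)) (presented_const (skew_rels p e))"
proof -
  let ?\<Phi> = "free_eval [:y:] th"
  let ?I = "Idl\<^bsub>FA\<^esub> (skew_rels p e)"
  let ?rel = "\<lambda>w. word [GY, GX] w - p * word [GX, GY] w - e * word [] w :: 'k"
  have y0: "y \<noteq> 0" and th0: "th \<noteq> 0" using y th by auto
  have mult: "x \<otimes>\<^bsub>FA\<^esub> x' \<in> carrier FA" "x \<oplus>\<^bsub>FA\<^esub> x' \<in> carrier FA" if "x \<in> carrier FA" "x' \<in> carrier FA"
    for x x' :: "generator list \<Rightarrow> 'k" using that by simp_all
  have hom: "?\<Phi> \<in> ring_hom FA S"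
    by (rule ring_hom_memI)
       (simp_all add: free_eval_mult free_eval_add free_simps(2,3) free_eval_word)
  interpret H: ring_hom_ring FA S ?\<Phi>
    by (rule ring_hom_ringI2[OF F.ring_axioms ring_S hom])
  have ker: "a_kernel FA S ?\<Phi> = {f \<in> carrier FA. ?\<Phi> f = 0}" unfolding a_kernel_def' S_simps ..
  have relc: "?rel \<in> carrier FA"
  proof -
    have "{w. ?rel w \<noteq> 0} \<subseteq> {[GY, GX], [GX, GY], []}" by (auto simp: word_def)
    from finite_subset[OF this] show ?thesis by (simp add: free_simps)
  qed
  have sub: "skew_rels p e \<subseteq> carrier FA" using relc by (simp add: skew_rels_def)
  have "?\<Phi> ?rel = 0"
  proof -
    let ?A = "{[GY, GX], [GX, GY], []} :: generator list set"
    have "?\<Phi> ?rel = (\<Sum>w\<in>?A. smult [:?rel w:] (word_eval [:y:] th w))"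
      by (rule free_eval_superset) (auto simp: word_def)
    also have "\<dots> = th \<star> [:y:] - smult [:p:] ([:y:] \<star> th) - [:[:e:]:]"
    proof -
      have E: "word_eval [:y:] th [GY, GX] = th \<star> [:y:]" "word_eval [:y:] th [GX, GY] = [:y:] \<star> th" "word_eval [:y:] th [] = 1"
        by (simp_all only: word_eval.simps generator.case R.mult_1_right)
      have r: "?rel [GY, GX] = 1" "?rel [GX, GY] = - p" "?rel [] = - e" by (simp_all add: word_def)
      have m: "smult [:- k:] v = - smult [:k:] v" for k and v :: "'k poly poly"
        using smult_minus_left[of "[:k:]" v] by simp
      have "(\<Sum>w\<in>?A. smult [:?rel w:] (word_eval [:y:] th w)) =
          smult [:?rel [GY, GX]:] (word_eval [:y:] th [GY, GX]) +
          (smult [:?rel [GX, GY]:] (word_eval [:y:] th [GX, GY]) + smult [:?rel []:] (word_eval [:y:] th []))"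
        by (subst sum.insert; simp)+
      also have "\<dots> = th \<star> [:y:] - smult [:p:] ([:y:] \<star> th) - [:[:e:]:]"
        unfolding r E m by (simp add: one_pCons[symmetric])
      finally show ?thesis .
    qed
    also have "\<dots> = 0" unfolding rel by simp
    finally show ?thesis .
  qed
  then have "skew_rels p e \<subseteq> a_kernel FA S ?\<Phi>" using relc unfolding ker skew_rels_def by blast
  then have IK: "?I \<subseteq> a_kernel FA S ?\<Phi>" using F.genideal_minimal[OF H.kernel_is_ideal] by blast
  have keyw: "word_eval [:y:] th (normal_word i j) \<noteq> 0 \<and> key (word_eval [:y:] th (normal_word i j)) = (i, j)" for i j
  proof -
    have Yc: "word_eval [:y:] th (replicate j GY) \<noteq> 0 \<and> degree (word_eval [:y:] th (replicate j GY)) = j \<and>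
        lead_coeff (word_eval [:y:] th (replicate j GY)) = [:l ^ j:]"
    proof (induction j)
      case (Suc j)
      let ?v = "word_eval [:y:] th (replicate j GY)"
      have v: "?v \<noteq> 0" "degree ?v = j" "lead_coeff ?v = [:l ^ j:]" using Suc by auto
      have "lead_coeff (th \<star> ?v) = lead_coeff th * (\<sigma> ^^ degree th) (lead_coeff ?v)" by (rule lead_coeff_mul[OF th0 v(1)])
      also have "\<dots> = [:l ^ Suc j:]" unfolding v(3) th(2) by simp
      finally show ?case using degree_mul_lead(2)[OF th0 v(1)] th(1) v(1,2) th0 by simp
    qed (simp add: one_pCons)
    have Y: "word_eval [:y:] th (replicate j GY) \<noteq> 0" "degree (word_eval [:y:] th (replicate j GY)) = j"
      "lead_coeff (word_eval [:y:] th (replicate j GY)) = [:l ^ j:]" using Yc by blast+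
    have X: "word_eval [:y:] th (replicate i GX @ w) = smult (y ^ i) (word_eval [:y:] th w)" for w
      by (induction i) (simp_all add: mult.commute)
    have "lead_coeff (word_eval [:y:] th (normal_word i j)) = y ^ i * [:l ^ j:]"
      unfolding X lead_coeff_smult Y(3) ..
    moreover have "degree (y ^ i * [:l ^ j:]) = i" using y y0 th(3) by (simp add: degree_mult_eq degree_power_eq)
    moreover have "degree (word_eval [:y:] th (normal_word i j)) = j" unfolding X using Y(2) y0 by simp
    moreover have "word_eval [:y:] th (normal_word i j) \<noteq> 0" unfolding X using Y(1) y0 by simp
    ultimately show ?thesis by (simp add: key_def)
  qed
  have nf0: "g = (\<lambda>w. 0)" if g: "g \<in> normal_forms" "?\<Phi> g = 0" for g
  proof (rule ccontr)
    assume ne: "g \<noteq> (\<lambda>w. 0)"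
    let ?A = "{w. g w \<noteq> 0}"
    let ?v = "\<lambda>w. smult [:g w:] (word_eval [:y:] th w)"
    have fin: "finite ?A" using g(1) by (simp add: normal_forms_def free_simps)
    have A: "?A \<noteq> {}" using ne by auto
    have nw: "\<exists>i j. w = normal_word i j" if "w \<in> ?A" for w using g(1) that by (auto simp: normal_forms_def)
    have kv: "?v w \<noteq> 0 \<and> key (?v w) = key (word_eval [:y:] th w)" if "w \<in> ?A" for w
    proof -
      obtain i j where w: "w = normal_word i j" using nw[OF \<open>w \<in> ?A\<close>] by blast
      have "g w \<noteq> 0" using \<open>w \<in> ?A\<close> by simp
      then show ?thesis using keyw[of i j] unfolding w by (simp add: key_def lead_coeff_smult)
    qed
    have "inj_on (\<lambda>w. key (?v w)) ?A"
    proof (rule inj_onI)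
      fix w w' assume h: "w \<in> ?A" "w' \<in> ?A" "key (?v w) = key (?v w')"
      obtain i j i' j' where w: "w = normal_word i j" "w' = normal_word i' j'" using nw[OF h(1)] nw[OF h(2)] by blast
      have "key (word_eval [:y:] th w) = key (word_eval [:y:] th w')" using kv[OF h(1)] kv[OF h(2)] h(3) by metis
      then show "w = w'" using keyw[of i j] keyw[of i' j'] by (simp add: w)
    qed
    from sum_distinct_keys_nonzero[OF fin A conjunct1[OF kv] this]
    have "sum ?v ?A \<noteq> 0" by (rule conjunct1)
    then show False using g(2) unfolding free_eval_def by blast
  qed
  have "a_kernel FA S ?\<Phi> \<subseteq> ?I"
  proof
    fix f assume "f \<in> a_kernel FA S ?\<Phi>"
    then have f: "f \<in> carrier FA" "?\<Phi> f = 0" unfolding ker by blast+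
    obtain g where g: "g \<in> normal_forms" "f \<ominus>\<^bsub>FA\<^esub> g \<in> ?I" using normal_ordering[OF f(1)] by blast
    have gc: "g \<in> carrier FA" using g(1) by (simp add: normal_forms_def)
    have "?\<Phi> (f \<ominus>\<^bsub>FA\<^esub> g) = 0" using g(2) IK unfolding ker by blast
    moreover have "?\<Phi> ((f \<ominus>\<^bsub>FA\<^esub> g) \<oplus>\<^bsub>FA\<^esub> g) = ?\<Phi> (f \<ominus>\<^bsub>FA\<^esub> g) + ?\<Phi> g" using f(1) gc by simp
    moreover have "(f \<ominus>\<^bsub>FA\<^esub> g) \<oplus>\<^bsub>FA\<^esub> g = f" using f(1) gc by (simp add: a_minus_def F.a_assoc F.l_neg)
    ultimately have "?\<Phi> g = 0" using f(2) by simp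
    then have "g = \<zero>\<^bsub>FA\<^esub>" using nf0[OF g(1)] by (simp add: free_simps)
    then show "f \<in> ?I" using g(2) f(1) by (simp add: a_minus_def)
  qed
  then have K: "a_kernel FA S ?\<Phi> = ?I" using IK by blast
  \<comment> \<open>x and \<theta> can be recovered, since \<open>y\<close> and \<open>th\<close>
    are linear with leading coefficients in K.\<close>
  have surj: "?\<Phi> ` carrier FA = carrier S"
  proof -
    let ?R = "?\<Phi> ` carrier FA"
    have Rm: "u \<star> v \<in> ?R" and Ra: "u + v \<in> ?R" if uv: "u \<in> ?R" "v \<in> ?R" for u v
    proof -
      obtain f g where fg: "u = ?\<Phi> f" "v = ?\<Phi> g" "f \<in> carrier FA" "g \<in> carrier FA" using uv by auto
      have "u \<star> v = ?\<Phi> (f \<otimes>\<^bsub>FA\<^esub> g)" "u + v = ?\<Phi> (f \<oplus>\<^bsub>FA\<^esub> g)" using fg by simp_all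
      then show "u \<star> v \<in> ?R" "u + v \<in> ?R" using mult[OF fg(3,4)] by blast+
    qed
    have Rc: "[:[:k:]:] \<in> ?R" for k using free_eval_const[of "[:y:]" th k] free_const_carrier[of k] by (auto simp: ore_const_def image_iff intro!: bexI[of _ "free_const k"])
    have Rw: "word_eval [:y:] th w \<in> ?R" for w using free_eval_word[of "[:y:]" th w] word_carrier[of w] by (metis image_eqI)
    have Ry: "[:y:] \<in> ?R" and Rt: "th \<in> ?R" using Rw[of "[GX]"] Rw[of "[GY]"] by (simp_all add: R.mult_1_right del: const_mul)
    have y_eq: "y = [:coeff y 0, lead_coeff y:]"
    proof (rule poly_eqI)
      fix i show "coeff y i = coeff [:coeff y 0, lead_coeff y:] i"
        using y by (cases i; cases "i - 1") (auto simp: coeff_eq_0)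
    qed
    have ly: "lead_coeff y \<noteq> 0" using y0 by simp
    have "[:[:0, 1:]:] = [:[:inverse (lead_coeff y):]:] \<star> ([:y:] + [:[:- coeff y 0:]:])"
      by (subst (2) y_eq) (use ly in simp)
    then have Rx: "[:[:0, 1:]:] \<in> ?R" using Rm[OF Rc Ra[OF Ry Rc]] by metis
    have Rf: "[:f:] \<in> ?R" for f
    proof (induction f)
      case 0
      show ?case using Rc[of 0] by simp
    next
      case (pCons k f)
      have "[:pCons k f:] = [:[:k:]:] + [:[:0, 1:]:] \<star> [:f:]" by simp
      then show ?case using Ra[OF Rc Rm[OF Rx pCons(2)]] by metis
    qed
    have th_eq: "th = [:coeff th 0, [:l:]:]"
    proof (rule poly_eqI)
      fix i show "coeff th i = coeff [:coeff th 0, [:l:]:] i"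
        using th by (cases i; cases "i - 1") (auto simp: coeff_eq_0)
    qed
    have "[:0, 1:] = [:[:inverse l:]:] \<star> (th + [:- coeff th 0:])"
      by (subst th_eq) (use th(3) in \<open>simp add: one_pCons\<close>)
    then have Rth: "[:0, 1:] \<in> ?R" using Rm[OF Rc Ra[OF Rt Rf]] by metis
    have "s \<in> ?R" for s
    proof (induction s rule: ore_induct)
      case one then show ?case using Rc[of 1] by (simp add: one_pCons)
    next
      case (smult r s) then show ?case using Rm[OF Rf, of s r] by simp
    next
      case (T s) then show ?case using Rm[OF Rth, of s] by simp
    qed (rule Ra)
    then show ?thesis by auto
  qed
  define \<Psi> where "\<Psi> = (\<lambda>X. the_elem (?\<Phi> ` X))"
  have iso: "\<Psi> \<in> ring_iso (presented_algebra (skew_rels p e)) S"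
    using H.FactRing_iso_set[OF surj] unfolding K presented_algebra_def \<Psi>_def .
  interpret I: ideal ?I "FA :: (generator list \<Rightarrow> 'k) ring" by (rule F.genideal_ideal[OF sub])
  have "ring (presented_algebra (skew_rels p e))" unfolding presented_algebra_def by (rule I.quotient_is_ring)
  then have inv: "inv_into (carrier (presented_algebra (skew_rels p e))) \<Psi> \<in> ring_iso S (presented_algebra (skew_rels p e))"
    using iso by (rule ring_iso_set_sym)
  have "inv_into (carrier (presented_algebra (skew_rels p e))) \<Psi> (ore_const k) = presented_const (skew_rels p e) k" for k
  proof -
    have "\<Psi> (presented_const (skew_rels p e) k) = ?\<Phi> (free_const k)"
      using H.the_elem_simp[OF free_const_carrier, of k] unfolding K \<Psi>_def presented_const_def .
    then have "\<Psi> (presented_const (skew_rels p e) k) = ore_const k" by (simp add: free_eval_const)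
    moreover have "presented_const (skew_rels p e) k \<in> carrier (presented_algebra (skew_rels p e))"
      unfolding presented_const_def presented_algebra_def FactRing_def A_RCOSETS_def' by (auto intro!: bexI[of _ "free_const k"])
    moreover have "inj_on \<Psi> (carrier (presented_algebra (skew_rels p e)))"
      using iso by (auto simp: ring_iso_def bij_betw_def)
    ultimately show ?thesis by (metis inv_into_f_f)
  qed
  then show ?thesis using inv unfolding K_algebra_isomorphic_def by blast
qed

end

section \<open>The equivalences\<close>

context ore
begin

lemma spow_x: "\<exists>\<beta>. (\<sigma> ^^ n) [:0, 1:] = [:\<beta>, q ^ n:]"
proof (induction n)
  case (Suc n)
  then obtain \<beta> where "(\<sigma> ^^ n) [:0, 1:] = [:\<beta>, q ^ n:]" by blast
  then have "(\<sigma> ^^ Suc n) [:0, 1:] = \<sigma> [:\<beta>, q ^ n:]" by simp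
  also have "\<dots> = [:\<beta> + b * q ^ n, q ^ Suc n:]" by (simp add: s_pcompose pcompose_pCons mult.commute)
  finally show ?case by blast
qed simp

lemma spow_x_shift: "q = 1 \<Longrightarrow> (\<sigma> ^^ n) [:0, 1:] = [:of_nat n * b, 1:]"
proof (induction n)
  case (Suc n)
  then have "(\<sigma> ^^ Suc n) [:0, 1:] = \<sigma> [:of_nat n * b, 1:]" by simp
  also have "\<dots> = [:of_nat (Suc n) * b, 1:]"
    using Suc.prems by (simp add: s_pcompose pcompose_pCons algebra_simps)
  finally show ?case .
qed simp

lemma sigma_id_iff: "\<sigma> = id \<longleftrightarrow> q = 1 \<and> b = 0"
proof
  assume "\<sigma> = id"
  then show "q = 1 \<and> b = 0" using sx by simp
next
  assume "q = 1 \<and> b = 0"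
  then show "\<sigma> = id" by (simp add: fun_eq_iff s_pcompose pcompose_idR)
qed

lemma derivation_pderiv:
  assumes sid: "\<sigma> = id" shows "d f = d [:0, 1:] * pderiv f"
proof (induction f)
  case (pCons k f)
  have "d (pCons k f) = d ([:k:] + [:0, 1:] * f)" by simp
  also have "\<dots> = [:0, 1:] * d f + d [:0, 1:] * f" unfolding d_add d_mult using sid by simp
  finally show ?case using pCons by (simp add: pderiv_pCons algebra_simps)
qed simp

text \<open>Applying d to x f = f x in both orders gives (\<sigma>(x) - x) d(f) = 0.\<close>

lemma invariant_derivation_zero:
  assumes "\<sigma> \<noteq> id" "\<sigma> f = f" shows "d f = 0"
proof -
  have "d ([:0, 1:] * f) = d (f * [:0, 1:])" by (simp only: mult.commute)
  then have "[:b, q:] * d f + d [:0, 1:] * f = f * d [:0, 1:] + d f * [:0, 1:]"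
    by (simp only: d_mult sx assms(2))
  moreover have "(u - v) * e = 0" if "u * e + w * f = f * w + e * v" for u v w e :: "'k poly"
    using that by (simp add: algebra_simps)
  ultimately have "([:b, q:] - [:0, 1:]) * d f = 0" by blast
  moreover have "[:b, q:] - [:0, 1:] \<noteq> 0" using assms(1) by (auto simp: sigma_id_iff)
  ultimately show ?thesis by (metis mult_eq_0_iff)
qed

text \<open>y = x + b/(q - 1) is an eigenvector of \<sigma> for q. Divide d(y) by y: the quotient is
  absorbed by the shift h of \<theta>, and the remainder is the constant c.\<close>

lemma normalized_exists:
  assumes "q \<noteq> 1"
  shows "\<exists>y h c. normalized_ore \<sigma> d q b y h c"
proof -
  define y where "y = [:b / (q - 1), 1:]"
  define h where "h = smult (inverse (1 - q)) (d y div y)"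
  have sy: "\<sigma> y = smult q y" using assms by (simp add: y_def s_pcompose pcompose_pCons field_simps)
  have "degree (d y mod y) < 1" using degree_mod_less'[of y "d y"] by (cases "d y mod y = 0") (auto simp: y_def)
  then obtain c where c: "d y mod y = [:c:]" by (metis degree_eq_zeroE less_one)
  have "smult (1 - q) (h * y) = d y div y * y" using assms by (simp add: h_def)
  then have "d y = smult (1 - q) (h * y) + [:c:]" using c by (metis div_mult_mod_eq)
  then have "normalized_ore \<sigma> d q b y h c"
    using sy by unfold_locales (auto simp: y_def)
  then show ?thesis by blast
qed

lemma commutant_all:
  assumes f: "\<And>f. [:f:] \<star> w = w \<star> [:f:]" and x: "[:0, 1:] \<star> w = w \<star> [:0, 1:]"
  shows "s \<star> w = w \<star> s"
proof (induction s rule: ore_induct)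
  case (add s t)
  then show ?case by (simp add: R.distrib_left R.distrib_right)
next
  case (smult r s)
  have "smult r s \<star> w = [:r:] \<star> (w \<star> s)" using smult by simp
  also have "\<dots> = w \<star> ([:r:] \<star> s)" unfolding R.mult.assoc[symmetric] f ..
  finally show ?case by simp
next
  case (T s)
  have "T s \<star> w = [:0, 1:] \<star> (w \<star> s)" using T by (simp add: T_mul)
  also have "\<dots> = w \<star> ([:0, 1:] \<star> s)" unfolding R.mult.assoc[symmetric] x ..
  finally show ?case by simp
qed simp

lemma rational_ring_S: "rational_ring S (\<lambda>r. [:[:of_rat r:]:])"
  by (intro rational_ring.intro rational_ring_axioms.intro ring_S) (simp_all add: of_rat_add of_rat_mult one_pCons)

text \<open>If b = 0, taking constant terms in \<theta> is multiplicative modulo d(x), so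
  commutators have constant term divisible by d(x), which is not a unit. If b \<noteq> 0, there is a
  character of S with values in K, and it kills commutators.\<close>

lemma commutator_not_one:
  assumes q: "q = 1" and nc: "b \<noteq> 0 \<or> degree (d [:0, 1:]) > 0"
  shows "u \<star> v - v \<star> u \<noteq> 1"
proof
  assume eq: "u \<star> v - v \<star> u = 1"
  show False
  proof (cases "b = 0")
    case True
    then have sid: "\<sigma> = id" using q sigma_id_iff by blast
    let ?p = "d [:0, 1:]"
    have "?p dvd coeff (u \<star> v) 0 - coeff u 0 * coeff v 0" for u v
    proof (induction u rule: ore_induct)
      case (add s t)
      have "coeff ((s + t) \<star> v) 0 - coeff (s + t) 0 * coeff v 0 =
        (coeff (s \<star> v) 0 - coeff s 0 * coeff v 0) + (coeff (t \<star> v) 0 - coeff t 0 * coeff v 0)"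
        by (simp add: R.distrib_right algebra_simps)
      then show ?case using add by (metis dvd_add)
    next
      case (smult r s)
      have "coeff (smult r s \<star> v) 0 - coeff (smult r s) 0 * coeff v 0 = r * (coeff (s \<star> v) 0 - coeff s 0 * coeff v 0)"
        by (simp add: algebra_simps)
      then show ?case using smult by (metis dvd_mult)
    next
      case (T s)
      have "coeff (T a) 0 = ?p * pderiv (coeff a 0)" for a
        using derivation_pderiv[OF sid, of "coeff a 0"] by (simp add: coeff_T)
      then show ?case by (simp add: T_mul)
    qed simp
    from dvd_diff[OF this[of u v] this[of v u]]
    have "?p dvd coeff (u \<star> v - v \<star> u) 0" by (simp add: algebra_simps)
    then have "?p dvd 1" unfolding eq by simp
    moreover have "?p \<noteq> 0" using nc True by auto
    ultimately have "degree ?p = 0" using is_unit_iff_degree by blast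
    then show False using nc True by simp
  next
    case False
    note df = shift_derivation[OF q False]
    \<comment> \<open>The character sends x to 0 and \<theta> to \<tau>. As z = \<theta> + d(x)/b
      satisfies z x = (x + b) z, the image of z must vanish, which determines \<tau>.\<close>
    define \<tau> where "\<tau> = - poly (smult (inverse b) (d [:0, 1:])) 0"
    define \<epsilon> where "\<epsilon> u = poly (map_poly (\<lambda>f. poly f 0) u) \<tau>" for u :: "'k poly poly"
    have e_pCons: "\<epsilon> (pCons f u) = poly f 0 + \<tau> * \<epsilon> u" for f u
      by (simp add: \<epsilon>_def map_poly_pCons)
    have e_add: "\<epsilon> (u + v) = \<epsilon> u + \<epsilon> v" for u v
    proof -
      have "map_poly (\<lambda>f. poly f 0) (u + v) = map_poly (\<lambda>f. poly f 0) u + map_poly (\<lambda>f. poly f 0) v"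
        by (rule poly_eqI) (simp add: coeff_map_poly)
      then show ?thesis by (simp add: \<epsilon>_def)
    qed
    have e_0: "\<epsilon> 0 = 0" by (simp add: \<epsilon>_def)
    have e_smult: "\<epsilon> (smult f u) = poly f 0 * \<epsilon> u" for f u
      by (induction u) (simp_all add: e_0 e_pCons algebra_simps)
    have e_T: "\<epsilon> (T u) = \<tau> * \<epsilon> u" for u
    proof (induction u)
      case (pCons f u)
      have "poly (d f) 0 = (poly (\<sigma> f) 0 - poly f 0) * - \<tau>" unfolding \<tau>_def by (subst df) simp
      then show ?case using pCons(2)
        by (simp add: T_pCons e_pCons e_add e_0 algebra_simps)
    qed (simp add: e_0)
    have e_1: "\<epsilon> 1 = 1" by (simp add: one_pCons e_pCons e_0)
    have "\<epsilon> (u \<star> v) = \<epsilon> u * \<epsilon> v" for u v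
    proof (induction u rule: ore_induct)
      case one
      show ?case by (simp add: e_1)
    qed (simp_all add: R.distrib_right e_add e_smult T_mul e_T algebra_simps)
    then have "\<epsilon> (u \<star> v) = \<epsilon> (v \<star> u)" by (simp add: mult.commute)
    moreover have "\<epsilon> (u \<star> v) = \<epsilon> (v \<star> u) + \<epsilon> 1" using eq e_add[of "v \<star> u" 1] by (simp add: algebra_simps)
    ultimately show False using e_1 by simp
  qed
qed

end

section \<open>Central powers of t and the presentations of S\<close>

context normalized_ore
begin

text \<open>Each of the m + 1 commutations contributes c times a power of q, and the powers add up
  to a q-integer.\<close>

lemma t_power_y: "(t \<up> Suc m) \<star> [:y:] = smult (smult (q ^ Suc m) y) (t \<up> Suc m) + smult [:c * (\<Sum>i\<le>m. q ^ i):] (t \<up> m)"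
proof (induction m)
  case 0
  have "smult [:c:] 1 = [:[:c:]:]" by (simp add: one_pCons)
  then show ?case using ty by simp
next
  case (Suc m)
  have e: "t \<star> smult (smult k y) v = smult [:k:] ((t \<star> [:y:]) \<star> v)" for k v
  proof -
    have "smult (smult k y) v = smult [:k:] ([:y:] \<star> v)" by simp
    then show ?thesis by (simp only: mul_smult_const R.mult.assoc)
  qed
  have "(t \<up> Suc (Suc m)) \<star> [:y:] = t \<star> ((t \<up> Suc m) \<star> [:y:])" by (simp add: R.mult.assoc)
  also have "\<dots> = smult [:q ^ Suc m:] ((t \<star> [:y:]) \<star> (t \<up> Suc m)) + smult [:c * (\<Sum>i\<le>m. q ^ i):] (t \<up> Suc m)"
    unfolding Suc R.distrib_left e mul_smult_const by simp
  also have "(t \<star> [:y:]) \<star> (t \<up> Suc m) = smult (smult q y) (t \<up> Suc (Suc m)) + smult [:c:] (t \<up> Suc m)"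
    unfolding ty R.distrib_right by simp
  also have "smult [:q ^ Suc m:] (smult (smult q y) (t \<up> Suc (Suc m)) + smult [:c:] (t \<up> Suc m)) + smult [:c * (\<Sum>i\<le>m. q ^ i):] (t \<up> Suc m)
      = smult (smult (q ^ Suc (Suc m)) y) (t \<up> Suc (Suc m)) + smult ([:q ^ Suc m * c:] + [:c * (\<Sum>i\<le>m. q ^ i):]) (t \<up> Suc m)"
    unfolding smult_add_right smult_add_left by (simp add: mult.commute)
  also have "[:q ^ Suc m * c:] + [:c * (\<Sum>i\<le>m. q ^ i):] = [:c * (\<Sum>i\<le>Suc m. q ^ i):]"
    by (simp add: algebra_simps)
  finally show ?case .
qed

text \<open>If q^n = 1 and q \<noteq> 1, the q-integer 1 + q + ... + q^(n-1) vanishes, so t^n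
  commutes with y; for c = 0 this term is absent. Then t^n commutes with K[x] and with \<theta> = t
  + h.\<close>

lemma t_power_central:
  assumes n: "n > 0" "q ^ n = 1" "q \<noteq> 1 \<or> c = 0"
  shows "s \<star> (t \<up> n) = (t \<up> n) \<star> s"
proof (rule commutant_all)
  obtain m where m: "n = Suc m" using n(1) by (cases n) auto
  have "c * (\<Sum>i\<le>m. q ^ i) = 0"
  proof (cases "c = 0")
    case False
    then have "(q - 1) * (\<Sum>i<n. q ^ i) = 0" using n power_diff_1_eq[of q n] by simp
    then show ?thesis using False n(3) by (simp add: m lessThan_Suc_atMost)
  qed simp
  then have Y: "(t \<up> n) \<star> [:y:] = smult y (t \<up> n)" using t_power_y[of m] n(2) unfolding m by simp
  show F: "[:f:] \<star> (t \<up> n) = (t \<up> n) \<star> [:f:]" for f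
  proof (induction f rule: y_induct)
    case (step k f)
    have e: "[:[:k:] + y * f:] = [:[:k:]:] + [:y:] \<star> [:f:]" by simp
    have "(t \<up> n) \<star> ([:y:] \<star> [:f:]) = ([:y:] \<star> (t \<up> n)) \<star> [:f:]" unfolding R.mult.assoc[symmetric] Y by simp
    also have "\<dots> = ([:y:] \<star> [:f:]) \<star> (t \<up> n)" unfolding R.mult.assoc step ..
    finally show ?case unfolding e R.distrib_left R.distrib_right const_comm by simp
  qed simp
  have "[:0, 1:] = t + [:h:]" by (simp add: t_def)
  then show "[:0, 1:] \<star> (t \<up> n) = (t \<up> n) \<star> [:0, 1:]"
    unfolding \<open>[:0, 1:] = t + [:h:]\<close> R.distrib_left R.distrib_right F
    by (simp only: R.power_commutes)
qed

lemma t_power_degree: "degree (t \<up> n) = n \<and> lead_coeff (t \<up> n) = 1"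
proof (induction n)
  case (Suc n)
  have td: "degree t = 1" "lead_coeff t = 1" by (simp_all add: t_def)
  have one: "(\<sigma> ^^ i) 1 = 1" for i using spow_const[of i 1] by (simp add: one_pCons)
  have IH: "degree (t \<up> n) = n" "lead_coeff (t \<up> n) = 1" using Suc by blast+
  have nz: "t \<noteq> 0" "t \<up> n \<noteq> 0" using td IH(2) by (metis leading_coeff_0_iff one_neq_zero)+
  have "lead_coeff (t \<star> (t \<up> n)) = lead_coeff t * (\<sigma> ^^ degree t) (lead_coeff (t \<up> n))" by (rule lead_coeff_mul[OF nz])
  also have "\<dots> = 1" unfolding IH(2) td(2) one by simp
  finally have L: "lead_coeff (t \<star> (t \<up> n)) = 1" .
  have "degree (t \<star> (t \<up> n)) = Suc n" using degree_mul_lead(2)[OF nz] IH(1) td(1) by simp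
  then show ?case unfolding R.power.power_Suc using L by blast
qed simp

text \<open>The relation t y = q y t + c is that of the plane for c = 0; for c \<noteq> 0 dividing t
  by c gives the Weyl relation.\<close>

lemma normalized_presented:
  "K_algebra_isomorphic S ore_const (presented_algebra (quantum_plane_rels q)) (presented_const (quantum_plane_rels q)) \<or>
   K_algebra_isomorphic S ore_const (presented_algebra (quantum_weyl_rels q)) (presented_const (quantum_weyl_rels q))"
proof (cases "c = 0")
  case True
  have "K_algebra_isomorphic S ore_const (presented_algebra (skew_rels q 0)) (presented_const (skew_rels q 0))"
    by (rule presented_iso[where y = y and th = t and l = 1]) (use y ty True in \<open>auto simp: t_def one_pCons\<close>)
  then show ?thesis by (simp add: skew_rels_plane)
next
  case False
  let ?t = "smult [:inverse c:] t"
  have e: "?t \<star> [:y:] = smult (smult q y) ?t + [:[:1:]:]" using False by (simp add: ty smult_add_right mult.commute)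
  have "K_algebra_isomorphic S ore_const (presented_algebra (skew_rels q 1)) (presented_const (skew_rels q 1))"
    by (rule presented_iso[where y = y and th = ?t and l = "inverse c", OF _ _ _ _ e])
       (use y False in \<open>auto simp: t_def\<close>)
  then show ?thesis by (simp add: skew_rels_weyl)
qed

end

text \<open>Supplies the concrete models of K[x,y] and of the first Weyl algebra with which S is
  compared.\<close>

lemma ore_derivation:
  fixes D :: "'k::field_char_0 poly \<Rightarrow> 'k poly"
  assumes "\<And>f g. D (f + g) = D f + D g" "\<And>f g. D (f * g) = f * D g + D f * g" "\<And>k f. D (smult k f) = smult k (D f)"
  shows "ore id D 1 0"
proof (rule ore.intro)
  show "ring_automorphism (id :: 'k poly \<Rightarrow> 'k poly)" by (simp add: ring_automorphism_def)
  show "sigma_derivation id D" using assms by (simp add: sigma_derivation_def)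
  have vs: "vector_space (smult :: 'k \<Rightarrow> 'k poly \<Rightarrow> 'k poly)"
    by unfold_locales (simp_all add: smult_add_right smult_add_left)
  show "K_linear (id :: 'k poly \<Rightarrow> 'k poly)" "K_linear D"
    using vs assms by (auto simp: Vector_Spaces.linear_iff)
qed simp

context ore
begin

lemma isomorphic_ring_iso:
  assumes "K_algebra_isomorphic S ore_const P i" "K_algebra_isomorphic S' ore_const P i'" and S': "ring S'"
  obtains h where "h \<in> ring_iso S S'"
proof -
  obtain f g where "f \<in> ring_iso S P" "g \<in> ring_iso S' P" using assms(1,2) by (auto simp: K_algebra_isomorphic_def)
  then have "inv_into (carrier S') g \<circ> f \<in> ring_iso S S'"
    by (intro ring_iso_set_trans[of f S P] ring_iso_set_sym[OF S'])
  then show ?thesis by (rule that)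
qed

text \<open>The commutative polynomial ring, as an Ore extension with zero derivation, has the same
  presentation, so S would be commutative.\<close>

lemma plane_iso_commutative:
  assumes q: "q = 1" and iso: "K_algebra_isomorphic S ore_const (presented_algebra (quantum_plane_rels 1)) (presented_const (quantum_plane_rels 1))"
  shows "b = 0 \<and> d [:0, 1:] = 0"
proof -
  define D :: "'k poly \<Rightarrow> 'k poly" where "D = (\<lambda>f. 0)"
  have D: "D f = 0" for f by (simp add: D_def)
  define E :: "'k poly \<Rightarrow> 'k poly" where "E = id"
  have E: "E f = f" for f by (simp add: E_def)
  interpret P: ore E D 1 0 unfolding E_def by (rule ore_derivation) (simp_all add: D)
  have TP: "P.T u = pCons 0 u" for u
    by (rule poly_eqI) (auto simp: P.coeff_T D E coeff_pCons split: nat.split)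
  have mult: "P.mul u v = u * v" for u v
  proof (induction u rule: P.ore_induct)
    case (T s) then show ?case unfolding P.T_mul unfolding TP by simp
  qed (simp_all add: P.R.distrib_right distrib_right)
  have "P.mul [:0, 1:] [:[:0, 1:]:] = smult (smult 1 [:0, 1:]) [:0, 1:] + [:[:0:]:]" unfolding mult by simp
  then have "K_algebra_isomorphic P.S ore_const (presented_algebra (quantum_plane_rels 1)) (presented_const (quantum_plane_rels 1))"
    unfolding skew_rels_plane by (intro P.presented_iso[where y = "[:0, 1:]" and th = "[:0, 1:]" and l = 1]) (simp_all add: one_pCons)
  then obtain g where g: "g \<in> ring_iso S P.S" using isomorphic_ring_iso[OF iso _ P.ring_S] by blast
  then have inj: "inj g" and gm: "\<And>u v. g (u \<star> v) = P.mul (g u) (g v)"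
    by (auto simp: ring_iso_def ring_hom_def bij_betw_def)
  have "g ([:0, 1:] \<star> [:[:0, 1:]:]) = g ([:[:0, 1:]:] \<star> [:0, 1:])" unfolding gm mult by (rule mult.commute)
  then have "[:0, 1:] \<star> [:[:0, 1:]:] = [:[:0, 1:]:] \<star> [:0, 1:]" using inj by (simp only: inj_eq)
  then have "[:d [:0, 1:], \<sigma> [:0, 1:]:] = [:0, [:0, 1:]:]" by (simp add: T_pCons)
  then show ?thesis using sx by simp
qed

text \<open>The Ore extension of K[x] by d/dx has the same presentation. There \<theta> x - x
  \<theta> = 1, so 1 would be a commutator in S.\<close>

lemma weyl_iso_constant:
  assumes q: "q = 1" and iso: "K_algebra_isomorphic S ore_const (presented_algebra (quantum_weyl_rels 1)) (presented_const (quantum_weyl_rels 1))"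
  shows "b = 0 \<and> degree (d [:0, 1:]) = 0"
proof (rule ccontr)
  assume nc: "\<not> ?thesis"
  define E :: "'k poly \<Rightarrow> 'k poly" where "E = id"
  have E: "E f = f" for f by (simp add: E_def)
  have o1: "[:1:] = (1 :: 'k poly)" and o2: "(1 :: 'k poly poly) = [:1:]" by (simp_all add: one_pCons)
  interpret P: ore E "pderiv :: 'k poly \<Rightarrow> 'k poly" 1 0
    unfolding E_def by (rule ore_derivation) (simp_all add: pderiv_add pderiv_mult pderiv_smult mult.commute)
  have "pderiv [:0, 1:] = (1 :: 'k poly)" by (simp add: pderiv_pCons one_pCons)
  then have Tx: "P.T [:[:0, 1:]:] = [:1, [:0, 1:]:]" using P.T_pCons[of "[:0, 1:]" 0] by (simp only: P.T_zero E add_0_right)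
  have rel: "P.mul [:0, 1:] [:[:0, 1:]:] = smult (smult 1 [:0, 1:]) [:0, 1:] + [:[:1:]:]"
    using Tx by (simp add: o1)
  then have "K_algebra_isomorphic P.S ore_const (presented_algebra (quantum_weyl_rels 1)) (presented_const (quantum_weyl_rels 1))"
    unfolding skew_rels_weyl by (intro P.presented_iso[where y = "[:0, 1:]" and th = "[:0, 1:]" and l = 1]) (simp_all add: one_pCons)
  then obtain g where g: "g \<in> ring_iso S P.S" using isomorphic_ring_iso[OF iso _ P.ring_S] by blast
  then have bij: "bij g" and gm: "\<And>u v. g (u \<star> v) = P.mul (g u) (g v)" and ga: "\<And>u v. g (u + v) = g u + g v" and g1: "g 1 = 1"
    by (auto simp: ring_iso_def ring_hom_def)
  obtain u v where uv: "g u = [:0, 1:]" "g v = [:[:0, 1:]:]" using bij by (metis bij_pointE)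
  have "g (u \<star> v) = g (v \<star> u + 1)" unfolding ga gm g1 uv by (simp add: Tx o2)
  then have "u \<star> v = v \<star> u + 1" using bij by (simp add: bij_def inj_eq)
  then have "u \<star> v - v \<star> u = 1" by simp
  then show False using commutator_not_one[OF q] nc by auto
qed

end

text \<open>For q = 1 and b \<noteq> 0 the map \<sigma> is a translation of infinite order, and (a),
  (b) and (d) fail even when d(x) is constant. This is why the second alternative of
  \<open>c_parameters\<close> asks for b = 0.\<close>

theorem theorem4p2:
  fixes \<sigma> d :: "'k::field_char_0 poly \<Rightarrow> 'k poly" and q b :: 'k
  assumes "ring_automorphism \<sigma>" and "K_linear \<sigma>"
    and "sigma_derivation \<sigma> d" and "K_linear d"
    and "\<sigma> [:0, 1:] = [:b, q:]"
  defines "S \<equiv> ore_extension \<sigma> d"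
  defines "a_diamond \<equiv> diamond_property S"
    and "b_iso \<equiv>
      (K_algebra_isomorphic S ore_const
         (presented_algebra (quantum_plane_rels q)) (presented_const (quantum_plane_rels q)) \<or>
       K_algebra_isomorphic S ore_const
         (presented_algebra (quantum_weyl_rels q)) (presented_const (quantum_weyl_rels q))) \<and>
      (\<exists>n>0. q ^ n = 1)"
    and "c_parameters \<equiv>
      (q \<noteq> 1 \<and> (\<exists>n>0. q ^ n = 1)) \<or> (q = 1 \<and> b = 0 \<and> degree (d [:0, 1:]) = 0)"
    and "d_finite_order \<equiv>
      (\<sigma> \<noteq> id \<and> (\<exists>n>0. \<sigma> ^^ n = id)) \<or> (\<sigma> = id \<and> (\<forall>a. \<exists>n>0. (d ^^ n) a = 0))"
  shows "(a_diamond \<longleftrightarrow> b_iso) \<and> (b_iso \<longleftrightarrow> c_parameters) \<and> (c_parameters \<longleftrightarrow> d_finite_order)"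
proof -
  interpret O: ore \<sigma> d q b using assms(1-5) by (rule ore.intro)
  \<comment> \<open>For \<sigma> = id the relation \<theta> x = x \<theta> + c is already normal,
    with y = x and h = 0.\<close>
  have norm1: "\<exists>c. normalized_ore \<sigma> d q b [:0, 1:] 0 c" if "q = 1" "b = 0" "degree (d [:0, 1:]) = 0"
  proof -
    obtain c where "d [:0, 1:] = [:c:]" using \<open>degree (d [:0, 1:]) = 0\<close> by (metis degree_eq_zeroE)
    then show ?thesis using that assms(5) by (intro exI[of _ c]) (unfold_locales, auto)
  qed
  \<comment> \<open>In the coordinate y the map \<sigma> is scaling by q.\<close>
  have root_pow: "\<sigma> ^^ n = id" if "q \<noteq> 1" "q ^ n = 1" for n
  proof -
    obtain y h c where "normalized_ore \<sigma> d q b y h c" using O.normalized_exists[OF \<open>q \<noteq> 1\<close>] by blast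
    then interpret N: normalized_ore \<sigma> d q b y h c .
    have "(\<sigma> ^^ k) y = smult (q ^ k) y" for k
      by (induction k) (simp_all add: O.s_smult N.sy mult.commute)
    then have y: "(\<sigma> ^^ n) y = y" using \<open>q ^ n = 1\<close> by simp
    show ?thesis
    proof
      fix f show "(\<sigma> ^^ n) f = id f"
        by (induction f rule: N.y_induct) (simp_all add: O.spow_add O.spow_mult y)
    qed
  qed
  have cb: "b_iso" if c: c_parameters
  proof (cases "q = 1")
    case True
    then have "b = 0" "degree (d [:0, 1:]) = 0" using c unfolding c_parameters_def by auto
    then obtain c where "normalized_ore \<sigma> d q b [:0, 1:] 0 c" using norm1[OF True] by blast
    from normalized_ore.normalized_presented[OF this] show ?thesis
      unfolding b_iso_def S_def using True by (auto intro: exI[of _ 1])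
  next
    case False
    then obtain y h c where "normalized_ore \<sigma> d q b y h c" using O.normalized_exists by blast
    from normalized_ore.normalized_presented[OF this] show ?thesis
      using c False unfolding b_iso_def S_def c_parameters_def by blast
  qed
  have bc: c_parameters if bi: b_iso
  proof (cases "q = 1")
    case True
    then show ?thesis
      using bi O.plane_iso_commutative[OF True] O.weyl_iso_constant[OF True]
      unfolding b_iso_def c_parameters_def S_def by auto
  next
    case False
    then show ?thesis using bi unfolding b_iso_def c_parameters_def by blast
  qed
  have ca: a_diamond if c: c_parameters
    unfolding a_diamond_def
  proof (rule diamond_propertyI)
    fix I assume I: "monolithic S I"
    show "dcc_above S I"
    proof (cases "q = 1")
      case True
      then have b0: "b = 0" and dx: "degree (d [:0, 1:]) = 0" using c unfolding c_parameters_def by auto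
      then have sid: "\<sigma> = id" using True O.sigma_id_iff by blast
      obtain c where N: "normalized_ore \<sigma> d q b [:0, 1:] 0 c" using norm1[OF True b0 dx] by blast
      interpret N: normalized_ore \<sigma> d q b "[:0, 1:]" 0 c by (rule N)
      have dc: "d [:0, 1:] = [:c:]" using N.dy True by simp
      have dd: "d r = smult c (pderiv r)" for r using O.derivation_pderiv[OF sid, of r] dc by simp
      show ?thesis
      proof (cases "c = 0")
        case True
        \<comment> \<open>Here d = 0, the ring is commutative, and t = \<theta> serves as the
          central element of positive degree.\<close>
        have cen: "s \<in> UNIV \<Longrightarrow> ore_mult \<sigma> d s (power.power 1 (ore_mult \<sigma> d) N.t 1) = ore_mult \<sigma> d (power.power 1 (ore_mult \<sigma> d) N.t 1) s" for s
          by (rule N.t_power_central) (use \<open>q = 1\<close> True in auto)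
        show ?thesis unfolding S_def
          by (rule O.finite_over_centre_dcc[where n = 1 and w = "power.power 1 (ore_mult \<sigma> d) N.t 1"])
             (use cen N.t_power_degree[of 1] I True dd sid in \<open>auto simp: S_def\<close>)
      next
        case False
        obtain P where "P \<in> I" "P \<noteq> 0" using O.monolithic_nonzero I unfolding S_def by blast
        then show ?thesis unfolding S_def using O.weyl_dcc[OF sid False dd] by blast
      qed
    next
      case False
      then obtain n where n: "n > 0" "q ^ n = 1" using c unfolding c_parameters_def by blast
      obtain y h c where "normalized_ore \<sigma> d q b y h c" using O.normalized_exists[OF False] by blast
      then interpret N: normalized_ore \<sigma> d q b y h c .
      have sid: "\<sigma> \<noteq> id" using False O.sigma_id_iff by blast
      show ?thesis unfolding S_def
      proof (rule O.finite_over_centre_dcc[where n = n and w = "power.power 1 (ore_mult \<sigma> d) N.t n"])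
        show "\<sigma> ^^ n = id" by (rule root_pow[OF False n(2)])
        show "d f = 0" if "\<sigma> f = f" for f by (rule O.invariant_derivation_zero[OF sid that])
        show "ore_mult \<sigma> d s (power.power 1 (ore_mult \<sigma> d) N.t n) = ore_mult \<sigma> d (power.power 1 (ore_mult \<sigma> d) N.t n) s" for s
          by (rule N.t_power_central) (use n False in auto)
      qed (use n N.t_power_degree[of n] I in \<open>auto simp: S_def\<close>)
    qed
  qed
  have ac: c_parameters if a: a_diamond
  proof (rule ccontr)
    assume nc: "\<not> c_parameters"
    have "\<exists>I. monolithic S I \<and> \<not> dcc_above S I"
    proof (cases "\<exists>n>0. q ^ n = 1")
      case False
      then have nru: "\<And>n. n > 0 \<Longrightarrow> q ^ n \<noteq> 1" by blast
      then have "q \<noteq> 1" by force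
      then obtain y h c where "normalized_ore \<sigma> d q b y h c" using O.normalized_exists by blast
      then show ?thesis unfolding S_def using normalized_ore.nonroot_no_dcc nru by blast
    next
      case True
      then have q: "q = 1" and nb: "b \<noteq> 0 \<or> degree (d [:0, 1:]) > 0" using nc unfolding c_parameters_def by auto
      show ?thesis
      proof (cases "b = 0")
        case True
        then have sid: "\<sigma> = id" using q O.sigma_id_iff by blast
        show ?thesis unfolding S_def
          by (rule O.differential_no_dcc[OF sid O.derivation_pderiv[OF sid]]) (use nb True in simp)
      qed (use O.shift_no_dcc[OF q] in \<open>simp add: S_def\<close>)
    qed
    then obtain I where "monolithic S I" "\<not> dcc_above S I" by blast
    then show False
      using rational_ring.dcc_aboveI_diamond[OF O.rational_ring_S] a unfolding a_diamond_def S_def by blast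
  qed
  have cd: d_finite_order if c: c_parameters
  proof (cases "q = 1")
    case True
    then have b0: "b = 0" and dx: "degree (d [:0, 1:]) = 0" using c unfolding c_parameters_def by auto
    then have sid: "\<sigma> = id" using True O.sigma_id_iff by blast
    obtain k where k: "d [:0, 1:] = [:k:]" using dx by (metis degree_eq_zeroE)
    have dd: "d f = smult k (pderiv f)" for f using O.derivation_pderiv[OF sid, of f] k by simp
    have "(d ^^ Suc n) a = 0" if "degree a \<le> n" for n a
      using that
    proof (induction n arbitrary: a)
      case 0
      then have "pderiv a = 0" by (simp add: pderiv_eq_0_iff)
      then show ?case by (simp add: dd)
    next
      case (Suc n)
      have "degree (d a) \<le> degree a - 1" by (simp add: dd Polynomial.degree_pderiv)
      then have "degree (d a) \<le> n" using Suc.prems by linarith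
      from Suc.IH[OF this] show ?case by (simp add: funpow_swap1)
    qed
    then show ?thesis using sid unfolding d_finite_order_def by blast
  next
    case False
    then obtain n where "n > 0" "q ^ n = 1" using c unfolding c_parameters_def by blast
    then show ?thesis using root_pow[OF False] False O.sigma_id_iff unfolding d_finite_order_def by blast
  qed
  have dc: c_parameters if df: d_finite_order
  proof (cases "\<sigma> = id")
    case True
    then have nil: "\<And>a. \<exists>n>0. (d ^^ n) a = 0" using df unfolding d_finite_order_def by blast
    have "degree (d [:0, 1:]) = 0"
    proof (rule ccontr)
      assume pos: "degree (d [:0, 1:]) \<noteq> 0"
      \<comment> \<open>If d(x) has positive degree, d = d(x) d/dx never lowers the degree of a
        nonconstant polynomial, so no power of d kills x.\<close>
      have "degree ((d ^^ n) [:0, 1:]) \<ge> 1" for n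
      proof (induction n)
        case (Suc n)
        let ?f = "(d ^^ n) [:0, 1:]"
        have "pderiv ?f \<noteq> 0" using Suc by (simp add: pderiv_eq_0_iff)
        moreover have "d [:0, 1:] \<noteq> 0" using pos by auto
        ultimately have "degree (d ?f) = degree (d [:0, 1:]) + (degree ?f - 1)"
          unfolding O.derivation_pderiv[OF True, of ?f] by (simp add: degree_mult_eq Polynomial.degree_pderiv)
        then show ?case using pos by simp
      qed simp
      then show False using nil[of "[:0, 1:]"] by (metis degree_0 not_one_le_zero)
    qed
    then show ?thesis using True O.sigma_id_iff unfolding c_parameters_def by blast
  next
    case False
    then obtain n where n: "n > 0" "\<sigma> ^^ n = id" using df unfolding d_finite_order_def by blast
    obtain \<beta> where "(\<sigma> ^^ n) [:0, 1:] = [:\<beta>, q ^ n:]" using O.spow_x by blast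
    then have qn: "q ^ n = 1" using n(2) by simp
    have "q \<noteq> 1"
    proof
      assume q: "q = 1"
      then have "of_nat n * b = 0" using O.spow_x_shift[OF q, of n] n(2) by simp
      then have "b = 0" using n(1) by simp
      then show False using q False O.sigma_id_iff by blast
    qed
    then show ?thesis using n(1) qn unfolding c_parameters_def by blast
  qed
  show ?thesis using ca ac cb bc cd dc by blast
qed

end
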